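(* Let $N\ge 3$, $m=\frac{N-2}{N+2}$, $n=1-m$, $C^*=\frac{2m((1-m)N-2)}{n}$, $\beta_0=\frac{2}{\sqrt{N-2}}$, $\beta_1=\frac1{2m}$. For $\beta>0$ put $\alpha=\frac{1+2\beta}{n}$ and consider the elliptic equation $$(E)\qquad \Delta f^{m}+\beta\, y\cdot\nabla f+\alpha f=0\quad\text{on }\mathbb R^N ,$$ and the asymptotic expansion $$(A)\qquad f(y)=\Big(\frac{C^*}{|y|^2}\Big)^{1/n}\big(1-B|y|^{-\gamma}+o(|y|^{-\gamma})\big),\qquad |y|\to\infty .$$ Let $\gamma_1\le\gamma_2$ be $\gamma_{1,2}=\frac{\beta(N-2)\mp\sqrt{\beta^2(N-2)^2-4(N-2)}}{2}$. Then: (1) If $N\ge 6$ and $\beta>\beta_0$, or $3\le N<6$ and $\beta>\beta_1$: for every $B>0$ there exists a unique radially symmetric smooth positive solution $f_{\beta,B}$ of $(E)$ satisfying $(A)$ with $\gamma=\gamma_1$. (2) If $3\le N<6$ and $\beta_0<\beta<\beta_1$: for every $B<0$ there exists a unique radially symmetric smooth positive solution $f_{\beta,B}$ of $(E)$ satisfying $(A)$ with $\gamma=\gamma_1$. (3) If $3\le N<6$ and $\beta=\beta_1$: for every $B>0$ there exists a unique radially symmetric smooth positive solution $f_{\beta,B}$ of $(E)$ satisfying $(A)$ with $\gamma=\gamma_2=2$, and it is given in closed form by $f_{\beta,B}(y)=\big(\frac{C^*}{\lambda^2+|y|^2}\big)^{1/n}$ for some $\lambda>0$.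
   Context: The $o$-term in the expansion may depend on $B$. Solutions $f$ of $(E)$ are exactly the profiles of self-similar solutions $U(x,t)=(T-t)^\alpha f(x(T-t)^\beta)$ of the fast diffusion equation $u_t=\Delta u^m$. Note $C^*=\frac{(N-2)^2}{N+2}$ is the constant for which $\big(C^*(T-t)/|x|^2\big)^{1/n}$ solves $u_t=\Delta u^m$ on $(\mathbb R^N\setminus\{0\})\times(-\infty,T)$. *)

theory Defs
  imports "HOL-Analysis.Analysis" "HOL-Library.Landau_Symbols"
begin

definition m_exp :: "nat \<Rightarrow> real" where
  "m_exp N = (real N - 2) / (real N + 2)"

definition n_exp :: "nat \<Rightarrow> real" where
  "n_exp N = 1 - m_exp N"

definition C_star :: "nat \<Rightarrow> real" where
  "C_star N = 2 * m_exp N * ((1 - m_exp N) * real N - 2) / n_exp N"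

definition beta0 :: "nat \<Rightarrow> real" where
  "beta0 N = 2 / sqrt (real N - 2)"

definition beta1 :: "nat \<Rightarrow> real" where
  "beta1 N = 1 / (2 * m_exp N)"

definition alpha :: "nat \<Rightarrow> real \<Rightarrow> real" where
  "alpha N \<beta> = (1 + 2 * \<beta>) / n_exp N"

definition gamma1 :: "nat \<Rightarrow> real \<Rightarrow> real" where
  "gamma1 N \<beta> = (\<beta> * (real N - 2) - sqrt (\<beta>\<^sup>2 * (real N - 2)\<^sup>2 - 4 * (real N - 2))) / 2"

definition gamma2 :: "nat \<Rightarrow> real \<Rightarrow> real" where
  "gamma2 N \<beta> = (\<beta> * (real N - 2) + sqrt (\<beta>\<^sup>2 * (real N - 2)\<^sup>2 - 4 * (real N - 2))) / 2"

text \<open>The total function \<^const>\<open>frechet_derivative\<close> is unspecified at points where \<open>u\<close> is not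
  differentiable; below the operators are applied to a smooth \<open>f\<close> and, when \<open>f\<close> is also
  positive, to its smooth power \<open>f\<^sup>m\<close>.\<close>

definition partial_deriv :: "'n::finite \<Rightarrow> (real ^ 'n \<Rightarrow> real) \<Rightarrow> real ^ 'n \<Rightarrow> real" where
  "partial_deriv i u x = frechet_derivative u (at x) (axis i 1)"

definition gradient :: "(real ^ 'n::finite \<Rightarrow> real) \<Rightarrow> real ^ 'n \<Rightarrow> real ^ 'n" where
  "gradient u x = (\<chi> i. partial_deriv i u x)"

definition laplacian :: "(real ^ 'n::finite \<Rightarrow> real) \<Rightarrow> real ^ 'n \<Rightarrow> real" where
  "laplacian u x = (\<Sum>i\<in>UNIV. partial_deriv i (partial_deriv i u) x)"

primrec C_k :: "nat \<Rightarrow> (real ^ 'n::finite \<Rightarrow> real) \<Rightarrow> bool" where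
  "C_k 0 u \<longleftrightarrow> continuous_on UNIV u"
| "C_k (Suc k) u \<longleftrightarrow> u differentiable_on UNIV \<and> (\<forall>i. C_k k (partial_deriv i u))"

definition smooth :: "(real ^ 'n::finite \<Rightarrow> real) \<Rightarrow> bool" where
  "smooth u \<longleftrightarrow> (\<forall>k. C_k k u)"

definition radially_symmetric :: "(real ^ 'n::finite \<Rightarrow> real) \<Rightarrow> bool" where
  "radially_symmetric u \<longleftrightarrow> (\<forall>x y. norm x = norm y \<longrightarrow> u x = u y)"

definition solves_E :: "real \<Rightarrow> (real ^ 'n::finite \<Rightarrow> real) \<Rightarrow> bool" where
  "solves_E \<beta> f \<longleftrightarrow>
     (\<forall>y. laplacian (\<lambda>x. f x powr m_exp CARD('n)) y
          + \<beta> * (y \<bullet> gradient f y) + alpha CARD('n) \<beta> * f y = 0)"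

definition radial_smooth_positive_solution :: "real \<Rightarrow> (real ^ 'n::finite \<Rightarrow> real) \<Rightarrow> bool" where
  "radial_smooth_positive_solution \<beta> f \<longleftrightarrow>
     radially_symmetric f \<and> smooth f \<and> (\<forall>y. f y > 0) \<and> solves_E \<beta> f"

definition expansion_A :: "real \<Rightarrow> real \<Rightarrow> (real ^ 'n::finite \<Rightarrow> real) \<Rightarrow> bool" where
  "expansion_A B \<gamma> f \<longleftrightarrow>
     (\<exists>r. r \<in> o[at_infinity](\<lambda>y. norm y powr - \<gamma>) \<and>
          (\<forall>\<^sub>F y in at_infinity.
             f y = (C_star CARD('n) / (norm y)\<^sup>2) powr (1 / n_exp CARD('n))
                     * (1 - B * norm y powr - \<gamma> + r y)))"

end

theory Submission
  imports Defs "HOL-Real_Asymp.Real_Asymp"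
begin

text \<open>Write \<open>f powr m = g\<close>, \<open>r = exp s\<close> and \<open>g = C\<^sub>* powr (k / 2) * r powr (- k) * v s\<close> with
  \<open>k = (N - 2) / 2\<close>, \<open>p = 1 / m = 1 + 2 / k\<close> and \<open>b = \<beta> C\<^sub>*\<close>. The radial equation becomes the autonomous equation
  \<open>v'' + b (v powr p)' + k\<^sup>2 (v powr p - v) = 0\<close>, and the scaling \<open>f(y) \<mapsto> \<mu> powr (2 / n) * f(\<mu> y)\<close> is translation in \<open>s\<close>.
  Solutions regular at the origin form the single orbit leaving \<open>v = 0\<close>, so everything depends on how this
  orbit approaches \<open>v = 1\<close>, where the linearised decay rates are \<open>\<gamma>\<^sub>1 < \<gamma>\<^sub>2\<close>: the expansion (A) with \<open>\<gamma> = \<gamma>\<^sub>1\<close> says that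
  \<open>(v - 1) exp (\<gamma>\<^sub>1 s)\<close> has a nonzero limit, and its sign is the sign of \<open>- B\<close>.

  For \<open>b = k\<close>, that is \<open>\<beta> = \<beta>\<^sub>1\<close>, the orbit is the explicit curve \<open>v' = k (v - v powr p)\<close>, with rate \<open>2\<close>. In general the
  curves \<open>v' = l (v - v powr p)\<close> with \<open>l = \<gamma> k / 2\<close> are barriers for suitable \<open>\<gamma>\<close> between \<open>\<gamma>\<^sub>1\<close> and \<open>\<gamma>\<^sub>2\<close>. If \<open>\<gamma>\<^sub>2 > 2\<close> such a barrier traps
  the orbit below \<open>1\<close>; if \<open>\<gamma>\<^sub>2 < 2\<close> the orbit overshoots \<open>1\<close> once and is then trapped above it. In both cases the
  barrier keeps the decay rate away from \<open>\<gamma>\<^sub>2\<close>, and a Riccati argument identifies it as \<open>\<gamma>\<^sub>1\<close>.\<close>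

section \<open>An integro-differential equation of Volterra type\<close>

text \<open>The obstacle at the origin is the singular term \<open>(N - 1) / r\<close>.
  Multiplication by \<open>r ^ (N - 1)\<close> puts the radial equation in divergence form, and the
  substitution \<open>\<rho> = r * s\<close> in its integral from \<open>0\<close> to
  \<open>r\<close> produces the average \<open>wavg (N - 1)\<close>, which sees only values between
  \<open>0\<close> and \<open>t\<close>. Existence, smoothness at the origin and uniqueness all rest
  on this integrated form. Its nonlocal coefficient is a multiple of \<open>k - b\<close>, which is
  why \<open>b = k\<close> is solvable by hand.

  The number 2 is the threshold because a barrier with constant \<open>l\<close> leaves
  \<open>0\<close> at rate \<open>l\<close> and approaches \<open>1\<close> at rate
  \<open>l * (p - 1)\<close>, which is 2 for \<open>l = k\<close>, while the orbit itself leaves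
  \<open>0\<close> at rate \<open>k\<close>; moreover \<open>(2 - \<gamma>\<^sub>1) * (2 -
  \<gamma>\<^sub>2) = 2 * p * (k - b)\<close>. A barrier with \<open>l > k\<close> starts above the
  orbit, and near \<open>1\<close> a rate strictly between the two roots gives the sign that traps.

  Once \<open>(v - 1) * exp (\<gamma> * s)\<close> has a nonzero limit, translation by
  \<open>ln \<mu>\<close> multiplies \<open>B\<close> by a power of \<open>\<mu>\<close>, so that
  \<open>B\<close> runs exactly once through a half-line.\<close>

definition wavg :: "nat \<Rightarrow> (real \<Rightarrow> real) \<Rightarrow> real \<Rightarrow> real" where
  "wavg j \<phi> t = integral {0..1} (\<lambda>s. s ^ j * \<phi> (t * s\<^sup>2))"

lemma continuous_on_wavg_integrand:
  fixes \<phi> :: "real \<Rightarrow> real"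
  assumes "continuous_on {0..} \<phi>"
  shows "continuous_on ({0..} \<times> {0..1}) (\<lambda>(t, s). s ^ j * \<phi> (t * s\<^sup>2))"
proof -
  have "continuous_on ({0..} \<times> {0..1}) (\<lambda>z::real \<times> real. \<phi> (fst z * (snd z)\<^sup>2))"
    by (rule continuous_on_compose2[OF assms]) (auto intro!: continuous_intros)
  then show ?thesis
    by (auto simp: split_beta intro!: continuous_intros)
qed

lemma continuous_on_wavg:
  assumes "continuous_on {0..} \<phi>"
  shows "continuous_on {0..} (wavg j \<phi>)"
  using integral_continuous_on_param[of "{0..}" "0::real" "1::real" "\<lambda>t s. s ^ j * \<phi> (t * s\<^sup>2)"]
    continuous_on_wavg_integrand[OF assms, of j]
  by (simp add: wavg_def[abs_def])

lemma wavg_integrand_continuous: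
  fixes \<phi> :: "real \<Rightarrow> real"
  assumes "continuous_on {0..} \<phi>" "t \<ge> 0"
  shows "continuous_on {0..1} (\<lambda>s. s ^ j * \<phi> (t * s\<^sup>2))"
proof -
  have "continuous_on {0..1} (\<lambda>s. \<phi> (t * s\<^sup>2))"
    by (rule continuous_on_compose2[OF assms(1)]) (use assms(2) in \<open>auto intro!: continuous_intros\<close>)
  then show ?thesis
    by (auto intro!: continuous_intros)
qed

lemma wavg_integrable:
  fixes \<phi> :: "real \<Rightarrow> real"
  assumes "continuous_on {0..} \<phi>" "t \<ge> 0"
  shows "(\<lambda>s. s ^ j * \<phi> (t * s\<^sup>2)) integrable_on {0..1}"
  using wavg_integrand_continuous[OF assms, of j] by (rule integrable_continuous_real)

lemma wavg_diff:
  assumes "continuous_on {0..} \<phi>" "continuous_on {0..} \<psi>" "t \<ge> 0"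
  shows "wavg j \<phi> t - wavg j \<psi> t = wavg j (\<lambda>x. \<phi> x - \<psi> x) t"
  unfolding wavg_def
  by (subst Henstock_Kurzweil_Integration.integral_diff[symmetric])
     (use wavg_integrable[OF assms(1,3)] wavg_integrable[OF assms(2,3)] in \<open>auto simp: algebra_simps\<close>)

lemma integral_pow01: "integral {0..1} (\<lambda>s::real. s ^ j) = 1 / real (Suc j)"
proof -
  have "((\<lambda>s::real. s ^ j) has_integral (1 ^ Suc j / real (Suc j) - 0 ^ Suc j / real (Suc j))) {0..1}"
    by (rule fundamental_theorem_of_calculus)
       (auto simp del: power_Suc of_nat_Suc intro!: derivative_eq_intros
         simp flip: has_real_derivative_iff_has_vector_derivative)
  then show ?thesis by (simp add: integral_unique)
qed

lemma abs_wavg_le: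
  assumes "continuous_on {0..} \<phi>" "t \<ge> 0" "\<And>x. 0 \<le> x \<Longrightarrow> x \<le> t \<Longrightarrow> \<bar>\<phi> x\<bar> \<le> M"
  shows "\<bar>wavg j \<phi> t\<bar> \<le> M / real (Suc j)"
proof -
  have "\<bar>s ^ j * \<phi> (t * s\<^sup>2)\<bar> \<le> M * s ^ j" if "s \<in> {0..1}" for s
  proof -
    have "t * s\<^sup>2 \<le> t"
      using that assms(2) by (simp add: mult_left_le power_le_one)
    then have "\<bar>\<phi> (t * s\<^sup>2)\<bar> \<le> M"
      using assms by auto
    then show ?thesis
      using that by (auto simp: abs_mult mult.commute[of M] intro!: mult_left_mono)
  qed
  then have "norm (wavg j \<phi> t) \<le> integral {0..1} (\<lambda>s. M * s ^ j)"
    unfolding wavg_def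
    by (intro integral_norm_bound_integral wavg_integrable assms integrable_continuous_real)
       (auto intro!: continuous_intros)
  also have "\<dots> = M / real (Suc j)"
    by (simp add: integral_pow01 del: of_nat_Suc)
  finally show ?thesis by simp
qed

lemma wavg_le:
  assumes "continuous_on {0..} \<phi>" "t \<ge> 0" "\<And>x. 0 \<le> x \<Longrightarrow> x \<le> t \<Longrightarrow> \<phi> x \<le> M"
  shows "wavg j \<phi> t \<le> M / real (Suc j)"
proof -
  have "wavg j \<phi> t \<le> integral {0..1} (\<lambda>s. M * s ^ j)"
    unfolding wavg_def
  proof (rule integral_le)
    fix s :: real assume s: "s \<in> {0..1}"
    have "t * s\<^sup>2 \<le> t"
      using s assms(2) by (simp add: mult_left_le power_le_one)
    then have "\<phi> (t * s\<^sup>2) \<le> M"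
      using assms by auto
    then show "s ^ j * \<phi> (t * s\<^sup>2) \<le> M * s ^ j"
      using s by (auto simp: mult.commute[of M] intro!: mult_left_mono)
  qed (use wavg_integrable[OF assms(1,2)] in \<open>auto intro!: integrable_continuous_real continuous_intros\<close>)
  then show ?thesis
    by (simp add: integral_pow01 del: of_nat_Suc)
qed

lemma wavg_nonneg:
  assumes "continuous_on {0..} \<phi>" "t \<ge> 0" "\<And>x. \<phi> x \<ge> 0"
  shows "wavg j \<phi> t \<ge> 0"
  unfolding wavg_def
  by (rule Henstock_Kurzweil_Integration.integral_nonneg) (use assms wavg_integrable in auto)

lemma wavg_at_0: "wavg j \<phi> 0 = \<phi> 0 / real (Suc j)"
  by (simp add: wavg_def integral_pow01 del: of_nat_Suc)

text \<open>Differentiating \<open>\<phi> (t * s\<^sup>2)\<close> in \<open>t\<close> brings down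
  \<open>s\<^sup>2\<close>, so the weight index moves from \<open>j\<close> to
  \<open>j + 2\<close>.\<close>

lemma wavg_has_derivative:
  assumes der: "\<And>t. t \<ge> 0 \<Longrightarrow> (\<phi> has_real_derivative \<phi>' t) (at t within {0..})"
    and cont: "continuous_on {0..} \<phi>'" and t: "t \<ge> 0"
  shows "(wavg j \<phi> has_real_derivative wavg (j + 2) \<phi>' t) (at t within {0..})"
proof -
  have c\<phi>: "continuous_on {0..} \<phi>"
    using der by (auto simp: continuous_on_eq_continuous_within intro: DERIV_continuous)
  have "((\<lambda>x. integral (cbox 0 1) (\<lambda>s. s ^ j * \<phi> (x * s\<^sup>2))) has_field_derivative
      integral (cbox 0 1) (\<lambda>s. s ^ (j + 2) * \<phi>' (t * s\<^sup>2))) (at t within {0..})"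
  proof (rule leibniz_rule_field_derivative)
    fix x s :: real assume x: "x \<in> {0..}" and s: "s \<in> cbox 0 1"
    have im: "(\<lambda>x. x * s\<^sup>2) ` {0..} \<subseteq> {0..}" by auto
    have "(\<phi> has_real_derivative \<phi>' (x * s\<^sup>2)) (at (x * s\<^sup>2) within (\<lambda>x. x * s\<^sup>2) ` {0..})"
      by (rule has_field_derivative_subset[OF der im]) (use x in auto)
    moreover have "((\<lambda>x. x * s\<^sup>2) has_real_derivative s\<^sup>2) (at x within {0..})"
      by (auto intro!: derivative_eq_intros)
    ultimately have "((\<lambda>x. \<phi> (x * s\<^sup>2)) has_real_derivative \<phi>' (x * s\<^sup>2) * s\<^sup>2) (at x within {0..})"
      using DERIV_image_chain by (fastforce simp: o_def)
    from DERIV_cmult[OF this, of "s ^ j"]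
    show "((\<lambda>x. s ^ j * \<phi> (x * s\<^sup>2)) has_real_derivative s ^ (j + 2) * \<phi>' (x * s\<^sup>2)) (at x within {0..})"
      by (simp add: power_add power2_eq_square mult_ac)
  next
    show "continuous_on ({0..} \<times> cbox 0 1) (\<lambda>(x, t). t ^ (j + 2) * \<phi>' (x * t\<^sup>2))"
      using continuous_on_wavg_integrand[OF cont, of "j + 2"] by simp
  qed (use wavg_integrable[OF c\<phi>] t in auto)
  then show ?thesis
    by (simp add: wavg_def[abs_def])
qed

text \<open>The combined integrand is the \<open>s\<close>-derivative of
  \<open>s ^ Suc j * \<phi> (t * s\<^sup>2)\<close>, whose values at the ends are \<open>0\<close>
  and \<open>\<phi> t\<close>. The identity undoes the integration: it eliminates the average when
  the second-order equation is recovered.\<close>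

lemma wavg_ode:
  assumes der: "\<And>t. t \<ge> 0 \<Longrightarrow> (\<phi> has_real_derivative \<phi>' t) (at t within {0..})"
    and cont: "continuous_on {0..} \<phi>'" and t: "t \<ge> 0"
  shows "2 * t * wavg (j + 2) \<phi>' t + real (Suc j) * wavg j \<phi> t = \<phi> t"
proof -
  have c\<phi>: "continuous_on {0..} \<phi>"
    using der by (auto simp: continuous_on_eq_continuous_within intro: DERIV_continuous)
  have "((\<lambda>s. 2 * t * (s ^ (j + 2) * \<phi>' (t * s\<^sup>2)) + real (Suc j) * (s ^ j * \<phi> (t * s\<^sup>2)))
     has_integral (1 ^ Suc j * \<phi> (t * 1\<^sup>2) - 0 ^ Suc j * \<phi> (t * 0\<^sup>2))) {0..1}"
  proof (rule fundamental_theorem_of_calculus)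
    fix s :: real assume s: "s \<in> {0..1}"
    have im: "(\<lambda>s. t * s\<^sup>2) ` {0..1} \<subseteq> {0..}" using t by auto
    have "(\<phi> has_real_derivative \<phi>' (t * s\<^sup>2)) (at (t * s\<^sup>2) within (\<lambda>s. t * s\<^sup>2) ` {0..1})"
      by (rule has_field_derivative_subset[OF der im]) (use t in auto)
    moreover have "((\<lambda>s. t * s\<^sup>2) has_real_derivative 2 * t * s) (at s within {0..1})"
      by (auto intro!: derivative_eq_intros)
    ultimately have d: "((\<lambda>s. \<phi> (t * s\<^sup>2)) has_real_derivative \<phi>' (t * s\<^sup>2) * (2 * t * s)) (at s within {0..1})"
      using DERIV_image_chain by (fastforce simp: o_def)
    have "((\<lambda>s. s ^ Suc j * \<phi> (t * s\<^sup>2)) has_real_derivative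
        2 * t * (s ^ (j + 2) * \<phi>' (t * s\<^sup>2)) + real (Suc j) * (s ^ j * \<phi> (t * s\<^sup>2))) (at s within {0..1})"
      by (rule derivative_eq_intros d refl)+ (simp add: power_add algebra_simps power2_eq_square)
    then show "((\<lambda>s. s ^ Suc j * \<phi> (t * s\<^sup>2)) has_vector_derivative
        2 * t * (s ^ (j + 2) * \<phi>' (t * s\<^sup>2)) + real (Suc j) * (s ^ j * \<phi> (t * s\<^sup>2))) (at s within {0..1})"
      by (simp add: has_real_derivative_iff_has_vector_derivative)
  qed simp
  moreover have "((\<lambda>s. 2 * t * (s ^ (j + 2) * \<phi>' (t * s\<^sup>2)) + real (Suc j) * (s ^ j * \<phi> (t * s\<^sup>2)))
     has_integral (2 * t * wavg (j + 2) \<phi>' t + real (Suc j) * wavg j \<phi> t)) {0..1}"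
    unfolding wavg_def
    by (intro has_integral_add has_integral_mult_right integrable_integral wavg_integrable cont c\<phi> t)
  ultimately show ?thesis
    by (metis (no_types, lifting) has_integral_unique diff_0_right mult_zero_left one_power2 power_0_Suc
        mult_1 power_one mult.right_neutral)
qed

text \<open>Picard iteration converges on the whole half-line, not only locally: the average at
  \<open>t\<close> uses values on \<open>[0, t]\<close> only and the Lipschitz constant is global,
  so successive differences are bounded by terms of an exponential series.\<close>

lemma volterra_solution_exists:
  fixes \<Phi> :: "real \<Rightarrow> real" and a c L :: real
  assumes lip: "\<And>x y. \<bar>\<Phi> x - \<Phi> y\<bar> \<le> L * \<bar>x - y\<bar>"
  obtains x where "x 0 = 1" "\<And>t. t \<ge> 0 \<Longrightarrow>
    (x has_real_derivative a * \<Phi> (x t) + c * wavg j (\<lambda>u. \<Phi> (x u)) t) (at t within {0..})"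
proof -
  have L0: "L \<ge> 0"
    using lip[of 1 0] by simp
  have cont\<Phi>: "continuous_on S \<Phi>" for S
  proof -
    have "L-lipschitz_on S \<Phi>"
      using lip L0 by (auto simp: lipschitz_on_def dist_real_def)
    then show ?thesis by (rule lipschitz_on_continuous_on)
  qed
  define Q where "Q x t = a * \<Phi> (x t) + c * wavg j (\<lambda>u. \<Phi> (x u)) t" for x t
  \<comment> \<open>The averaging weight has mass \<open>1 / real (Suc j)\<close>, at most
    \<open>1\<close>, so the nonlocal term contributes no more than
    \<open>\<bar>c\<bar> * L\<close>.\<close>
  define M where "M = (\<bar>a\<bar> + \<bar>c\<bar>) * L"
  have M0: "M \<ge> 0" using L0 by (simp add: M_def)
  have contPhi: "continuous_on {0..} (\<lambda>u. \<Phi> (x u))" if "continuous_on {0..} x" for x :: "real \<Rightarrow> real"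
    using continuous_on_compose2[OF cont\<Phi> that] by auto
  have contQ: "continuous_on {0..} (Q x)" if "continuous_on {0..} x" for x
    unfolding Q_def using contPhi[OF that] by (intro continuous_intros continuous_on_wavg)
  have Qdiff: "\<bar>Q x t - Q y t\<bar> \<le> M * A"
    if cx: "continuous_on {0..} x" and cy: "continuous_on {0..} y" and t: "t \<ge> 0"
      and xy: "\<And>u. 0 \<le> u \<Longrightarrow> u \<le> t \<Longrightarrow> \<bar>x u - y u\<bar> \<le> A" for x y t A
  proof -
    have bd: "\<bar>\<Phi> (x u) - \<Phi> (y u)\<bar> \<le> L * A" if "0 \<le> u" "u \<le> t" for u
      using lip[of "x u" "y u"] mult_left_mono[OF xy[OF that] L0] by simp
    have LA: "0 \<le> L * A" using bd[of 0] t by (smt (verit))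
    have "\<bar>wavg j (\<lambda>u. \<Phi> (x u)) t - wavg j (\<lambda>u. \<Phi> (y u)) t\<bar> \<le> (L * A) / real (Suc j)"
      unfolding wavg_diff[OF contPhi[OF cx] contPhi[OF cy] t]
      by (rule abs_wavg_le) (use bd t cx cy contPhi in \<open>auto intro!: continuous_intros\<close>)
    also have "\<dots> \<le> L * A"
      using divide_left_mono[of 1 "real (Suc j)" "L * A"] LA by simp
    finally have w: "\<bar>wavg j (\<lambda>u. \<Phi> (x u)) t - wavg j (\<lambda>u. \<Phi> (y u)) t\<bar> \<le> L * A" .
    have "Q x t - Q y t = a * (\<Phi> (x t) - \<Phi> (y t)) + c * (wavg j (\<lambda>u. \<Phi> (x u)) t - wavg j (\<lambda>u. \<Phi> (y u)) t)"
      by (simp add: Q_def algebra_simps)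
    also have "\<bar>\<dots>\<bar> \<le> \<bar>a\<bar> * \<bar>\<Phi> (x t) - \<Phi> (y t)\<bar> + \<bar>c\<bar> * \<bar>wavg j (\<lambda>u. \<Phi> (x u)) t - wavg j (\<lambda>u. \<Phi> (y u)) t\<bar>"
      by (metis abs_mult abs_triangle_ineq)
    also have "\<dots> \<le> \<bar>a\<bar> * (L * A) + \<bar>c\<bar> * (L * A)"
      using w bd[of t] t by (intro add_mono mult_left_mono) auto
    finally show ?thesis by (simp add: M_def algebra_simps)
  qed
  define X where "X = rec_nat (\<lambda>_. 1) (\<lambda>_ x t. 1 + integral {0..t} (Q x))"
  have X0: "X 0 = (\<lambda>_. 1)" and XS: "X (Suc n) = (\<lambda>t. 1 + integral {0..t} (Q (X n)))" for n
    by (simp_all add: X_def)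
  have intQ: "Q x integrable_on {0..t}" if "continuous_on {0..} x" for x t
    using continuous_on_subset[OF contQ[OF that], of "{0..t}"] by (intro integrable_continuous_real) auto
  have derI: "((\<lambda>t. integral {0..t} g) has_real_derivative g t) (at t within {0..})"
    if g: "continuous_on {0..} g" and t: "t \<ge> 0" for g :: "real \<Rightarrow> real" and t
  proof -
    have "((\<lambda>t. integral {0..t} g) has_vector_derivative g t) (at t within {0..t+1})"
      by (rule integral_has_vector_derivative) (use t g in \<open>auto intro: continuous_on_subset\<close>)
    moreover have "at t within {0..t+1} = at t within {0..}"
      by (rule at_within_nhd[of _ "{..<t+1}"]) auto
    ultimately show ?thesis
      by (simp add: has_real_derivative_iff_has_vector_derivative)
  qed
  have cX: "continuous_on {0..} (X n)" for n
  proof (induction n)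
    case (Suc n)
    have "continuous_on {0..} (\<lambda>t. integral {0..t} (Q (X n)))"
      unfolding continuous_on_eq_continuous_within
      using derI[OF contQ[OF Suc]] by (auto intro: DERIV_continuous)
    then show ?case unfolding XS by (rule continuous_on_add[OF continuous_on_const])
  qed (simp add: X0)
  \<comment> \<open>\<open>K\<close> bounds the right-hand side at the constant initial iterate
    \<open>1\<close>.\<close>
  define K where "K = \<bar>a * \<Phi> 1\<bar> + \<bar>c\<bar> * \<bar>\<Phi> 1\<bar>"
  have K0: "K \<ge> 0" by (simp add: K_def)
  have step: "\<bar>X (Suc n) t - X n t\<bar> \<le> K * M ^ n * t ^ Suc n / fact (Suc n)" if "t \<ge> 0" for n t
    using that
  proof (induction n arbitrary: t)
    case 0
    have "norm (integral {0..t} (Q (X 0))) \<le> integral {0..t} (\<lambda>_. K)"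
    proof (rule integral_norm_bound_integral)
      fix u assume u: "u \<in> {0..t}"
      have "\<bar>wavg j (\<lambda>_. \<Phi> 1) u\<bar> \<le> \<bar>\<Phi> 1\<bar> / real (Suc j)"
        by (rule abs_wavg_le) (use u in auto)
      also have "\<dots> \<le> \<bar>\<Phi> 1\<bar>" by (simp add: field_simps mult_left_le)
      finally have "\<bar>c\<bar> * \<bar>wavg j (\<lambda>_. \<Phi> 1) u\<bar> \<le> \<bar>c\<bar> * \<bar>\<Phi> 1\<bar>"
        by (rule mult_left_mono) simp
      then show "norm (Q (X 0) u) \<le> K"
        using abs_triangle_ineq[of "a * \<Phi> 1" "c * wavg j (\<lambda>_. \<Phi> 1) u"]
        by (simp add: Q_def X0 K_def abs_mult)
    qed (use intQ[OF cX] in auto)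
    then show ?case using 0 by (simp add: XS X0 mult.commute)
  next
    case (Suc n)
    have "X (Suc (Suc n)) t - X (Suc n) t = integral {0..t} (\<lambda>u. Q (X (Suc n)) u - Q (X n) u)"
      by (subst Henstock_Kurzweil_Integration.integral_diff[OF intQ[OF cX] intQ[OF cX]]) (simp add: XS)
    also have "norm \<dots> \<le> integral {0..t} (\<lambda>u. K * M ^ Suc n * (u ^ Suc n / fact (Suc n)))"
    proof (rule integral_norm_bound_integral)
      fix u assume u: "u \<in> {0..t}"
      have "\<bar>Q (X (Suc n)) u - Q (X n) u\<bar> \<le> M * (K * M ^ n * u ^ Suc n / fact (Suc n))"
      proof (rule Qdiff[OF cX cX])
        fix r assume r: "0 \<le> r" "r \<le> u"
        have "K * M ^ n * r ^ Suc n / fact (Suc n) \<le> K * M ^ n * u ^ Suc n / fact (Suc n)"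
          using r K0 M0 by (intro divide_right_mono mult_left_mono power_mono) auto
        then show "\<bar>X (Suc n) r - X n r\<bar> \<le> K * M ^ n * u ^ Suc n / fact (Suc n)"
          using Suc.IH[of r] r by simp
      qed (use u in auto)
      then show "norm (Q (X (Suc n)) u - Q (X n) u) \<le> K * M ^ Suc n * (u ^ Suc n / fact (Suc n))"
        by (simp add: mult_ac)
    next
      show "(\<lambda>u. Q (X (Suc n)) u - Q (X n) u) integrable_on {0..t}"
        by (intro integrable_diff intQ cX)
    qed (auto intro!: integrable_continuous_real continuous_intros)
    also have "integral {0..t} (\<lambda>u. K * M ^ Suc n * (u ^ Suc n / fact (Suc n))) =
        K * M ^ Suc n * (t ^ Suc (Suc n) / fact (Suc (Suc n)))"
    proof -
      have "((\<lambda>u. u ^ Suc n / fact (Suc n)) has_integral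
          (t ^ Suc (Suc n) / fact (Suc (Suc n)) - 0 ^ Suc (Suc n) / fact (Suc (Suc n)))) {0..t}"
      proof (rule fundamental_theorem_of_calculus)
        fix u assume "u \<in> {0..t}"
        have "((\<lambda>u. u ^ Suc (Suc n) / fact (Suc (Suc n))) has_real_derivative
            real (Suc (Suc n)) * u ^ Suc n / fact (Suc (Suc n))) (at u within {0..t})"
          by (auto intro!: derivative_eq_intros simp del: power_Suc of_nat_Suc fact_Suc)
        also have "real (Suc (Suc n)) * u ^ Suc n / fact (Suc (Suc n)) = u ^ Suc n / fact (Suc n)"
          by (subst fact_Suc[of "Suc n"]) (simp del: fact_Suc of_nat_Suc power_Suc)
        finally show "((\<lambda>u. u ^ Suc (Suc n) / fact (Suc (Suc n))) has_vector_derivative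
            u ^ Suc n / fact (Suc n)) (at u within {0..t})"
          by (simp add: has_real_derivative_iff_has_vector_derivative)
      qed (use Suc.prems in simp)
      from integral_unique[OF has_integral_mult_right[OF this, of "K * M ^ Suc n"]] show ?thesis
        by (simp del: fact_Suc power_Suc add: power_0_Suc)
    qed
    finally show ?case by (simp del: fact_Suc power_Suc)
  qed
  define x where "x t = 1 + (\<Sum>i. X (Suc i) t - X i t)" for t
  have unif: "uniform_limit {0..T} X x sequentially" if T: "T \<ge> 0" for T
  proof -
    have "uniform_limit {0..T} (\<lambda>n t. \<Sum>i<n. X (Suc i) t - X i t) (\<lambda>t. \<Sum>i. X (Suc i) t - X i t) sequentially"
    proof (rule Weierstrass_m_test)
      fix n t assume t: "t \<in> {0..T}"
      have "\<bar>X (Suc n) t - X n t\<bar> \<le> K * M ^ n * t ^ Suc n / fact (Suc n)"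
        using step t by auto
      also have "\<dots> \<le> K * M ^ n * T ^ Suc n / fact n"
      proof (intro frac_le mult_left_mono power_mono)
        show "fact n \<le> (fact (Suc n) :: real)" by (rule fact_mono) auto
      qed (use t K0 M0 in auto)
      finally show "norm (X (Suc n) t - X n t) \<le> K * T * (inverse (fact n) * (M * T) ^ n)"
        by (simp add: power_mult_distrib field_simps)
    qed (intro summable_mult summable_exp)
    then have "uniform_limit {0..T} (\<lambda>n t. 1 + (\<Sum>i<n. X (Suc i) t - X i t)) x sequentially"
      unfolding x_def by (intro uniform_limit_add uniform_limit_const)
    moreover have "1 + (\<Sum>i<n. X (Suc i) t - X i t) = X n t" for n t
      by (induction n) (simp_all add: X0)
    ultimately show ?thesis by simp
  qed
  have cx: "continuous_on {0..} x"
  proof -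
    have "continuous_on {0..T} x" if "T \<ge> 0" for T
      by (rule uniform_limit_theorem[OF _ unif[OF that]])
         (auto intro!: always_eventually continuous_on_subset[OF cX])
    show ?thesis unfolding continuous_on_eq_continuous_within
    proof
      fix t :: real assume t: "t \<in> {0..}"
      have "continuous (at t within {0..t+1}) x"
        using \<open>\<And>T. T \<ge> 0 \<Longrightarrow> continuous_on {0..T} x\<close>[of "t+1"] t
        by (auto simp: continuous_on_eq_continuous_within)
      moreover have "at t within {0..t+1} = at t within {0..}"
        by (rule at_within_nhd[of _ "{..<t+1}"]) auto
      ultimately show "continuous (at t within {0..}) x" by simp
    qed
  qed
  have xeq: "x t = 1 + integral {0..t} (Q x)" if t: "t \<ge> 0" for t
  proof (rule LIMSEQ_unique)
    show "(\<lambda>n. X (Suc n) t) \<longlonglongrightarrow> x t"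
      using tendsto_uniform_limitI[OF unif[OF t], of t] t by (intro LIMSEQ_Suc) auto
    show "(\<lambda>n. X (Suc n) t) \<longlonglongrightarrow> 1 + integral {0..t} (Q x)"
    proof (rule LIMSEQ_I)
      fix e :: real assume e: "e > 0"
      define d where "d = e / 2 / (M * t + 1)"
      have den: "M * t + 1 > 0" using M0 t by (smt (verit) mult_nonneg_nonneg)
      have d: "d > 0" unfolding d_def using e den by simp
      obtain n0 where n0: "\<And>n u. n \<ge> n0 \<Longrightarrow> u \<in> {0..t} \<Longrightarrow> dist (X n u) (x u) < d"
        using uniform_limitD[OF unif[OF t] d] unfolding eventually_sequentially by blast
      show "\<exists>no. \<forall>n\<ge>no. norm (X (Suc n) t - (1 + integral {0..t} (Q x))) < e"
      proof (intro exI[of _ n0] allI impI)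
        fix n assume n: "n \<ge> n0"
        have "X (Suc n) t - (1 + integral {0..t} (Q x)) = integral {0..t} (\<lambda>u. Q (X n) u - Q x u)"
          by (subst Henstock_Kurzweil_Integration.integral_diff[OF intQ[OF cX] intQ[OF cx]]) (simp add: XS)
        also have "norm \<dots> \<le> integral {0..t} (\<lambda>u. M * d)"
        proof (rule integral_norm_bound_integral)
          fix u assume u: "u \<in> {0..t}"
          show "norm (Q (X n) u - Q x u) \<le> M * d"
            using Qdiff[OF cX cx, of u n d] n0[OF n] u by (auto simp: dist_real_def less_imp_le)
        next
          show "(\<lambda>u. Q (X n) u - Q x u) integrable_on {0..t}"
            by (intro integrable_diff intQ cX cx)
        qed auto
        also have "\<dots> = M * t * d" using t by simp
        also have "\<dots> \<le> (M * t + 1) * d" using d by (simp add: algebra_simps)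
        also have "\<dots> = e / 2"
          unfolding d_def using den by (metis less_irrefl nonzero_mult_div_cancel_left times_divide_eq_right)
        also have "\<dots> < e" using e by simp
        finally show "norm (X (Suc n) t - (1 + integral {0..t} (Q x))) < e" .
      qed
    qed
  qed
  have x0: "x 0 = 1" using xeq[of 0] by simp
  have "(x has_real_derivative Q x t) (at t within {0..})" if t: "t \<ge> 0" for t
  proof -
    have "((\<lambda>t. 1 + integral {0..t} (Q x)) has_real_derivative Q x t) (at t within {0..})"
      using derI[OF contQ[OF cx] t] by (auto intro!: derivative_eq_intros)
    then show ?thesis
      by (rule has_field_derivative_transform_within[where d=1]) (use t xeq in auto)
  qed
  then show ?thesis
    using that[of x] x0 by (simp add: Q_def)
qed

section \<open>Barriers and exponential decay\<close>

text \<open>The zero is the infimum of the closed set where \<open>F \<le> 0\<close>; a negative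
  value there would force an earlier zero by the intermediate value theorem. Applied to a minimum of
  several quantities, it gives the first time at which a region is left.\<close>

lemma first_zero:
  fixes F :: "real \<Rightarrow> real"
  assumes cont: "continuous_on {a..s} F" and Fa: "F a > 0" and s: "s \<ge> a" "F s \<le> 0"
  obtains z where "z > a" "z \<le> s" "F z = 0" "\<And>r. a \<le> r \<Longrightarrow> r < z \<Longrightarrow> F r > 0"
proof -
  define Z where "Z = {r \<in> {a..s}. F r \<le> 0}"
  have "closed Z"
    unfolding Z_def using continuous_closed_preimage[OF cont, of "{..0}"] by (simp add: vimage_def Int_def)
  moreover have ne: "Z \<noteq> {}" using s by (auto simp: Z_def)
  moreover have bd: "bdd_below Z" by (auto simp: Z_def)
  ultimately have z: "Inf Z \<in> Z" by (intro closed_contains_Inf)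
  define z where "z = Inf Z"
  have before: "F r > 0" if "a \<le> r" "r < z" for r
  proof (rule ccontr)
    assume "\<not> F r > 0"
    then have "r \<in> Z" using that z by (auto simp: Z_def z_def)
    then have "z \<le> r" unfolding z_def using bd by (rule cInf_lower)
    then show False using that by simp
  qed
  have za: "z > a" using z Fa by (cases "z = a") (auto simp: z_def Z_def)
  have "F z = 0"
  proof (rule ccontr)
    assume "F z \<noteq> 0"
    then have neg: "F z < 0" using z by (auto simp: Z_def z_def)
    have "continuous_on {a..z} F" using cont z by (auto simp: z_def Z_def intro: continuous_on_subset)
    then obtain y where y: "a \<le> y" "y \<le> z" "F y = 0"
      using IVT2'[of F z 0 a] neg Fa za by auto
    then show False using before[of y] neg by (cases "y = z") auto
  qed
  moreover have "z \<le> s" using z by (auto simp: z_def Z_def)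
  ultimately show ?thesis using that za before by blast
qed

text \<open>At a first zero \<open>f\<close> would arrive from positive values, which a positive
  derivative forbids; so the sign of the derivative matters only where \<open>f\<close>
  vanishes.\<close>

lemma barrier_pos:
  fixes f f' :: "real \<Rightarrow> real"
  assumes der: "\<And>r. a \<le> r \<Longrightarrow> r \<le> s \<Longrightarrow> (f has_real_derivative f' r) (at r)" and fa: "f a > 0"
    and crossing: "\<And>r. a < r \<Longrightarrow> r \<le> s \<Longrightarrow> f r = 0 \<Longrightarrow> f' r > 0"
    and s: "s \<ge> a"
  shows "f s > 0"
proof (rule ccontr)
  assume "\<not> f s > 0"
  moreover have "continuous_on {a..s} f"
    using der by (auto intro!: continuous_at_imp_continuous_on DERIV_isCont)
  ultimately obtain z where z: "z > a" "z \<le> s" "f z = 0" "\<And>r. a \<le> r \<Longrightarrow> r < z \<Longrightarrow> f r > 0"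
    using first_zero[of a s f thesis] fa s by fastforce
  obtain d where d: "d > 0" "\<And>h. 0 < h \<Longrightarrow> h < d \<Longrightarrow> f (z - h) < f z"
    using DERIV_pos_inc_left[OF der crossing[OF z(1-3)]] z(1,2) by auto
  define h where "h = min (d / 2) (z - a)"
  have "0 < h" "h < d" "a \<le> z - h" using d(1) z(1) by (auto simp: h_def)
  then show False using d(2)[of h] z(3) z(4)[of "z - h"] by simp
qed

lemma mono_bounded_tendsto_at_top:
  fixes f :: "real \<Rightarrow> real"
  assumes mono: "\<And>x y. a \<le> x \<Longrightarrow> x \<le> y \<Longrightarrow> f x \<le> f y" and bd: "\<And>x. a \<le> x \<Longrightarrow> f x \<le> B"
  obtains L where "(f \<longlongrightarrow> L) at_top" "\<And>x. a \<le> x \<Longrightarrow> f x \<le> L"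
proof -
  have bdd: "bdd_above (f ` {a..})" using bd by (auto intro!: bdd_aboveI[of _ B])
  define L where "L = Sup (f ` {a..})"
  have le: "f x \<le> L" if "a \<le> x" for x
    unfolding L_def by (rule cSup_upper) (use that bdd in auto)
  have "(f \<longlongrightarrow> L) at_top"
  proof (rule increasing_tendsto)
    show "\<forall>\<^sub>F x in at_top. f x \<le> L"
      using eventually_ge_at_top[of a] by eventually_elim (rule le)
    fix y assume "y < L"
    then obtain x where x: "x \<ge> a" "y < f x"
      unfolding L_def using less_cSup_iff[OF _ bdd] by auto
    show "\<forall>\<^sub>F x in at_top. y < f x"
      using eventually_ge_at_top[of x] by eventually_elim (use x mono in fastforce)
  qed
  then show ?thesis using that le by blast
qed

text \<open>The Riccati equation satisfied by the decay rate \<open>q\<close> has the attracting rest point \<open>g1\<close> and the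
  repelling one \<open>g2\<close>; a trajectory kept away from \<open>g2\<close> converges to \<open>g1\<close> exponentially fast.\<close>

lemma riccati_rate:
  fixes x q \<epsilon> :: "real \<Rightarrow> real"
  assumes pos: "\<And>s. s \<ge> S \<Longrightarrow> x s > 0"
    and derx: "\<And>s. s \<ge> S \<Longrightarrow> (x has_real_derivative - q s * x s) (at s)"
    and derq: "\<And>s. s \<ge> S \<Longrightarrow> (q has_real_derivative (q s - g1) * (q s - g2) + \<epsilon> s) (at s)"
    and eps: "\<And>s. s \<ge> S \<Longrightarrow> \<bar>\<epsilon> s\<bar> \<le> C * x s"
    and qle: "\<And>s. s \<ge> S \<Longrightarrow> q s \<le> g" and g: "g < g2" and g1: "0 < g1"
    and x0: "(x \<longlongrightarrow> 0) at_top"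
  obtains A where "A > 0" "((\<lambda>s. x s * exp (g1 * s)) \<longlongrightarrow> A) at_top"
proof -
  define \<delta> where "\<delta> = g2 - g"
  have \<delta>: "\<delta> > 0" using g by (simp add: \<delta>_def)
  have C0: "C \<ge> 0"
    using eps[of S] pos[of S] by (smt (verit) mult_neg_pos)
  have "(\<epsilon> \<longlongrightarrow> 0) at_top"
  proof (rule Lim_null_comparison)
    show "\<forall>\<^sub>F s in at_top. norm (\<epsilon> s) \<le> C * x s"
      using eventually_ge_at_top[of S] by eventually_elim (use eps in auto)
    show "((\<lambda>s. C * x s) \<longlongrightarrow> 0) at_top"
      using tendsto_mult_right_zero[OF x0] by simp
  qed
  then have "\<forall>\<^sub>F s in at_top. \<bar>\<epsilon> s\<bar> < \<delta> * g1 / 8"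
    using \<delta> g1 by (auto dest!: tendstoD[where e="\<delta> * g1 / 8"])
  then obtain S0 where S0: "\<And>s. s \<ge> S0 \<Longrightarrow> \<bar>\<epsilon> s\<bar> < \<delta> * g1 / 8"
    by (auto simp: eventually_at_top_linorder)
  define S1 where "S1 = max S S0"
  define X where "X = \<bar>q S1 - g1\<bar> + 1"
  have X: "X > 0" by (simp add: X_def)
  \<comment> \<open>Nothing bounds \<open>q\<close> from below yet. While \<open>q < g1\<close> the
    factor \<open>g2 - q\<close> is at least \<open>\<delta>\<close>, so the gap to
    \<open>g1\<close> contracts at rate \<open>\<delta>\<close>; the barrier uses half that rate,
    and the extra margin \<open>g1 / 4\<close> absorbs \<open>\<epsilon>\<close>.\<close>
  have low: "q s - g1 + g1 / 4 + X * exp (- (\<delta> / 2) * (s - S1)) > 0" if "s \<ge> S1" for s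
  proof (rule barrier_pos[OF _ _ _ that])
    fix s assume s: "s \<ge> S1"
    show "((\<lambda>s. q s - g1 + g1 / 4 + X * exp (- (\<delta> / 2) * (s - S1))) has_real_derivative
      (q s - g1) * (q s - g2) + \<epsilon> s - (\<delta> / 2) * (X * exp (- (\<delta> / 2) * (s - S1)))) (at s)"
      using s by (auto intro!: derivative_eq_intros derq simp: S1_def)
  next
    show "q S1 - g1 + g1 / 4 + X * exp (- (\<delta> / 2) * (S1 - S1)) > 0"
      using g1 by (simp add: X_def)
  next
    fix s assume s: "s > S1" and 0: "q s - g1 + g1 / 4 + X * exp (- (\<delta> / 2) * (s - S1)) = 0"
    define e where "e = X * exp (- (\<delta> / 2) * (s - S1))"
    have e: "e > 0" using X by (simp add: e_def)
    have q: "q s - g1 = - (g1 / 4 + e)" using 0 by (simp add: e_def)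
    have "(g1 / 4 + e) * (g2 - q s) \<ge> (g1 / 4 + e) * \<delta>"
      using qle[of s] s e g1 by (intro mult_left_mono) (auto simp: \<delta>_def S1_def)
    moreover have "(q s - g1) * (q s - g2) = (g1 / 4 + e) * (g2 - q s)"
      unfolding q by (simp add: field_simps)
    moreover have "\<bar>\<epsilon> s\<bar> < \<delta> * g1 / 8" using S0 s by (auto simp: S1_def)
    moreover have "\<delta> * e > 0" using \<delta> e by simp
    moreover have "\<delta> * g1 > 0" using \<delta> g1 by simp
    ultimately have "(q s - g1) * (q s - g2) + \<epsilon> s - (\<delta> / 2) * e > 0"
      by (simp add: algebra_simps)
    then show "(q s - g1) * (q s - g2) + \<epsilon> s - (\<delta> / 2) * (X * exp (- (\<delta> / 2) * (s - S1))) > 0"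
      by (simp add: e_def)
  qed
  have "((\<lambda>s. X * exp (- (\<delta> / 2) * (s - S1))) \<longlongrightarrow> X * 0) at_top"
    using \<delta> by (intro tendsto_mult tendsto_const) real_asymp
  then have "\<forall>\<^sub>F s in at_top. X * exp (- (\<delta> / 2) * (s - S1)) < g1 / 4"
    using order_tendstoD(2)[of _ "X * 0" at_top "g1 / 4"] g1 by simp
  then obtain S2' where S2': "\<And>s. s \<ge> S2' \<Longrightarrow> X * exp (- (\<delta> / 2) * (s - S1)) < g1 / 4"
    by (auto simp: eventually_at_top_linorder)
  define S2 where "S2 = max S1 S2'"
  have S2S: "S2 \<ge> S" by (simp add: S2_def S1_def)
  have qge: "q s \<ge> g1 / 2" if "s \<ge> S2" for s
    using low[of s] S2'[of s] that by (simp add: S2_def)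
  \<comment> \<open>The rate \<open>g1 / 2\<close> is crude, but it makes \<open>\<epsilon>\<close>
    decay exponentially, hence integrable.\<close>
  have xdecay: "x s \<le> x S2 * exp (- (g1 / 2) * (s - S2))" if s: "s \<ge> S2" for s
  proof -
    have "x s * exp (g1 / 2 * (s - S2)) \<le> x S2 * exp (g1 / 2 * (S2 - S2))"
    proof (rule DERIV_nonpos_imp_nonincreasing[OF s])
      fix r assume r: "S2 \<le> r" "r \<le> s"
      have dx: "(x has_real_derivative - q r * x r) (at r)" using derx r S2S by auto
      have "((\<lambda>s. x s * exp (g1 / 2 * (s - S2))) has_real_derivative
          (g1 / 2 - q r) * (x r * exp (g1 / 2 * (r - S2)))) (at r)"
        by (auto intro!: derivative_eq_intros dx simp: algebra_simps)
      moreover have "(g1 / 2 - q r) * (x r * exp (g1 / 2 * (r - S2))) \<le> 0"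
        using qge[of r] r pos[of r] S2S by (intro mult_nonpos_nonneg mult_nonneg_nonneg) auto
      ultimately show "\<exists>y. ((\<lambda>s. x s * exp (g1 / 2 * (s - S2))) has_real_derivative y) (at r) \<and> y \<le> 0"
        by blast
    qed
    then have "x s * exp (g1 / 2 * (s - S2)) * exp (- (g1 / 2) * (s - S2)) \<le> x S2 * exp (- (g1 / 2) * (s - S2))"
      by (intro mult_right_mono) auto
    then show ?thesis by (simp add: mult.assoc flip: exp_add)
  qed
  \<comment> \<open>\<open>\<mu> \<le> g1 / 2\<close> lets \<open>E\<close> dominate
    \<open>\<epsilon>\<close>; \<open>\<mu> \<le> \<delta> / 2\<close> keeps \<open>E\<close> slower
    than the contraction of \<open>q\<close> towards \<open>g1\<close>.\<close>
  define \<mu> where "\<mu> = min (g1 / 2) (\<delta> / 2)"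
  have \<mu>: "\<mu> > 0" "\<mu> \<le> g1 / 2" "\<mu> \<le> \<delta> / 2" using g1 \<delta> by (auto simp: \<mu>_def)
  define E where "E s = exp (- \<mu> * (s - S2))" for s
  have E0: "E s > 0" for s by (simp add: E_def)
  have derE: "(E has_real_derivative - \<mu> * E s) (at s)" for s
    unfolding E_def by (auto intro!: derivative_eq_intros)
  define C1 where "C1 = C * x S2"
  have C1: "C1 \<ge> 0" using C0 pos[of S2] S2S by (simp add: C1_def)
  have epsE: "\<bar>\<epsilon> s\<bar> \<le> C1 * E s" if s: "s \<ge> S2" for s
  proof -
    have "\<bar>\<epsilon> s\<bar> \<le> C * x s" using eps s S2S by auto
    also have "\<dots> \<le> C * (x S2 * exp (- (g1 / 2) * (s - S2)))"
      using xdecay[OF s] C0 by (rule mult_left_mono)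
    also have "\<dots> \<le> C * (x S2 * E s)"
      unfolding E_def using mult_right_mono[OF \<mu>(2), of "s - S2"] s pos[of S2] S2S C0
      by (intro mult_left_mono) (auto simp: mult_right_mono)
    finally show ?thesis by (simp add: C1_def mult.assoc)
  qed
  \<comment> \<open>Chosen to exceed the initial gap strictly and to satisfy
    \<open>\<delta> * M > 2 * C1\<close>, the margin needed where the barrier is met.\<close>
  define M where "M = \<bar>q S2 - g1\<bar> + 1 + 2 * C1 / \<delta>"
  have M0: "M > 0" using C1 \<delta> by (simp add: M_def add_pos_nonneg)
  have MC: "\<delta> * M > 2 * C1"
  proof -
    have "2 * C1 = \<delta> * (2 * C1 / \<delta>)" using \<delta> by simp
    also have "\<dots> < \<delta> * M" using \<delta> by (intro mult_strict_left_mono) (auto simp: M_def)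
    finally show ?thesis .
  qed
  have main: "M * E s - \<sigma> * (q s - g1) > 0" if s: "s \<ge> S2" and \<sigma>: "\<sigma> = 1 \<or> \<sigma> = - 1" for s \<sigma>
  proof (rule barrier_pos[OF _ _ _ s])
    fix s assume s: "s \<ge> S2"
    show "((\<lambda>s. M * E s - \<sigma> * (q s - g1)) has_real_derivative
      - \<mu> * M * E s - \<sigma> * ((q s - g1) * (q s - g2) + \<epsilon> s)) (at s)"
      using s S2S by (auto intro!: derivative_eq_intros derE derq)
  next
    have "M > \<bar>q S2 - g1\<bar>" using C1 \<delta> by (simp add: M_def add_pos_nonneg)
    then show "M * E S2 - \<sigma> * (q S2 - g1) > 0" using \<sigma> by (auto simp: E_def)
  next
    fix s assume s: "s > S2" and 0: "M * E s - \<sigma> * (q s - g1) = 0"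
    have ME: "M * E s = \<sigma> * (q s - g1)" using 0 by simp
    have "- \<sigma> * ((q s - g1) * (q s - g2)) = (M * E s) * (g2 - q s)"
      unfolding ME by (simp add: algebra_simps)
    also have "\<dots> \<ge> (M * E s) * \<delta>"
      using qle[of s] s S2S M0 E0[of s] by (intro mult_left_mono) (auto simp: \<delta>_def)
    finally have 1: "- \<sigma> * ((q s - g1) * (q s - g2)) \<ge> M * E s * \<delta>" .
    have 2: "- \<sigma> * \<epsilon> s \<ge> - C1 * E s" using epsE[of s] s \<sigma> by auto
    have "\<mu> * (M * E s) \<le> \<delta> / 2 * (M * E s)" using \<mu> M0 E0[of s] by (intro mult_right_mono) auto
    moreover have "2 * C1 * E s < \<delta> * M * E s" using MC E0 by simp
    ultimately show "- \<mu> * M * E s - \<sigma> * ((q s - g1) * (q s - g2) + \<epsilon> s) > 0"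
      using 1 2 by (simp add: algebra_simps)
  qed
  have th: "\<bar>q s - g1\<bar> \<le> M * E s" if "s \<ge> S2" for s
    using main[OF that, of 1] main[OF that, of "-1"] by auto
  define F where "F s = ln (x s) + g1 * s" for s
  have derF: "(F has_real_derivative g1 - q s) (at s)" if "s \<ge> S2" for s
    unfolding F_def using that S2S pos[of s]
    by (auto intro!: derivative_eq_intros derx simp: field_simps)
  \<comment> \<open>\<open>F' = g1 - q\<close> is bounded by \<open>M * E\<close>, which is
    integrable. Correcting \<open>F\<close> by the multiple \<open>M / \<mu>\<close> of
    \<open>E\<close> yields monotone bounded functions, so \<open>F\<close> has a finite limit and
    \<open>x * exp (g1 * s)\<close> a positive one.\<close>
  have up: "- F s - M / \<mu> * E s \<le> - F r - M / \<mu> * E r" if sr: "S2 \<le> s" "s \<le> r" for s r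
  proof (rule DERIV_nonneg_imp_nondecreasing[OF sr(2)])
    fix u assume u: "s \<le> u" "u \<le> r"
    have "((\<lambda>s. - F s - M / \<mu> * E s) has_real_derivative - (g1 - q u) + M * E u) (at u)"
      using u sr \<mu> by (auto intro!: derivative_eq_intros derF derE)
    moreover have "- (g1 - q u) + M * E u \<ge> 0" using th[of u] u sr by auto
    ultimately show "\<exists>y. ((\<lambda>s. - F s - M / \<mu> * E s) has_real_derivative y) (at u) \<and> y \<ge> 0" by blast
  qed
  have dn: "F S2 - M / \<mu> * E S2 \<le> F r - M / \<mu> * E r" if sr: "S2 \<le> r" for r
  proof (rule DERIV_nonneg_imp_nondecreasing[OF sr])
    fix u assume u: "S2 \<le> u" "u \<le> r"
    have "((\<lambda>s. F s - M / \<mu> * E s) has_real_derivative (g1 - q u) + M * E u) (at u)"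
      using u sr \<mu> by (auto intro!: derivative_eq_intros derF derE)
    moreover have "(g1 - q u) + M * E u \<ge> 0" using th[of u] u sr by auto
    ultimately show "\<exists>y. ((\<lambda>s. F s - M / \<mu> * E s) has_real_derivative y) (at u) \<and> y \<ge> 0" by blast
  qed
  have Mm: "M / \<mu> * E r > 0" for r using M0 \<mu> E0 by simp
  have bdd: "- F r - M / \<mu> * E r \<le> - (F S2 - M / \<mu> * E S2)" if "S2 \<le> r" for r
    using dn[OF that] Mm[of r] by linarith
  obtain L where L: "((\<lambda>s. - F s - M / \<mu> * E s) \<longlongrightarrow> L) at_top"
    by (rule mono_bounded_tendsto_at_top[of S2 "\<lambda>s. - F s - M / \<mu> * E s", OF up bdd])
  have Elim: "(E \<longlongrightarrow> 0) at_top"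
    unfolding E_def
    using \<mu> by real_asymp
  have "((\<lambda>s. - (- F s - M / \<mu> * E s) - M / \<mu> * E s) \<longlongrightarrow> - L - M / \<mu> * 0) at_top"
    by (rule tendsto_diff[OF tendsto_minus[OF L] tendsto_mult[OF tendsto_const Elim]])
  then have "(F \<longlongrightarrow> - L) at_top" by simp
  then have "((\<lambda>s. exp (F s)) \<longlongrightarrow> exp (- L)) at_top" by (rule tendsto_exp)
  moreover have "\<forall>\<^sub>F s in at_top. exp (F s) = x s * exp (g1 * s)"
    using eventually_ge_at_top[of S] by eventually_elim (simp add: F_def exp_add pos)
  ultimately have "((\<lambda>s. x s * exp (g1 * s)) \<longlongrightarrow> exp (- L)) at_top"
    by (rule Lim_transform_eventually)
  then show ?thesis using that[of "exp (- L)"] by simp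
qed

section \<open>Orbits of the autonomous equation\<close>

lemma powr_ge_tangent:
  fixes x p :: real
  assumes p: "p > 1" and x: "x > 0"
  shows "x powr p \<ge> 1 + p * (x - 1)"
proof -
  define F where "F y = y powr p - p * y" for y :: real
  have der: "(F has_real_derivative p * (y powr (p - 1) - 1)) (at y)" if "y > 0" for y
    unfolding F_def using that by (auto intro!: derivative_eq_intros simp: algebra_simps)
  have "F x \<ge> F 1"
  proof (cases "x \<ge> 1")
    case True
    show ?thesis
    proof (rule DERIV_nonneg_imp_nondecreasing[OF True])
      fix y assume y: "1 \<le> y" "y \<le> x"
      then have "p * (y powr (p - 1) - 1) \<ge> 0" using p by (simp add: ge_one_powr_ge_zero)
      then show "\<exists>z. (F has_real_derivative z) (at y) \<and> z \<ge> 0" using der[of y] y by fastforce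
    qed
  next
    case False
    then have le: "x \<le> 1" by simp
    show ?thesis
    proof (rule DERIV_nonpos_imp_nonincreasing[OF le])
      fix y assume y: "x \<le> y" "y \<le> 1"
      then have "p * (y powr (p - 1) - 1) \<le> 0" using p x by (simp add: mult_nonneg_nonpos powr_le1)
      then show "\<exists>z. (F has_real_derivative z) (at y) \<and> z \<le> 0" using der[of y] y x by fastforce
    qed
  qed
  then show ?thesis by (simp add: F_def algebra_simps)
qed

lemma powr_less_self: "(p::real) > 1 \<Longrightarrow> 0 < x \<Longrightarrow> x < 1 \<Longrightarrow> x powr p < x"
  using powr_less_mono'[of x 1 p] by simp

lemma self_less_powr: "(p::real) > 1 \<Longrightarrow> x > 1 \<Longrightarrow> x < x powr p"
  using powr_less_mono[of 1 p x] by simp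

locale emden_orbit =
  fixes k p b :: real and v w :: "real \<Rightarrow> real"
  assumes k_pos: "k > 0" and kp: "k * (p - 1) = 2" and b_pos: "b > 0"
    and v_pos: "v s > 0"
    and v_deriv: "(v has_real_derivative w s) (at s)"
    and w_deriv: "(w has_real_derivative
      k\<^sup>2 * (v s - v s powr p) - b * p * v s powr (p - 1) * w s) (at s)"
begin

lemma p_gt_1: "p > 1"
  using kp k_pos by (smt (verit) mult_nonneg_nonpos)

lemma vp_deriv: "((\<lambda>s. v s powr p) has_real_derivative p * v s powr (p - 1) * w s) (at s)"
  using DERIV_fun_powr[OF v_deriv v_pos, of p s] by simp

lemma v_powr: "v s powr p = v s * v s powr (p - 1)"
  using v_pos[of s] powr_add[of "v s" 1 "p - 1"] by simp

lemma isCont_v [continuous_intros]: "isCont v s" and isCont_w [continuous_intros]: "isCont w s"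
  using v_deriv w_deriv by (blast intro: DERIV_isCont)+

text \<open>Convergence of \<open>w\<close> is not known. The combination
  \<open>w + b * v powr p\<close> has a derivative tending to
  \<open>M = k\<^sup>2 * (L - L powr p)\<close>, and two applications of de l'Hospital's rule show
  that \<open>v / s\<^sup>2\<close> tends to \<open>M / 2\<close>. A finite limit of
  \<open>v\<close> forces \<open>M = 0\<close>.\<close>

lemma limit_eq_1:
  assumes lim: "(v \<longlongrightarrow> L) at_top" and L: "L > 0"
  shows "L = 1"
proof -
  define Y where "Y s = w s + b * v s powr p" for s
  define M where "M = k\<^sup>2 * (L - L powr p)"
  have derY: "(Y has_real_derivative k\<^sup>2 * (v s - v s powr p)) (at s)" for s
    unfolding Y_def by (rule derivative_eq_intros w_deriv vp_deriv refl)+ (simp add: algebra_simps)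
  have vp: "((\<lambda>s. v s powr p) \<longlongrightarrow> L powr p) at_top"
    using lim L by (intro tendsto_intros) auto
  have "((\<lambda>s. Y s / s) \<longlongrightarrow> M) at_top"
  proof (rule lhospital_at_top_at_top)
    show "((\<lambda>s. k\<^sup>2 * (v s - v s powr p) / 1) \<longlongrightarrow> M) at_top"
      unfolding M_def using lim vp by (auto intro!: tendsto_intros)
  qed (use derY in \<open>auto intro: filterlim_ident\<close>)
  moreover have "((\<lambda>s. b * v s powr p / s) \<longlongrightarrow> 0) at_top"
    by (rule real_tendsto_divide_at_top[OF tendsto_mult[OF tendsto_const vp]]) (rule filterlim_ident)
  ultimately have "((\<lambda>s. Y s / s - b * v s powr p / s) \<longlongrightarrow> M - 0) at_top"
    by (rule tendsto_diff)
  moreover have "Y s / s - b * v s powr p / s = w s / s" for s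
    by (simp add: Y_def add_divide_distrib)
  ultimately have ws: "((\<lambda>s. w s / s) \<longlongrightarrow> M) at_top" by simp
  have "((\<lambda>s. v s / s\<^sup>2) \<longlongrightarrow> M / 2) at_top"
  proof (rule lhospital_at_top_at_top)
    show sq: "LIM s at_top. s\<^sup>2 :> (at_top :: real filter)"
      by (rule filterlim_pow_at_top[OF _ filterlim_ident]) simp
    show "\<forall>\<^sub>F s::real in at_top. 2 * s \<noteq> 0"
      using eventually_gt_at_top[of 0] by eventually_elim simp
    show "((\<lambda>s. w s / (2 * s)) \<longlongrightarrow> M / 2) at_top"
      using tendsto_divide[OF ws tendsto_const[of 2]] by (simp add: field_simps)
  qed (auto intro!: always_eventually v_deriv derivative_eq_intros)
  moreover have "((\<lambda>s. v s / s\<^sup>2) \<longlongrightarrow> 0) at_top"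
    by (rule real_tendsto_divide_at_top[OF lim filterlim_pow_at_top[OF _ filterlim_ident]]) simp
  ultimately have "M / 2 = 0"
    using tendsto_unique trivial_limit_at_top_linorder by blast
  then have "L = L powr p" using k_pos by (simp add: M_def)
  then show ?thesis
    using powr_less_self[OF p_gt_1 L] self_less_powr[OF p_gt_1, of L] by (cases L "1::real" rule: linorder_cases) auto
qed

text \<open>The rate \<open>q = - w / (v - 1)\<close> satisfies a Riccati equation whose quadratic
  is the characteristic polynomial at \<open>v = 1\<close>, with an error of order
  \<open>v - 1\<close> from linearising the powers. The sign \<open>\<sigma>\<close> covers approach
  from above and from below at once.\<close>

lemma decay_rate:
  assumes sum: "g1 + g2 = b * p" and prod: "g1 * g2 = k\<^sup>2 * (p - 1)" and g1: "0 < g1" and g: "g < g2"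
    and \<sigma>: "\<sigma> = 1 \<or> \<sigma> = - 1"
    and side: "\<And>s. s \<ge> S \<Longrightarrow> \<sigma> * (v s - 1) > 0"
    and q0: "\<And>s. s \<ge> S \<Longrightarrow> 0 \<le> - w s / (v s - 1)" and qg: "\<And>s. s \<ge> S \<Longrightarrow> - w s / (v s - 1) \<le> g"
    and lim: "(v \<longlongrightarrow> 1) at_top"
  obtains A where "A > 0" "((\<lambda>s. \<sigma> * (v s - 1) * exp (g1 * s)) \<longlongrightarrow> A) at_top"
proof -
  define q where "q s = - w s / (v s - 1)" for s
  \<comment> \<open>The quotient tends to \<open>1 - p\<close> at \<open>1\<close>, so
    \<open>R\<close> is the remainder after linearisation, of order \<open>x - 1\<close>.\<close>
  define R where "R x = (x - x powr p) / (x - 1) + (p - 1)" for x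
  define \<epsilon> where "\<epsilon> s = - (b * p * (v s powr (p - 1) - 1) * q s) - k\<^sup>2 * R (v s)" for s
  have at1: "filterlim v (at 1) at_top"
  proof -
    have "\<forall>\<^sub>F s in at_top. v s \<noteq> 1"
      using eventually_ge_at_top[of S] by eventually_elim (use side in force)
    then show ?thesis using lim by (simp add: filterlim_at)
  qed
  have "R \<in> O[at 1](\<lambda>x. x - 1)"
    unfolding R_def[abs_def] using p_gt_1 by real_asymp
  then obtain C1 where C1: "C1 > 0" "\<forall>\<^sub>F x in at 1. \<bar>R x\<bar> \<le> C1 * \<bar>x - 1\<bar>"
    by (auto elim!: landau_o.bigE)
  have "(\<lambda>x. x powr (p - 1) - 1) \<in> O[at 1](\<lambda>x. x - 1)"
    using p_gt_1 by real_asymp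
  then obtain C2 where C2: "C2 > 0" "\<forall>\<^sub>F x in at 1. \<bar>x powr (p - 1) - 1\<bar> \<le> C2 * \<bar>x - 1\<bar>"
    by (auto elim!: landau_o.bigE)
  have "\<forall>\<^sub>F s in at_top. \<bar>R (v s)\<bar> \<le> C1 * \<bar>v s - 1\<bar> \<and> \<bar>v s powr (p - 1) - 1\<bar> \<le> C2 * \<bar>v s - 1\<bar>"
    using eventually_compose_filterlim[OF C1(2) at1] eventually_compose_filterlim[OF C2(2) at1]
    by eventually_elim simp
  then obtain S0 where S0: "\<And>s. s \<ge> S0 \<Longrightarrow> \<bar>R (v s)\<bar> \<le> C1 * \<bar>v s - 1\<bar> \<and> \<bar>v s powr (p - 1) - 1\<bar> \<le> C2 * \<bar>v s - 1\<bar>"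
    by (auto simp: eventually_at_top_linorder)
  have ab: "\<sigma> * (v s - 1) = \<bar>v s - 1\<bar>" if "s \<ge> S" for s
    using side[OF that] \<sigma> by auto
  show ?thesis
  proof (rule riccati_rate[of "max S S0" "\<lambda>s. \<sigma> * (v s - 1)" q g1 g2 \<epsilon> "b * p * C2 * g + k\<^sup>2 * C1" g])
    fix s assume "s \<ge> max S S0"
    then have s: "s \<ge> S" "s \<ge> S0" by auto
    have ne: "v s - 1 \<noteq> 0" using side[OF s(1)] by auto
    show "\<sigma> * (v s - 1) > 0" by (rule side[OF s(1)])
    have "((\<lambda>s. \<sigma> * (v s - 1)) has_real_derivative \<sigma> * w s) (at s)"
      by (auto intro!: derivative_eq_intros v_deriv)
    also have "\<sigma> * w s = - q s * (\<sigma> * (v s - 1))"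
      using ne by (simp add: q_def)
    finally show "((\<lambda>s. \<sigma> * (v s - 1)) has_real_derivative - q s * (\<sigma> * (v s - 1))) (at s)" .
    have q: "w s = - q s * (v s - 1)" using ne by (simp add: q_def)
    have "(q has_real_derivative (- (k\<^sup>2 * (v s - v s powr p) - b * p * v s powr (p - 1) * w s) * (v s - 1)
        - - w s * (w s - 0)) / ((v s - 1) * (v s - 1))) (at s)"
      unfolding q_def using ne by (intro derivative_intros v_deriv w_deriv) auto
    also have "(- (k\<^sup>2 * (v s - v s powr p) - b * p * v s powr (p - 1) * w s) * (v s - 1)
        - - w s * (w s - 0)) / ((v s - 1) * (v s - 1)) =
        - k\<^sup>2 * ((v s - v s powr p) / (v s - 1)) - b * p * v s powr (p - 1) * q s + (q s)\<^sup>2"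
      unfolding q using ne by (simp add: divide_simps) (simp add: algebra_simps power2_eq_square)
    also have "(v s - v s powr p) / (v s - 1) = R (v s) - (p - 1)"
      by (simp add: R_def)
    also have "- k\<^sup>2 * (R (v s) - (p - 1)) - b * p * v s powr (p - 1) * q s + (q s)\<^sup>2 =
        (q s)\<^sup>2 - (g1 + g2) * q s + g1 * g2 + \<epsilon> s"
      unfolding \<epsilon>_def sum prod by (simp add: algebra_simps)
    also have "\<dots> = (q s - g1) * (q s - g2) + \<epsilon> s"
      by (simp add: algebra_simps power2_eq_square)
    finally show "(q has_real_derivative (q s - g1) * (q s - g2) + \<epsilon> s) (at s)" .
    show "q s \<le> g" using qg[OF s(1)] by (simp add: q_def)
    have qs: "0 \<le> q s" "q s \<le> g" using q0[OF s(1)] qg[OF s(1)] by (auto simp: q_def)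
    have "\<bar>\<epsilon> s\<bar> \<le> \<bar>b * p * (v s powr (p - 1) - 1) * q s\<bar> + \<bar>k\<^sup>2 * R (v s)\<bar>"
      unfolding \<epsilon>_def by linarith
    also have "\<bar>b * p * (v s powr (p - 1) - 1) * q s\<bar> = b * p * \<bar>v s powr (p - 1) - 1\<bar> * q s"
      using b_pos p_gt_1 qs by (simp add: abs_mult)
    also have "\<dots> \<le> b * p * (C2 * \<bar>v s - 1\<bar>) * g"
      using S0[OF s(2)] qs b_pos p_gt_1 by (intro mult_mono) auto
    also have "\<bar>k\<^sup>2 * R (v s)\<bar> \<le> k\<^sup>2 * (C1 * \<bar>v s - 1\<bar>)"
      using S0[OF s(2)] by (auto simp: abs_mult intro!: mult_left_mono)
    finally show "\<bar>\<epsilon> s\<bar> \<le> (b * p * C2 * g + k\<^sup>2 * C1) * (\<sigma> * (v s - 1))"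
      unfolding ab[OF s(1)] by (simp add: algebra_simps)
  next
    have "((\<lambda>s. \<sigma> * (v s - 1)) \<longlongrightarrow> \<sigma> * (1 - 1)) at_top"
      by (intro tendsto_intros lim)
    then show "((\<lambda>s. \<sigma> * (v s - 1)) \<longlongrightarrow> 0) at_top" by simp
  qed (use g g1 that in auto)
qed

text \<open>For \<open>b = k\<close> the zero set of \<open>barrier k\<close> is the explicit orbit.\<close>

definition barrier :: "real \<Rightarrow> real \<Rightarrow> real" where
  "barrier l s = w s - l * (v s - v s powr p)"

text \<open>Eliminating \<open>v - v powr p\<close> in favour of \<open>barrier l\<close> and
  \<open>w\<close> leaves a damping term and a multiple of \<open>w\<close>. Where
  \<open>barrier l = 0\<close> only the latter survives, so the direction of crossing is decided by
  the signs of \<open>w\<close> and of a slope that is affine in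
  \<open>v powr (p - 1)\<close>.\<close>

lemma barrier_deriv:
  assumes "l \<noteq> 0"
  shows "(barrier l has_real_derivative
    - (k\<^sup>2 / l) * barrier l s + w s * (k\<^sup>2 / l - l + (l - b) * (p * v s powr (p - 1)))) (at s)"
proof -
  have "(barrier l has_real_derivative (k\<^sup>2 * (v s - v s powr p) - b * p * v s powr (p - 1) * w s)
      - l * (w s - p * v s powr (p - 1) * w s)) (at s)"
    unfolding barrier_def by (rule derivative_eq_intros v_deriv w_deriv vp_deriv refl)+ simp
  then show ?thesis
    by (rule DERIV_cong) (use assms in \<open>simp add: barrier_def divide_simps; simp add: algebra_simps power2_eq_square\<close>)
qed

lemma isCont_barrier: "isCont (barrier l) s"
  unfolding barrier_def using v_pos[of s] by (intro continuous_intros) auto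

text \<open>Because \<open>g = (p - 1) * l\<close>, the slope at \<open>v = 1\<close> times
  \<open>(p - 1) * l\<close> is the characteristic polynomial \<open>(g - g1) * (g - g2)\<close>,
  which is negative between its roots.\<close>

lemma barrier_slope_at_1:
  assumes sum: "g1 + g2 = b * p" and prod: "g1 * g2 = k\<^sup>2 * (p - 1)" and g: "g1 < g" "g < g2" "g > 0"
    and l: "l = g * k / 2"
  shows "k\<^sup>2 / l - l + (l - b) * p < 0"
proof -
  have l0: "l > 0" unfolding l using g k_pos by simp
  have gl: "g = (p - 1) * l"
    using kp k_pos by (simp add: l) (metis mult.commute mult.left_commute nonzero_mult_div_cancel_left zero_neq_numeral)
  have p1: "p - 1 > 0" using p_gt_1 by simp
  have "(g - g1) * (g - g2) < 0" using g by (simp add: mult_pos_neg)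
  also have "(g - g1) * (g - g2) = g * g - (g1 + g2) * g + g1 * g2" by (simp add: algebra_simps)
  also have "\<dots> = (p - 1) * (l * ((p - 1) * l - b * p) + k\<^sup>2)"
    unfolding sum prod gl by (simp add: algebra_simps)
  finally have "l * ((p - 1) * l - b * p) + k\<^sup>2 < 0"
    using p1 by (simp add: mult_less_0_iff)
  moreover have "l * ((p - 1) * l - b * p) + k\<^sup>2 = l * (k\<^sup>2 / l - l + (l - b) * p)"
    using l0 by (simp add: field_simps)
  ultimately show ?thesis using l0 by (simp add: mult_less_0_iff)
qed

text \<open>The region where \<open>v < 1\<close>, \<open>w > 0\<close> and
  \<open>barrier l < 0\<close> is invariant. In it \<open>v\<close> increases to \<open>1\<close>,
  and the tangent line at \<open>1\<close> turns the barrier into the bound \<open>g\<close> on the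
  decay rate, which keeps it away from \<open>g2\<close>. The requirement \<open>g > 2\<close> means
  \<open>l > k\<close>.\<close>

lemma converge_from_below:
  assumes sum: "g1 + g2 = b * p" and prod: "g1 * g2 = k\<^sup>2 * (p - 1)" and g1: "0 < g1"
    and g: "g1 < g" "g < g2" "g > 2" and l: "l = g * k / 2"
    and init: "v a < 1" "w a > 0" "w a < l * (v a - v a powr p)"
  obtains A where "A > 0" "((\<lambda>s. (1 - v s) * exp (g1 * s)) \<longlongrightarrow> A) at_top"
proof -
  have lk: "l > k" using mult_strict_right_mono[OF g(3) k_pos] by (simp add: l)
  then have l0: "l > 0" using k_pos by simp
  have lp: "l * (p - 1) = g" using kp by (simp add: l)
  have b1: "k\<^sup>2 / l - l + (l - b) * p < 0"
    using barrier_slope_at_1[OF sum prod g(1,2) _ l] g(3) by simp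
  have b0: "k\<^sup>2 / l - l < 0"
    using lk k_pos l0 by (simp add: divide_simps power2_eq_square mult_strict_mono)
  define F where "F s = min (1 - v s) (min (w s) (- barrier l s))" for s
  have Fpos: "F s > 0" if s: "s \<ge> a" for s
  proof (rule ccontr)
    assume "\<not> F s > 0"
    moreover have "continuous_on {a..s} F"
      unfolding F_def by (intro continuous_at_imp_continuous_on ballI continuous_intros isCont_barrier)
    moreover have "F a > 0" using init by (simp add: F_def barrier_def)
    ultimately obtain z where z: "z > a" "F z = 0" "\<And>r. a \<le> r \<Longrightarrow> r < z \<Longrightarrow> F r > 0"
      using first_zero[of a s F thesis] s by fastforce
    have r: "v r < 1" "w r > 0" "barrier l r < 0" if "a \<le> r" "r < z" for r
      using z(3)[OF that] by (auto simp: F_def)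
    have Fz: "v z \<le> 1" "w z \<ge> 0" "barrier l z \<le> 0" using z(2) by (auto simp: F_def min_def split: if_splits)
    \<comment> \<open>\<open>v\<close> cannot reach \<open>1\<close> in finite time: below the
      barrier \<open>1 - v\<close> decays no faster than \<open>exp (- g * s)\<close>.\<close>
    have "(1 - v a) * exp (g * a) \<le> (1 - v z) * exp (g * z)"
    proof (rule DERIV_nonneg_imp_nondecreasing[where f = "\<lambda>s. (1 - v s) * exp (g * s)"])
      fix u assume u: "a \<le> u" "u \<le> z"
      have "barrier l u \<le> 0" using r[of u] Fz u by (cases "u = z") auto
      then have "w u \<le> l * (v u - v u powr p)" by (simp add: barrier_def)
      also have "\<dots> \<le> l * ((p - 1) * (1 - v u))"
        using powr_ge_tangent[OF p_gt_1 v_pos[of u]] l0 by (intro mult_left_mono) (auto simp: algebra_simps)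
      also have "\<dots> = g * (1 - v u)" using lp by (simp flip: mult.assoc)
      finally have "exp (g * u) * (g * (1 - v u) - w u) \<ge> 0" by simp
      moreover have "((\<lambda>s. (1 - v s) * exp (g * s)) has_real_derivative exp (g * u) * (g * (1 - v u) - w u)) (at u)"
        by (auto intro!: derivative_eq_intros v_deriv simp: algebra_simps)
      ultimately show "\<exists>y. ((\<lambda>s. (1 - v s) * exp (g * s)) has_real_derivative y) (at u) \<and> y \<ge> 0" by blast
    qed (use z in simp)
    moreover have "(1 - v a) * exp (g * a) > 0" using init by simp
    ultimately have vz: "v z < 1" by (smt (verit) exp_gt_zero zero_less_mult_iff)
    have vv: "v z - v z powr p > 0" using powr_less_self[OF p_gt_1 v_pos vz] by simp
    \<comment> \<open>Below \<open>1\<close> the vector field points into \<open>w > 0\<close>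
      wherever \<open>w = 0\<close>.\<close>
    have wz: "w z > 0"
    proof (rule ccontr)
      assume "\<not> w z > 0"
      then have w0: "w z = 0" using Fz by simp
      then have "(w has_real_derivative k\<^sup>2 * (v z - v z powr p)) (at z)" using w_deriv[of z] by simp
      from DERIV_pos_inc_left[OF this] obtain d where d: "d > 0" "\<And>h. 0 < h \<Longrightarrow> h < d \<Longrightarrow> w (z - h) < w z"
        using vv k_pos by auto
      define h where "h = min (d / 2) (z - a)"
      have "0 < h" "h < d" "a \<le> z - h" using d(1) z(1) by (auto simp: h_def)
      then show False using d(2)[of h] w0 r[of "z - h"] by simp
    qed
    have bz: "barrier l z = 0"
      using z(2) vz wz by (auto simp: F_def min_def split: if_splits)
    \<comment> \<open>The slope is affine in \<open>u\<close>, hence a convex combination of its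
      values at \<open>u = 0\<close>, negative because \<open>l > k\<close>, and at
      \<open>u = 1\<close>, negative by the choice of \<open>g\<close>.\<close>
    define u where "u = v z powr (p - 1)"
    have u: "0 < u" "u < 1" using v_pos[of z] vz p_gt_1 powr_less_mono2[of "p - 1" "v z" 1] by (auto simp: u_def)
    have "k\<^sup>2 / l - l + (l - b) * (p * u) = (1 - u) * (k\<^sup>2 / l - l) + u * (k\<^sup>2 / l - l + (l - b) * p)"
      by (simp add: algebra_simps add_divide_distrib diff_divide_distrib)
    also have "\<dots> < 0"
      using u b0 b1 mult_pos_neg[of "1 - u"] mult_pos_neg[of u] by (intro add_neg_neg) auto
    finally have "w z * (k\<^sup>2 / l - l + (l - b) * (p * v z powr (p - 1))) < 0"
      using wz by (simp add: u_def mult_pos_neg)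
    then have "- (k\<^sup>2 / l) * barrier l z + w z * (k\<^sup>2 / l - l + (l - b) * (p * v z powr (p - 1))) < 0"
      using bz by simp
    from DERIV_neg_dec_left[OF barrier_deriv this] l0
    obtain d where d: "d > 0" "\<And>h. 0 < h \<Longrightarrow> h < d \<Longrightarrow> barrier l z < barrier l (z - h)" by auto
    define h where "h = min (d / 2) (z - a)"
    have "0 < h" "h < d" "a \<le> z - h" using d(1) z(1) by (auto simp: h_def)
    then show False using d(2)[of h] bz r[of "z - h"] by simp
  qed
  have inv: "v s < 1" "w s > 0" "w s < l * (v s - v s powr p)" if "s \<ge> a" for s
    using Fpos[OF that] by (auto simp: F_def barrier_def)
  have mono: "v x \<le> v y" if "a \<le> x" "x \<le> y" for x y
    by (rule DERIV_nonneg_imp_nondecreasing[OF that(2)]) (use that inv v_deriv in \<open>force intro: less_imp_le\<close>)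
  obtain L where L: "(v \<longlongrightarrow> L) at_top" "\<And>x. a \<le> x \<Longrightarrow> v x \<le> L"
    by (rule mono_bounded_tendsto_at_top[of a v 1, OF mono]) (use inv in \<open>auto intro: less_imp_le\<close>)
  have "L = 1" by (rule limit_eq_1[OF L(1)]) (use L(2)[of a] v_pos[of a] in auto)
  then have lim: "(v \<longlongrightarrow> 1) at_top" using L by simp
  show ?thesis
  proof (rule decay_rate[OF sum prod g1 g(2), of "-1" a])
    fix s assume s: "s \<ge> a"
    show "- 1 * (v s - 1) > 0" using inv[OF s] by simp
    show "0 \<le> - w s / (v s - 1)" using inv[OF s] by (simp add: divide_nonneg_neg)
    have "w s < l * (v s - v s powr p)" using inv[OF s] by simp
    also have "\<dots> \<le> l * ((p - 1) * (1 - v s))"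
      using powr_ge_tangent[OF p_gt_1 v_pos[of s]] l0 by (intro mult_left_mono) (auto simp: algebra_simps)
    also have "\<dots> = g * (1 - v s)" using lp by (simp flip: mult.assoc)
    finally show "- w s / (v s - 1) \<le> g"
      using inv[OF s] by (simp add: divide_simps algebra_simps)
  next
    fix A assume "A > 0" "((\<lambda>s. - 1 * (v s - 1) * exp (g1 * s)) \<longlongrightarrow> A) at_top"
    then show ?thesis using that by (simp add: algebra_simps)
  qed (use lim in auto)
qed


lemma powr_quotient_tendsto: "((\<lambda>x. (x powr p - x) / (x - 1)) \<longlongrightarrow> p - 1) (at 1)"
  using p_gt_1 by real_asymp

text \<open>For \<open>l = k\<close> the constant part \<open>k\<^sup>2 / l - l\<close> of the slope
  cancels, and the weight removes the damping term. What remains has the sign of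
  \<open>(k - b) * w\<close>, and vanishes for \<open>b = k\<close>.\<close>

lemma exp_barrier_deriv:
  "((\<lambda>s. exp (k * s) * barrier k s) has_real_derivative
    (k - b) * exp (k * s) * (p * v s powr (p - 1) * w s)) (at s)"
  using k_pos by (auto intro!: derivative_eq_intros barrier_deriv simp: algebra_simps power2_eq_square)

text \<open>The two conclusions sustain each other: as long as \<open>v \<le> 1\<close>, a positive
  \<open>barrier k\<close> forces \<open>w > 0\<close>, and then \<open>b < k\<close> makes the
  weighted barrier increase.\<close>

lemma exp_barrier_lower_bound:
  assumes bk: "b < k" and c: "0 < c" "c < exp (k * a) * barrier k a" and as: "a \<le> s"
    and le1: "\<And>r. a \<le> r \<Longrightarrow> r \<le> s \<Longrightarrow> v r \<le> 1"
  shows "exp (k * s) * barrier k s > c" "w s > 0"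
proof -
  have wpos: "w r > 0" if J: "barrier k r > 0" and r: "a \<le> r" "r \<le> s" for r
  proof -
    have "v r powr p \<le> v r"
      using le1[OF r] powr_less_self[OF p_gt_1 v_pos[of r]] by (cases "v r = 1") auto
    then have "k * (v r - v r powr p) \<ge> 0" using k_pos by simp
    then show ?thesis using J by (simp add: barrier_def)
  qed
  have "exp (k * s) * barrier k s - c > 0"
  proof (rule barrier_pos[OF _ _ _ as])
    fix r assume "a \<le> r" "r \<le> s"
    show "((\<lambda>s. exp (k * s) * barrier k s - c) has_real_derivative
      (k - b) * exp (k * r) * (p * v r powr (p - 1) * w r)) (at r)"
      using DERIV_diff[OF exp_barrier_deriv DERIV_const[of c]] by simp
  next
    fix r assume r: "a < r" "r \<le> s" "exp (k * r) * barrier k r - c = 0"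
    then have "barrier k r > 0" using c by (smt (verit) exp_gt_zero zero_less_mult_iff)
    then show "(k - b) * exp (k * r) * (p * v r powr (p - 1) * w r) > 0"
      using wpos[of r] r bk p_gt_1 v_pos[of r] by (intro mult_pos_pos) auto
  qed (use c in auto)
  then show *: "exp (k * s) * barrier k s > c" by simp
  then have "barrier k s > 0" using c by (smt (verit) exp_gt_zero zero_less_mult_iff)
  then show "w s > 0" using wpos as by auto
qed

text \<open>If the orbit stayed below \<open>1\<close>, the lower bound on \<open>exp (k s) * barrier k s\<close> would make
  \<open>exp (k s) * (1 - v s)\<close> decrease at least linearly.\<close>

lemma crosses_1:
  assumes bk: "b < k" and k2: "k < 2" and init: "v a < 1" "barrier k a > 0"
  obtains s where "s > a" "v s = 1" "w s > 0"
proof -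
  define c where "c = exp (k * a) * barrier k a / 2"
  have c: "0 < c" "c < exp (k * a) * barrier k a" using init by (auto simp: c_def)
  have "\<exists>s\<ge>a. v s \<ge> 1"
  proof (rule ccontr)
    assume "\<not> ?thesis"
    then have lt: "v s < 1" if "s \<ge> a" for s using that by force
    note W = exp_barrier_lower_bound[OF bk c, of _, OF _ less_imp_le[OF lt]]
    have mono: "v x \<le> v y" if "a \<le> x" "x \<le> y" for x y
    proof (rule DERIV_nonneg_imp_nondecreasing[OF that(2)])
      fix u assume "x \<le> u" "u \<le> y"
      then have "w u > 0" using W(2)[of u] that by auto
      then show "\<exists>z. (v has_real_derivative z) (at u) \<and> z \<ge> 0" using v_deriv[of u] by force
    qed
    obtain L where L: "(v \<longlongrightarrow> L) at_top" "\<And>x. a \<le> x \<Longrightarrow> v x \<le> L"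
      by (rule mono_bounded_tendsto_at_top[of a v 1, OF mono]) (use lt in \<open>auto intro: less_imp_le\<close>)
    have "L = 1" by (rule limit_eq_1[OF L(1)]) (use L(2)[of a] v_pos[of a] in auto)
    then have lim: "(v \<longlongrightarrow> 1) at_top" using L by simp
    have "\<forall>\<^sub>F s in at_top. v s \<noteq> 1"
      using eventually_ge_at_top[of a] by eventually_elim (use lt in force)
    then have at1: "filterlim v (at 1) at_top" using lim by (simp add: filterlim_at)
    \<comment> \<open>\<open>k < 2\<close> means \<open>p - 1 > 1\<close>, so
      \<open>v - v powr p\<close>, which behaves like \<open>(p - 1) * (1 - v)\<close> near
      \<open>1\<close>, eventually exceeds \<open>1 - v\<close>.\<close>
    have p2: "p - 1 > 1"
      using kp k2 k_pos p_gt_1 by (smt (verit) mult_left_le)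
    have "\<forall>\<^sub>F s in at_top. (v s powr p - v s) / (v s - 1) > 1"
      using order_tendstoD(1)[OF filterlim_compose[OF powr_quotient_tendsto at1] p2] .
    then obtain T where T: "\<And>s. s \<ge> T \<Longrightarrow> (v s powr p - v s) / (v s - 1) > 1"
      by (auto simp: eventually_at_top_linorder)
    define S where "S = max a T"
    have key: "exp (k * s) * (1 - v s) + c * s \<le> exp (k * S) * (1 - v S) + c * S" if s: "s \<ge> S" for s
    proof (rule DERIV_nonpos_imp_nonincreasing[where f = "\<lambda>s. exp (k * s) * (1 - v s) + c * s", OF s])
      fix u assume u: "S \<le> u" "u \<le> s"
      have u': "u \<ge> a" "u \<ge> T" using u by (auto simp: S_def)
      have 1: "v u - v u powr p > 1 - v u" using T[OF u'(2)] lt[OF u'(1)] by (simp add: divide_simps)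
      have wu: "w u = barrier k u + k * (v u - v u powr p)" by (simp add: barrier_def)
      have "exp (k * u) * (k * (1 - v u) - w u) + c =
          (c - exp (k * u) * barrier k u) + exp (k * u) * (k * ((1 - v u) - (v u - v u powr p)))"
        unfolding wu by (simp add: algebra_simps)
      also have "\<dots> \<le> 0"
        using W(1)[of u] u' 1 k_pos by (intro add_nonpos_nonpos mult_nonneg_nonpos) auto
      finally have "exp (k * u) * (k * (1 - v u) - w u) + c \<le> 0" .
      moreover have "((\<lambda>s. exp (k * s) * (1 - v s) + c * s) has_real_derivative
          exp (k * u) * (k * (1 - v u) - w u) + c) (at u)"
        by (auto intro!: derivative_eq_intros v_deriv simp: algebra_simps)
      ultimately show "\<exists>y. ((\<lambda>s. exp (k * s) * (1 - v s) + c * s) has_real_derivative y) (at u) \<and> y \<le> 0"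
        by blast
    qed
    define D where "D = exp (k * S) * (1 - v S) + c * S"
    \<comment> \<open>Late enough for \<open>c * s\<close> to exceed \<open>D\<close>, although
      \<open>exp (k * s) * (1 - v s)\<close> is still positive.\<close>
    define s where "s = max S (D / c + 1)"
    have "exp (k * s) * (1 - v s) > 0" using lt[of s] by (simp add: s_def S_def)
    then have "c * s < D" using key[of s] by (simp add: D_def s_def)
    moreover have "c * s \<ge> c * (D / c + 1)" using c by (intro mult_left_mono) (auto simp: s_def)
    ultimately show False using c by (simp add: algebra_simps)
  qed
  then obtain s where s: "s \<ge> a" "v s \<ge> 1" by blast
  obtain z where z: "z > a" "z \<le> s" "1 - v z = 0" "\<And>r. a \<le> r \<Longrightarrow> r < z \<Longrightarrow> 1 - v r > 0"
    by (rule first_zero[of a s "\<lambda>s. 1 - v s"])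
       (use s init in \<open>auto intro!: continuous_at_imp_continuous_on continuous_intros\<close>)
  have "w z > 0"
    by (rule exp_barrier_lower_bound(2)[OF bk c])
       (use z in \<open>auto simp: less_eq_real_def dest: z(4)\<close>)
  then show ?thesis using that[of z] z by auto
qed

text \<open>After crossing \<open>1\<close> the orbit stays in the region \<open>v > 1\<close>,
  \<open>barrier l > 0\<close>. Being bounded, it must turn round, because a limit above
  \<open>1\<close> is impossible; from then on it decreases to \<open>1\<close>, and the barrier
  bounds the decay rate by a number below \<open>g2\<close>.\<close>

lemma converge_from_above:
  assumes sum: "g1 + g2 = b * p" and prod: "g1 * g2 = k\<^sup>2 * (p - 1)" and g1: "0 < g1" "g1 < g2"
    and bk: "b < k" and k2: "k < 2" and init: "v a < 1" "barrier k a > 0"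
    and bdd: "\<And>s. v s \<le> Bd"
  obtains A where "A > 0" "((\<lambda>s. (v s - 1) * exp (g1 * s)) \<longlongrightarrow> A) at_top"
proof -
  obtain s1 where s1: "s1 > a" "v s1 = 1" "w s1 > 0"
    by (rule crosses_1[OF bk k2 init])
  \<comment> \<open>A quarter of the way from \<open>g1\<close> to \<open>g2\<close>: strictly
    between the roots and below their midpoint \<open>b * p / 2\<close>, which together with
    \<open>k < 2\<close> gives \<open>l \<le> b\<close>.\<close>
  define g where "g = (3 * g1 + g2) / 4"
  have g: "g1 < g" "g < g2" "g > 0" "2 * g < b * p" using g1 by (auto simp: g_def simp flip: sum)
  define l where "l = g * k / 2"
  have l0: "l > 0" using g k_pos by (simp add: l_def)
  have lp: "l * (p - 1) = g" using kp by (simp add: l_def)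
  have kp': "k * p = k + 2" using kp by (simp add: algebra_simps)
  have lb: "l \<le> b"
  proof -
    have "4 * l = 2 * g * k" by (simp add: l_def)
    also have "\<dots> \<le> b * p * k" using g(4) k_pos by (intro mult_right_mono) auto
    also have "\<dots> = b * (k + 2)" by (simp flip: kp' add: mult_ac)
    also have "\<dots> \<le> b * 4" using k2 b_pos by (intro mult_left_mono) auto
    finally show ?thesis by simp
  qed
  note b1 = barrier_slope_at_1[OF sum prod g(1-3) l_def]
  obtain s2 where s2: "s2 > s1" "v s2 > 1" "barrier l s2 > 0"
  proof -
    have "barrier l s1 > 0" using s1 by (simp add: barrier_def)
    then have "\<forall>\<^sub>F s in at s1. barrier l s > 0"
      using isCont_barrier[of s1 l] by (auto simp: isCont_def intro: order_tendstoD)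
    then have 1: "\<forall>\<^sub>F s in at_right s1. barrier l s > 0"
      by (simp add: eventually_at_split)
    obtain d where d: "d > 0" "\<And>h. 0 < h \<Longrightarrow> h < d \<Longrightarrow> v s1 < v (s1 + h)"
      using DERIV_pos_inc_right[OF v_deriv s1(3)] by auto
    have "v s > 1" if "s > s1" "s < s1 + d" for s using d(2)[of "s - s1"] that s1 by simp
    then have "\<forall>\<^sub>F s in at_right s1. v s > 1"
      using d(1) by (auto simp: eventually_at_right_field intro!: exI[of _ "s1 + d"])
    with 1 have "\<forall>\<^sub>F s in at_right s1. s1 < s \<and> v s > 1 \<and> barrier l s > 0"
      using eventually_at_right_less[of s1] by eventually_elim auto
    then show thesis using that eventually_happens' trivial_limit_at_right_real by blast
  qed
  define F where "F s = min (v s - 1) (barrier l s)" for s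
  have Fpos: "F s > 0" if s: "s \<ge> s2" for s
  proof (rule ccontr)
    assume "\<not> F s > 0"
    moreover have "continuous_on {s2..s} F"
      unfolding F_def by (intro continuous_at_imp_continuous_on ballI continuous_intros isCont_barrier)
    moreover have "F s2 > 0" using s2 by (simp add: F_def)
    ultimately obtain z where z: "z > s2" "F z = 0" "\<And>r. s2 \<le> r \<Longrightarrow> r < z \<Longrightarrow> F r > 0"
      using first_zero[of s2 s F thesis] s by fastforce
    have r: "v r > 1" "barrier l r > 0" if "s2 \<le> r" "r < z" for r
      using z(3)[OF that] by (auto simp: F_def)
    have Fz: "v z \<ge> 1" "barrier l z \<ge> 0" using z(2) by (auto simp: F_def min_def split: if_splits)
    define D where "D = \<bar>Bd\<bar> powr (p - 1)"
    define C where "C = l * p * D"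
    \<comment> \<open>A return to \<open>1\<close> in finite time is excluded: on or above the
      barrier \<open>w \<ge> - C * (v - 1)\<close>, where \<open>C\<close> is finite thanks to the
      upper bound \<open>Bd\<close> on the orbit.\<close>
    have "(v s2 - 1) * exp (C * s2) \<le> (v z - 1) * exp (C * z)"
    proof (rule DERIV_nonneg_imp_nondecreasing[where f = "\<lambda>s. (v s - 1) * exp (C * s)"])
      fix u assume u: "s2 \<le> u" "u \<le> z"
      have v1: "v u \<ge> 1" "barrier l u \<ge> 0" using r[of u] Fz u by (cases "u = z"; simp)+
      \<comment> \<open>Convexity at \<open>1\<close>, applied to \<open>1 / v\<close>, gives the
        upper estimate \<open>v powr p - v \<le> p * v powr (p - 1) * (v - 1)\<close>.\<close>
      define y where "y = 1 / v u"
      have y: "y > 0" using v1 by (simp add: y_def)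
      have "y powr p \<ge> 1 + p * (y - 1)" by (rule powr_ge_tangent[OF p_gt_1 y])
      then have "1 / v u powr p \<ge> 1 + p * (1 / v u - 1)" using v1 by (simp add: y_def powr_divide)
      then have "v u powr p * (1 + p * (1 / v u - 1)) \<le> 1"
        using v1 by (simp add: field_simps)
      moreover have "v u powr p * (1 + p * (1 / v u - 1)) = v u powr p - p * (v u powr (p - 1) * (v u - 1))"
        unfolding v_powr using v1 by (simp add: field_simps)
      ultimately have "v u powr p - v u \<le> p * (v u powr (p - 1) * (v u - 1))" using v1 by simp
      also have "\<dots> \<le> p * (D * (v u - 1))"
        unfolding D_def using v1 p_gt_1 bdd[of u] v_pos[of u]
        by (intro mult_left_mono mult_right_mono powr_mono2) auto
      finally have "l * (v u powr p - v u) \<le> l * (p * (D * (v u - 1)))"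
        using l0 by (intro mult_left_mono) auto
      moreover have "w u \<ge> - (l * (v u powr p - v u))" using v1 by (simp add: barrier_def algebra_simps)
      ultimately have "w u + C * (v u - 1) \<ge> 0" by (simp add: C_def mult.assoc)
      then have "exp (C * u) * (w u + C * (v u - 1)) \<ge> 0" by simp
      moreover have "((\<lambda>s. (v s - 1) * exp (C * s)) has_real_derivative exp (C * u) * (w u + C * (v u - 1))) (at u)"
        by (auto intro!: derivative_eq_intros v_deriv simp: algebra_simps)
      ultimately show "\<exists>y. ((\<lambda>s. (v s - 1) * exp (C * s)) has_real_derivative y) (at u) \<and> y \<ge> 0" by blast
    qed (use z in simp)
    moreover have "(v s2 - 1) * exp (C * s2) > 0" using s2 by simp
    ultimately have vz: "v z > 1" by (smt (verit) exp_gt_zero zero_less_mult_iff)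
    then have bz: "barrier l z = 0" using z(2) by (auto simp: F_def min_def split: if_splits)
    have "v z - v z powr p < 0" using self_less_powr[OF p_gt_1 vz] by simp
    then have wz: "w z < 0" using bz l0 by (simp add: barrier_def mult_pos_neg)
    \<comment> \<open>Since \<open>l \<le> b\<close>, the slope for \<open>v > 1\<close> does not
      exceed its value at \<open>v = 1\<close>.\<close>
    have "(l - b) * (p * v z powr (p - 1)) \<le> (l - b) * (p * 1)"
      using lb p_gt_1 vz by (intro mult_left_mono_neg mult_left_mono ge_one_powr_ge_zero) auto
    then have "k\<^sup>2 / l - l + (l - b) * (p * v z powr (p - 1)) < 0" using b1 by simp
    then have "- (k\<^sup>2 / l) * barrier l z + w z * (k\<^sup>2 / l - l + (l - b) * (p * v z powr (p - 1))) > 0"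
      using bz wz by (simp add: mult_neg_neg)
    from DERIV_pos_inc_left[OF barrier_deriv this] l0
    obtain d where d: "d > 0" "\<And>h. 0 < h \<Longrightarrow> h < d \<Longrightarrow> barrier l (z - h) < barrier l z" by auto
    define h where "h = min (d / 2) (z - s2)"
    have "0 < h" "h < d" "s2 \<le> z - h" using d(1) z(1) by (auto simp: h_def)
    then show False using d(2)[of h] bz r[of "z - h"] by simp
  qed
  have inv: "v s > 1" "barrier l s > 0" if "s \<ge> s2" for s
    using Fpos[OF that] by (auto simp: F_def)
  have "\<exists>s3\<ge>s2. w s3 < 0"
  proof (rule ccontr)
    assume "\<not> ?thesis"
    then have w0: "w s \<ge> 0" if "s \<ge> s2" for s using that by force
    have mono: "v x \<le> v y" if "s2 \<le> x" "x \<le> y" for x y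
      by (rule DERIV_nonneg_imp_nondecreasing[OF that(2)]) (use that w0 v_deriv in \<open>meson order_trans\<close>)
    obtain L where L: "(v \<longlongrightarrow> L) at_top" "\<And>x. s2 \<le> x \<Longrightarrow> v x \<le> L"
      by (rule mono_bounded_tendsto_at_top[of s2 v Bd, OF mono]) (use bdd in auto)
    have "L = 1" by (rule limit_eq_1[OF L(1)]) (use L(2)[of s2] v_pos[of s2] in auto)
    then show False using L(2)[of s2] s2 by simp
  qed
  then obtain s3 where s3: "s3 \<ge> s2" "w s3 < 0" by blast
  have wneg: "w s < 0" if s: "s \<ge> s3" for s
  proof -
    have "- w s > 0"
    proof (rule barrier_pos[OF _ _ _ s])
      fix r
      show "((\<lambda>s. - w s) has_real_derivative
         - (k\<^sup>2 * (v r - v r powr p) - b * p * v r powr (p - 1) * w r)) (at r)"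
        by (rule DERIV_minus[OF w_deriv])
      assume r: "s3 < r" "- w r = 0"
      have "v r - v r powr p < 0" using self_less_powr[OF p_gt_1, of "v r"] inv[of r] r s3 by simp
      then show "- (k\<^sup>2 * (v r - v r powr p) - b * p * v r powr (p - 1) * w r) > 0"
        using r k_pos by (simp add: mult_pos_neg)
    qed (use s3 in auto)
    then show ?thesis by simp
  qed
  have anti: "- v x \<le> - v y" if "s3 \<le> x" "x \<le> y" for x y
  proof -
    have "v y \<le> v x"
      by (rule DERIV_nonpos_imp_nonincreasing[OF that(2)]) (use that wneg v_deriv in \<open>meson order_trans less_imp_le\<close>)
    then show ?thesis by simp
  qed
  have bd: "- v x \<le> - 1" if "s3 \<le> x" for x using inv[of x] s3 that by simp
  obtain L where L: "((\<lambda>s. - v s) \<longlongrightarrow> L) at_top"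
    by (rule mono_bounded_tendsto_at_top[of s3 "\<lambda>s. - v s", OF anti bd])
  have vL: "(v \<longlongrightarrow> - L) at_top" using tendsto_minus[OF L] by simp
  have "\<forall>\<^sub>F s in at_top. 1 \<le> v s"
    using eventually_ge_at_top[of s3] by eventually_elim (use bd in force)
  then have "- L \<ge> 1"
    by (rule tendsto_lowerbound[OF vL]) simp
  then have lim: "(v \<longlongrightarrow> 1) at_top" using vL limit_eq_1[OF vL] by simp
  have "\<forall>\<^sub>F s in at_top. v s \<noteq> 1"
    using eventually_ge_at_top[of s2] by eventually_elim (use inv in force)
  then have at1: "filterlim v (at 1) at_top" using lim by (simp add: filterlim_at)
  \<comment> \<open>The bound from the barrier reaches \<open>g\<close> only in the limit;
    \<open>g'\<close> leaves room while staying below \<open>g2\<close>.\<close>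
  define g' where "g' = (g + g2) / 2"
  have g': "g < g'" "g' < g2" using g by (auto simp: g'_def)
  have "((\<lambda>s. l * ((v s powr p - v s) / (v s - 1))) \<longlongrightarrow> l * (p - 1)) at_top"
    by (intro tendsto_mult tendsto_const filterlim_compose[OF powr_quotient_tendsto at1])
  then have "\<forall>\<^sub>F s in at_top. l * ((v s powr p - v s) / (v s - 1)) < g'"
    using g'(1) lp by (auto intro: order_tendstoD)
  then obtain T where T: "\<And>s. s \<ge> T \<Longrightarrow> l * ((v s powr p - v s) / (v s - 1)) < g'"
    by (auto simp: eventually_at_top_linorder)
  show ?thesis
  proof (rule decay_rate[OF sum prod g1(1) g'(2), of 1 "max s3 T"])
    fix s assume "s \<ge> max s3 T"
    then have s: "s \<ge> s3" "s \<ge> T" "s \<ge> s2" using s3 by auto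
    show "1 * (v s - 1) > 0" using inv[OF s(3)] by simp
    show "0 \<le> - w s / (v s - 1)" using inv[OF s(3)] wneg[OF s(1)] by (simp add: divide_nonpos_pos)
    have "- w s / (v s - 1) \<le> l * (v s powr p - v s) / (v s - 1)"
      using inv[OF s(3)] by (intro divide_right_mono) (auto simp: barrier_def algebra_simps)
    also have "\<dots> \<le> g'" using T[OF s(2)] by simp
    finally show "- w s / (v s - 1) \<le> g'" .
  next
    fix A assume "A > 0" "((\<lambda>s. 1 * (v s - 1) * exp (g1 * s)) \<longlongrightarrow> A) at_top"
    then show ?thesis using that by simp
  qed (use lim in auto)
qed

end

section \<open>The radial profile\<close>

text \<open>A globally Lipschitz \<open>C\<^sup>1\<close> function that agrees with \<open>x powr p\<close> on \<open>[0, 1]\<close>, where the profile takes its values.\<close>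

definition ext_powr :: "real \<Rightarrow> real \<Rightarrow> real" where
  "ext_powr p x = (if x \<le> 1 then max 0 x powr p else 1 + p * (x - 1))"

lemma max_0_powr_deriv:
  fixes p :: real
  assumes p: "p > 1"
  shows "((\<lambda>x. max 0 x powr p) has_real_derivative p * max 0 x powr (p - 1)) (at x)"
proof (cases x "0::real" rule: linorder_cases)
  case less
  have "((\<lambda>x. 0) has_real_derivative p * max 0 x powr (p - 1)) (at x)" using less by simp
  then show ?thesis
    by (rule has_field_derivative_transform_within_open[of _ _ _ "{..<0}"]) (use less p in auto)
next
  case equal
  have "((\<lambda>h. (max 0 h powr p) / h) \<longlongrightarrow> 0) (at 0)"
  proof (rule Lim_null_comparison)
    show "\<forall>\<^sub>F h in at 0. norm (max 0 h powr p / h) \<le> \<bar>h\<bar> powr (p - 1)"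
    proof (rule always_eventually, rule allI)
      fix h :: real
      show "norm (max 0 h powr p / h) \<le> \<bar>h\<bar> powr (p - 1)"
        using p powr_add[of h 1 "p - 1"] by (cases "h > 0") (auto simp: max_def)
    qed
    show "((\<lambda>h::real. \<bar>h\<bar> powr (p - 1)) \<longlongrightarrow> 0) (at 0)"
      using p by real_asymp
  qed
  then show ?thesis using equal p by (simp add: has_field_derivative_iff)
next
  case greater
  have "((\<lambda>x. x powr p) has_real_derivative p * max 0 x powr (p - 1)) (at x)"
    using greater by (auto intro!: derivative_eq_intros)
  then show ?thesis
    by (rule has_field_derivative_transform_within_open[of _ _ _ "{0<..}"]) (use greater in auto)
qed

lemma ext_powr_deriv:
  assumes p: "p > 1"
  shows "(ext_powr p has_real_derivative p * (min 1 (max 0 x)) powr (p - 1)) (at x)"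
proof (cases x "1::real" rule: linorder_cases)
  case less
  have "((\<lambda>x. max 0 x powr p) has_real_derivative p * min 1 (max 0 x) powr (p - 1)) (at x)"
    using max_0_powr_deriv[OF p, of x] less by (simp add: min_absorb2)
  then show ?thesis
    by (rule has_field_derivative_transform_within_open[of _ _ _ "{..<1}"]) (use less in \<open>auto simp: ext_powr_def\<close>)
next
  case greater
  have "((\<lambda>x. 1 + p * (x - 1)) has_real_derivative p * min 1 (max 0 x) powr (p - 1)) (at x)"
    using greater by (auto intro!: derivative_eq_intros)
  then show ?thesis
    by (rule has_field_derivative_transform_within_open[of _ _ _ "{1<..}"]) (use greater in \<open>auto simp: ext_powr_def\<close>)
next
  case equal
  have l: "(ext_powr p has_real_derivative p) (at 1 within {..<1})"
  proof -
    have "((\<lambda>x. max 0 x powr p) has_real_derivative p) (at 1 within {..<1})"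
      using has_field_derivative_at_within[OF max_0_powr_deriv[OF p, of 1]] by simp
    then show ?thesis unfolding has_field_derivative_iff
      by (rule Lim_transform_eventually) (auto simp: ext_powr_def eventually_at_filter)
  qed
  have r: "(ext_powr p has_real_derivative p) (at 1 within {1<..})"
  proof -
    have "((\<lambda>x. 1 + p * (x - 1)) has_real_derivative p) (at 1 within {1<..})"
      by (auto intro!: derivative_eq_intros)
    then show ?thesis unfolding has_field_derivative_iff
      by (rule Lim_transform_eventually) (auto simp: ext_powr_def eventually_at_filter)
  qed
  show ?thesis
    using filterlim_split_at[OF l[unfolded has_field_derivative_iff] r[unfolded has_field_derivative_iff]] equal
    by (simp add: has_field_derivative_iff)
qed

lemma ext_powr_lipschitz:
  assumes p: "p > 1"
  shows "\<bar>ext_powr p x - ext_powr p y\<bar> \<le> p * \<bar>x - y\<bar>"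
proof -
  have "norm (ext_powr p x - ext_powr p y) \<le> p * norm (x - y)"
  proof (rule field_differentiable_bound[of UNIV])
    fix z :: real
    have "min 1 (max 0 z) powr (p - 1) \<le> 1" using p by (intro powr_le1) auto
    then show "norm (p * min 1 (max 0 z) powr (p - 1)) \<le> p" using p by (simp add: abs_mult mult_left_le)
  qed (use ext_powr_deriv[OF p] in auto)
  then show ?thesis by simp
qed

lemma ext_powr_mono:
  assumes p: "p > 1" and xy: "x \<le> y"
  shows "ext_powr p x \<le> ext_powr p y"
  by (rule DERIV_nonneg_imp_nondecreasing[OF xy]) (use p ext_powr_deriv[OF p] in force)

lemma ext_powr_nonneg: "p > 1 \<Longrightarrow> ext_powr p x \<ge> 0"
  by (auto simp: ext_powr_def)

text \<open>One-sided derivatives at \<open>0\<close> suffice, because the argument will be \<open>y \<bullet> y\<close>.\<close>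

primrec Ck_nonneg :: "nat \<Rightarrow> (real \<Rightarrow> real) \<Rightarrow> bool" where
  "Ck_nonneg 0 \<phi> \<longleftrightarrow> continuous_on {0..} \<phi>"
| "Ck_nonneg (Suc n) \<phi> \<longleftrightarrow>
    (\<exists>\<phi>'. (\<forall>t\<ge>0. (\<phi> has_real_derivative \<phi>' t) (at t within {0..})) \<and> Ck_nonneg n \<phi>')"

section \<open>Calculus of smooth functions on the closed half-line\<close>

lemma Ck_nonneg_continuous: "Ck_nonneg n \<phi> \<Longrightarrow> continuous_on {0..} \<phi>"
  by (cases n) (auto simp: continuous_on_eq_continuous_within intro: DERIV_continuous)

lemma Ck_nonneg_SucI:
  assumes "\<And>t. t \<ge> 0 \<Longrightarrow> (\<phi> has_real_derivative \<phi>' t) (at t within {0..})" "Ck_nonneg n \<phi>'"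
  shows "Ck_nonneg (Suc n) \<phi>"
  using assms by auto

lemma Ck_nonneg_SucD: "Ck_nonneg (Suc n) \<phi> \<Longrightarrow> Ck_nonneg n \<phi>"
proof (induction n arbitrary: \<phi>)
  case 0
  then show ?case using Ck_nonneg_continuous[OF 0] by simp
qed fastforce

lemma Ck_nonneg_cong:
  assumes "Ck_nonneg n \<phi>" "\<And>t. t \<ge> 0 \<Longrightarrow> \<phi> t = \<psi> t"
  shows "Ck_nonneg n \<psi>"
proof (cases n)
  case 0
  then show ?thesis using assms continuous_on_cong[of "{0..}" "{0..}" \<phi> \<psi>] by simp
next
  case (Suc m)
  then obtain \<phi>' where "\<forall>t\<ge>0. (\<phi> has_real_derivative \<phi>' t) (at t within {0..})" "Ck_nonneg m \<phi>'"
    using assms by auto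
  moreover have "(\<psi> has_real_derivative \<phi>' t) (at t within {0..})"
    if "(\<phi> has_real_derivative \<phi>' t) (at t within {0..})" "t \<ge> 0" for t
    by (rule has_field_derivative_transform_within[OF that(1), of 1]) (use that assms in auto)
  ultimately show ?thesis using Suc by auto
qed

lemma Ck_nonneg_const: "Ck_nonneg n (\<lambda>_. c)"
proof (induction n arbitrary: c)
  case (Suc n)
  show ?case by (rule Ck_nonneg_SucI[OF _ Suc[of 0]]) auto
qed simp

lemma Ck_nonneg_add: "Ck_nonneg n \<phi> \<Longrightarrow> Ck_nonneg n \<psi> \<Longrightarrow> Ck_nonneg n (\<lambda>t. \<phi> t + \<psi> t)"
proof (induction n arbitrary: \<phi> \<psi>)
  case (Suc n)
  obtain \<phi>' where d1: "\<And>t. t \<ge> 0 \<Longrightarrow> (\<phi> has_real_derivative \<phi>' t) (at t within {0..})" "Ck_nonneg n \<phi>'"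
    using Suc.prems(1) by auto
  obtain \<psi>' where d2: "\<And>t. t \<ge> 0 \<Longrightarrow> (\<psi> has_real_derivative \<psi>' t) (at t within {0..})" "Ck_nonneg n \<psi>'"
    using Suc.prems(2) by auto
  show ?case
    by (rule Ck_nonneg_SucI[OF _ Suc.IH[OF d1(2) d2(2)]]) (use d1 d2 in \<open>auto intro!: DERIV_add\<close>)
qed (auto intro: continuous_intros)

lemma Ck_nonneg_mult: "Ck_nonneg n \<phi> \<Longrightarrow> Ck_nonneg n \<psi> \<Longrightarrow> Ck_nonneg n (\<lambda>t. \<phi> t * \<psi> t)"
proof (induction n arbitrary: \<phi> \<psi>)
  case (Suc n)
  obtain \<phi>' where d1: "\<And>t. t \<ge> 0 \<Longrightarrow> (\<phi> has_real_derivative \<phi>' t) (at t within {0..})" "Ck_nonneg n \<phi>'"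
    using Suc.prems(1) by auto
  obtain \<psi>' where d2: "\<And>t. t \<ge> 0 \<Longrightarrow> (\<psi> has_real_derivative \<psi>' t) (at t within {0..})" "Ck_nonneg n \<psi>'"
    using Suc.prems(2) by auto
  note pr = Suc.prems[THEN Ck_nonneg_SucD]
  have "Ck_nonneg n (\<lambda>t. \<phi>' t * \<psi> t + \<psi>' t * \<phi> t)"
    by (intro Ck_nonneg_add Suc.IH d1 d2 pr)
  then show ?case
    by (rule Ck_nonneg_SucI[rotated]) (use d1 d2 in \<open>auto intro!: DERIV_mult\<close>)
qed (auto intro: continuous_intros)

lemma Ck_nonneg_powr:
  assumes "\<And>t. t \<ge> 0 \<Longrightarrow> \<phi> t > 0" "Ck_nonneg n \<phi>"
  shows "Ck_nonneg n (\<lambda>t. \<phi> t powr a)"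
  using assms(2)
proof (induction n arbitrary: a)
  case 0
  then show ?case using assms(1) by (force intro!: continuous_intros)
next
  case (Suc n)
  then obtain \<phi>' where d: "\<And>t. t \<ge> 0 \<Longrightarrow> (\<phi> has_real_derivative \<phi>' t) (at t within {0..})" "Ck_nonneg n \<phi>'"
    by auto
  have "((\<lambda>t. \<phi> t powr a) has_real_derivative a * (\<phi> t powr (a - 1) * \<phi>' t)) (at t within {0..})" if t: "t \<ge> 0" for t
  proof -
    have "((\<lambda>y. y powr a) has_real_derivative a * \<phi> t powr (a - 1)) (at (\<phi> t))"
      using assms(1)[OF t] by (auto intro!: derivative_eq_intros)
    from DERIV_chain2[OF this d(1)[OF t]] show ?thesis by (simp add: mult.assoc)
  qed
  moreover note pr = Ck_nonneg_SucD[OF Suc.prems]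
  have "Ck_nonneg n (\<lambda>t. a * (\<phi> t powr (a - 1) * \<phi>' t))"
    by (intro Ck_nonneg_mult Ck_nonneg_const Suc.IH[OF pr] d)
  ultimately show ?case by (rule Ck_nonneg_SucI)
qed

lemma Ck_nonneg_wavg: "Ck_nonneg n \<phi> \<Longrightarrow> Ck_nonneg n (wavg j \<phi>)"
proof (induction n arbitrary: \<phi> j)
  case 0
  then show ?case by (simp add: continuous_on_wavg)
next
  case (Suc n)
  then obtain \<phi>' where d: "\<And>t. t \<ge> 0 \<Longrightarrow> (\<phi> has_real_derivative \<phi>' t) (at t within {0..})" "Ck_nonneg n \<phi>'"
    by auto
  show ?case
    by (rule Ck_nonneg_SucI[OF wavg_has_derivative[OF d(1) Ck_nonneg_continuous[OF d(2)]] Suc.IH[OF d(2)]])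
qed

lemma Ck_nonneg_scale:
  assumes c: "c \<ge> 0"
  shows "Ck_nonneg n \<phi> \<Longrightarrow> Ck_nonneg n (\<lambda>t. \<phi> (c * t))"
proof (induction n arbitrary: \<phi>)
  case 0
  then have "continuous_on {0..} \<phi>" by simp
  then have "continuous_on {0..} (\<lambda>t. \<phi> (c * t))"
    by (rule continuous_on_compose2) (use c in \<open>auto intro!: continuous_intros\<close>)
  then show ?case by simp
next
  case (Suc n)
  then obtain \<phi>' where d: "\<And>t. t \<ge> 0 \<Longrightarrow> (\<phi> has_real_derivative \<phi>' t) (at t within {0..})" "Ck_nonneg n \<phi>'"
    by auto
  have "((\<lambda>t. \<phi> (c * t)) has_real_derivative c * \<phi>' (c * t)) (at t within {0..})" if t: "t \<ge> 0" for t
  proof -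
    have im: "(\<lambda>t. c * t) ` {0..} \<subseteq> {0..}" using c by auto
    have "(\<phi> has_real_derivative \<phi>' (c * t)) (at (c * t) within (\<lambda>t. c * t) ` {0..})"
      by (rule has_field_derivative_subset[OF d(1) im]) (use c t in auto)
    moreover have "((\<lambda>t. c * t) has_real_derivative c) (at t within {0..})"
      by (auto intro!: derivative_eq_intros)
    ultimately show ?thesis using DERIV_image_chain[of \<phi> "\<phi>' (c * t)" "\<lambda>t. c * t" t "{0..}" c] by (simp add: o_def mult.commute)
  qed
  moreover have "Ck_nonneg n (\<lambda>t. c * \<phi>' (c * t))"
    by (intro Ck_nonneg_mult Ck_nonneg_const Suc.IH d)
  ultimately show ?case by (rule Ck_nonneg_SucI)
qed

locale emden_params =
  fixes N :: nat and k p b :: real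
  assumes N_ge_3: "N \<ge> 3" and N_eq: "real N = 2 * k + 2" and k_times_p: "k * (p - 1) = 2"
    and b_positive: "b > 0"
begin

lemma k_positive: "k > 0"
proof -
  have "real N \<ge> 3" using N_ge_3 by simp
  then show ?thesis using N_eq by linarith
qed

lemma p_greater_1: "p > 1"
  using k_times_p k_positive by (smt (verit) mult_nonneg_nonpos)

lemma kp_eq: "k * p = k + 2"
  using k_times_p by (simp add: algebra_simps)

lemma Suc_N: "Suc (N - 1) = N"
  using N_ge_3 by simp

text \<open>With \<open>t = r\<^sup>2\<close> and \<open>\<phi> = G powr p\<close>, one integration of the radial equation for \<open>g(r) = G(t)\<close> gives the equation
  \<open>G' = rhs \<phi>\<close>, which is no longer singular at \<open>t = 0\<close>.\<close>

definition rhs :: "(real \<Rightarrow> real) \<Rightarrow> real \<Rightarrow> real" where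
  "rhs \<phi> t = - (b / 2) * \<phi> t - k * (k - b) / 2 * wavg (N - 1) \<phi> t"

lemma rhs_deriv:
  assumes "\<And>t. t \<ge> 0 \<Longrightarrow> (\<phi> has_real_derivative \<phi>' t) (at t within {0..})"
    and "continuous_on {0..} \<phi>'" and "t \<ge> 0"
  shows "(rhs \<phi> has_real_derivative
    - (b / 2) * \<phi>' t - k * (k - b) / 2 * wavg (N - 1 + 2) \<phi>' t) (at t within {0..})"
  unfolding rhs_def[abs_def]
  by (intro DERIV_diff DERIV_cmult assms wavg_has_derivative)

text \<open>\<open>wavg_ode\<close> cancels the nonlocal term, so a solution of
  \<open>G' = rhs \<phi>\<close> satisfies the radial equation in the variable \<open>t\<close>,
  where the Laplacian reads \<open>4 * t * G'' + 2 * real N * G'\<close>.\<close>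

lemma rhs_ode:
  assumes "\<And>t. t \<ge> 0 \<Longrightarrow> (\<phi> has_real_derivative \<phi>' t) (at t within {0..})"
    and "continuous_on {0..} \<phi>'" and "t \<ge> 0"
  shows "2 * t * (- (b / 2) * \<phi>' t - k * (k - b) / 2 * wavg (N - 1 + 2) \<phi>' t) + real N * rhs \<phi> t
    = - b * t * \<phi>' t - ((k + 2) * b + k\<^sup>2) / 2 * \<phi> t"
proof -
  have "2 * t * (- (b / 2) * \<phi>' t - k * (k - b) / 2 * wavg (N - 1 + 2) \<phi>' t) + real N * rhs \<phi> t
    = - b * t * \<phi>' t - real N * (b / 2) * \<phi> t
      - k * (k - b) / 2 * (2 * t * wavg (N - 1 + 2) \<phi>' t + real N * wavg (N - 1) \<phi> t)"
    by (simp add: rhs_def algebra_simps)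
  also have "2 * t * wavg (N - 1 + 2) \<phi>' t + real N * wavg (N - 1) \<phi> t = \<phi> t"
    using wavg_ode[OF assms, of "N - 1"] by (simp only: Suc_N)
  also have "- b * t * \<phi>' t - real N * (b / 2) * \<phi> t - k * (k - b) / 2 * \<phi> t
    = - b * t * \<phi>' t - ((k + 2) * b + k\<^sup>2) / 2 * \<phi> t"
    unfolding N_eq by (simp add: field_simps power2_eq_square)
  finally show ?thesis .
qed

lemma rhs_at_0: "rhs \<phi> 0 = - (b / 2 + k * (k - b) / (2 * real N)) * \<phi> 0"
  unfolding rhs_def wavg_at_0 Suc_N by (simp add: field_simps)

end

text \<open>\<open>ext_powr\<close> stands for the power so that global existence is available
  before \<open>0 < G \<le> 1\<close> is known; these bounds are derived from the equation
  afterwards.\<close>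

locale emden_profile = emden_params +
  fixes G :: "real \<Rightarrow> real"
  assumes G_0: "G 0 = 1"
    and G_deriv: "t \<ge> 0 \<Longrightarrow> (G has_real_derivative rhs (\<lambda>t. ext_powr p (G t)) t) (at t within {0..})"
begin

lemma continuous_G: "continuous_on {0..} G"
  using G_deriv by (auto simp: continuous_on_eq_continuous_within intro: DERIV_continuous)

lemma continuous_ext_powr: "continuous_on S (ext_powr p)"
  by (rule continuous_at_imp_continuous_on) (use ext_powr_deriv[OF p_greater_1] in \<open>blast intro: DERIV_isCont\<close>)

lemma continuous_ext_G: "continuous_on {0..} (\<lambda>t. ext_powr p (G t))"
  by (rule continuous_on_compose2[OF continuous_ext_powr continuous_G]) auto

text \<open>At a maximum point of \<open>G\<close> over an initial interval the nonlocal right-hand side is negative,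
  so the maximum is attained at \<open>0\<close>.\<close>

lemma G_le_1:
  assumes t: "t \<ge> 0"
  shows "G t \<le> 1"
proof (rule ccontr)
  assume "\<not> G t \<le> 1"
  then have Gt: "G t > 1" by simp
  have "continuous_on {0..t} G" using continuous_G by (rule continuous_on_subset) auto
  then obtain r where r: "0 \<le> r" "r \<le> t" "\<And>u. 0 \<le> u \<Longrightarrow> u \<le> t \<Longrightarrow> G u \<le> G r"
    using continuous_attains_sup[of "{0..t}" G] t by auto
  have Gr: "G r > 1" using r(3)[of t] t Gt by simp
  have r0: "r > 0" using Gr G_0 r(1) by (cases "r = 0") auto
  define \<phi> where "\<phi> t = ext_powr p (G t)" for t
  have \<phi>r: "\<phi> r > 0" using Gr p_greater_1 by (auto simp: \<phi>_def ext_powr_def add_pos_pos)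
  have cont: "continuous_on {0..} \<phi>" unfolding \<phi>_def by (rule continuous_ext_G)
  have le: "wavg (N - 1) \<phi> r \<le> \<phi> r / real N"
    using wavg_le[OF cont r(1), of "\<phi> r" "N - 1"] ext_powr_mono[OF p_greater_1] r
    unfolding Suc_N by (auto simp: \<phi>_def)
  have ge: "wavg (N - 1) \<phi> r \<ge> 0"
    by (rule wavg_nonneg[OF cont r(1)]) (simp add: \<phi>_def ext_powr_nonneg p_greater_1)
  \<comment> \<open>The sign of \<open>k - b\<close> decides which bound on the average is useful:
    nonnegativity, or the value \<open>\<phi> r / real N\<close> that the maximum point
    provides.\<close>
  have "rhs \<phi> r < 0"
  proof (cases "k \<ge> b")
    case True
    then have "k * (k - b) / 2 * wavg (N - 1) \<phi> r \<ge> 0" using ge k_positive by simp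
    moreover have "b / 2 * \<phi> r > 0" using b_positive \<phi>r by simp
    ultimately show ?thesis unfolding rhs_def by linarith
  next
    case False
    have "- (k * (k - b) / 2) * wavg (N - 1) \<phi> r \<le> - (k * (k - b) / 2) * (\<phi> r / real N)"
      using False k_positive le by (intro mult_left_mono) (auto simp: mult_nonneg_nonpos)
    then have "rhs \<phi> r \<le> - (b / 2) * \<phi> r - (k * (k - b) / 2) * (\<phi> r / real N)"
      unfolding rhs_def by simp
    also have "\<dots> = - (\<phi> r / real N) * ((k + 2) * b + k\<^sup>2) / 2"
      using k_positive unfolding N_eq by (simp add: field_simps power2_eq_square)
    also have "\<dots> < 0"
      using \<phi>r b_positive k_positive N_ge_3 by (auto intro!: divide_pos_pos mult_pos_pos add_pos_pos)
    finally show ?thesis .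
  qed
  moreover have "(G has_real_derivative rhs \<phi> r) (at r)"
    using G_deriv[of r] r0 at_within_interior[of r "{0..}"] unfolding \<phi>_def[abs_def] by simp
  ultimately obtain d where d: "d > 0" "\<And>h. 0 < h \<Longrightarrow> h < d \<Longrightarrow> G r < G (r - h)"
    using DERIV_neg_dec_left[of G "rhs \<phi> r" r] by auto
  define h where "h = min (d / 2) r"
  have "0 < h" "h < d" "h \<le> r" using d(1) r0 by (auto simp: h_def)
  then show False using d(2)[of h] r(2) r(3)[of "r - h"] by simp
qed

text \<open>The truncation at \<open>0\<close> remains because positivity of \<open>G\<close> is
  obtained only later, from the energy.\<close>

definition P :: "real \<Rightarrow> real" where "P t = max 0 (G t) powr p"
definition P' :: "real \<Rightarrow> real" where "P' t = p * max 0 (G t) powr (p - 1) * rhs P t"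

lemma ext_G_eq_P: "t \<ge> 0 \<Longrightarrow> ext_powr p (G t) = P t"
  using G_le_1 by (simp add: ext_powr_def P_def)

lemma wavg_ext_eq: "t \<ge> 0 \<Longrightarrow> wavg j (\<lambda>t. ext_powr p (G t)) t = wavg j P t"
  unfolding wavg_def by (intro Henstock_Kurzweil_Integration.integral_cong) (simp add: ext_G_eq_P)

lemma G_deriv_P: "t \<ge> 0 \<Longrightarrow> (G has_real_derivative rhs P t) (at t within {0..})"
  using G_deriv[of t] by (simp add: rhs_def ext_G_eq_P wavg_ext_eq)

lemma P_deriv: "t \<ge> 0 \<Longrightarrow> (P has_real_derivative P' t) (at t within {0..})"
  unfolding P_def[abs_def] P'_def
  using DERIV_chain2[OF max_0_powr_deriv[OF p_greater_1] G_deriv_P] by (simp add: P_def[abs_def])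

lemma continuous_P: "continuous_on {0..} P"
  using P_deriv by (auto simp: continuous_on_eq_continuous_within intro: DERIV_continuous)

lemma continuous_rhs_P: "continuous_on {0..} (rhs P)"
  unfolding rhs_def[abs_def] by (intro continuous_intros continuous_P continuous_on_wavg)

lemma continuous_P': "continuous_on {0..} P'"
  unfolding P'_def using p_greater_1
  by (intro continuous_intros continuous_on_powr' continuous_rhs_P continuous_G) auto

definition G2 :: "real \<Rightarrow> real" where
  "G2 t = - (b / 2) * P' t - k * (k - b) / 2 * wavg (N - 1 + 2) P' t"

lemma rhs_P_deriv: "t \<ge> 0 \<Longrightarrow> (rhs P has_real_derivative G2 t) (at t within {0..})"
  unfolding G2_def by (rule rhs_deriv[OF P_deriv continuous_P'])

lemma G2_ode: "t \<ge> 0 \<Longrightarrow> 2 * t * G2 t + real N * rhs P t = - b * t * P' t - ((k + 2) * b + k\<^sup>2) / 2 * P t"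
  unfolding G2_def by (rule rhs_ode[OF P_deriv continuous_P'])

lemma within_eq_at: "t > 0 \<Longrightarrow> at t within {0..} = at (t::real)"
  using at_within_interior[of t "{0..}"] by simp

definition v :: "real \<Rightarrow> real" where "v s = exp (k * s) * G (exp (2 * s))"
definition w :: "real \<Rightarrow> real" where
  "w s = exp (k * s) * (k * G (exp (2 * s)) + 2 * exp (2 * s) * rhs P (exp (2 * s)))"

lemma v_deriv: "(v has_real_derivative w s) (at s)"
proof -
  have g: "(G has_real_derivative rhs P (exp (2 * s))) (at (exp (2 * s)))"
    using G_deriv_P[of "exp (2 * s)"] by (simp add: within_eq_at)
  have e: "((\<lambda>s. exp (2 * s)) has_real_derivative 2 * exp (2 * s)) (at s)"
    by (auto intro!: derivative_eq_intros)
  note c = DERIV_chain2[OF g e]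
  show ?thesis
    unfolding v_def w_def by (rule c derivative_eq_intros refl)+ (simp add: algebra_simps)
qed

text \<open>The system is autonomous because \<open>k * p = k + 2\<close>: raising
  \<open>exp (k * s)\<close> to the power \<open>p\<close> produces exactly the additional factor
  \<open>exp (2 * s) = t\<close>. The truncation is carried along since this equation is used to
  prove \<open>v > 0\<close>.\<close>

lemma w_deriv:
  "(w has_real_derivative k\<^sup>2 * (v s - max 0 (v s) powr p) - b * p * max 0 (v s) powr (p - 1) * w s) (at s)"
proof -
  define t where "t = exp (2 * s)"
  define E where "E = exp (k * s)"
  have t0: "t > 0" by (simp add: t_def)
  have g: "(G has_real_derivative rhs P (exp (2 * s))) (at (exp (2 * s)))"
    using G_deriv_P[of "exp (2 * s)"] by (simp add: within_eq_at)
  have g2: "(rhs P has_real_derivative G2 (exp (2 * s))) (at (exp (2 * s)))"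
    using rhs_P_deriv[of "exp (2 * s)"] by (simp add: within_eq_at)
  have e: "((\<lambda>s. exp (2 * s)) has_real_derivative 2 * exp (2 * s)) (at s)"
    by (auto intro!: derivative_eq_intros)
  have m: "max 0 (v s) = E * max 0 (G t)"
    by (simp add: v_def E_def t_def max_mult_distrib_left)
  have "E powr p = exp (k * p * s)" by (simp add: E_def powr_def)
  also have "k * p * s = k * s + 2 * s" unfolding kp_eq by (simp add: algebra_simps)
  finally have "E powr p = E * t" by (simp add: E_def t_def exp_add)
  then have mp: "max 0 (v s) powr p = E * t * P t"
    unfolding m P_def by (simp add: powr_mult E_def)
  have "E powr (p - 1) = exp (k * (p - 1) * s)" by (simp add: E_def powr_def)
  then have "E powr (p - 1) = t" unfolding k_times_p by (simp add: t_def)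
  then have mp1: "max 0 (v s) powr (p - 1) = t * max 0 (G t) powr (p - 1)"
    unfolding m by (simp add: powr_mult E_def)
  have GP: "max 0 (G t) powr (p - 1) * G t = P t"
    using powr_add[of "G t" 1 "p - 1"] by (cases "G t > 0") (auto simp: P_def max_def)
  have "(w has_real_derivative E * (k\<^sup>2 * G t + 2 * t * (2 * t * G2 t + (2 * k + 2) * rhs P t))) (at s)"
    unfolding w_def
    by (rule DERIV_chain2[OF g e] DERIV_chain2[OF g2 e] derivative_eq_intros refl)+
       (simp add: E_def t_def algebra_simps power2_eq_square)
  also have "2 * t * G2 t + (2 * k + 2) * rhs P t = - b * t * P' t - ((k + 2) * b + k\<^sup>2) / 2 * P t"
    using G2_ode[of t] t0 by (simp add: N_eq)
  also have "E * (k\<^sup>2 * G t + 2 * t * (- b * t * P' t - ((k + 2) * b + k\<^sup>2) / 2 * P t)) =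
     k\<^sup>2 * (v s - max 0 (v s) powr p) - b * p * max 0 (v s) powr (p - 1) * w s"
  proof -
    have "b * p * max 0 (v s) powr (p - 1) * w s =
      b * t * E * ((k * p) * (max 0 (G t) powr (p - 1) * G t) + 2 * t * P' t)"
      unfolding mp1 w_def P'_def E_def[symmetric] t_def[symmetric] by (simp add: algebra_simps)
    also have "\<dots> = b * t * E * ((k + 2) * P t + 2 * t * P' t)"
      unfolding GP kp_eq ..
    finally have 1: "b * p * max 0 (v s) powr (p - 1) * w s = b * t * E * ((k + 2) * P t + 2 * t * P' t)" .
    have vE: "v s = E * G t" by (simp add: v_def E_def t_def)
    show ?thesis unfolding 1 mp unfolding vE by (simp add: field_simps)
  qed
  finally show ?thesis .
qed

text \<open>The energy vanishes at \<open>s = - \<infinity>\<close> and is nonnegative where \<open>v = 0\<close>; it decreases along the orbit, which therefore never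
  returns to \<open>v = 0\<close>.\<close>

definition energy :: "real \<Rightarrow> real" where
  "energy s = (w s)\<^sup>2 / 2 + k\<^sup>2 * (max 0 (v s) powr (p + 1) / (p + 1) - (v s)\<^sup>2 / 2)"

text \<open>Multiplying the equation by \<open>w\<close> makes the conservative terms an exact
  derivative and leaves the damping term, which is quadratic in \<open>w\<close>.\<close>

lemma energy_decreasing: "s \<le> r \<Longrightarrow> energy r \<le> energy s"
proof (rule DERIV_nonpos_imp_nonincreasing[where f = energy])
  fix u
  have p1: "p + 1 \<noteq> 0" using p_greater_1 by simp
  have d: "((\<lambda>s. max 0 (v s) powr (p + 1)) has_real_derivative ((p + 1) * max 0 (v u) powr p) * w u) (at u)"
    using DERIV_chain2[OF max_0_powr_deriv[of "p + 1"] v_deriv, of u] p_greater_1 by simp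
  have "(energy has_real_derivative - (b * p * max 0 (v u) powr (p - 1) * (w u)\<^sup>2)) (at u)"
    unfolding energy_def
    by (rule DERIV_cong[OF DERIV_add[OF DERIV_cdivide[OF DERIV_power[OF w_deriv]]
          DERIV_cmult[OF DERIV_diff[OF DERIV_cdivide[OF d] DERIV_cdivide[OF DERIV_power[OF v_deriv]]]]]])
       (use p1 in \<open>simp add: divide_simps; simp add: algebra_simps power2_eq_square\<close>)
  moreover have "- (b * p * max 0 (v u) powr (p - 1) * (w u)\<^sup>2) \<le> 0"
    using b_positive p_greater_1 by simp
  ultimately show "\<exists>y. (energy has_real_derivative y) (at u) \<and> y \<le> 0" by blast
qed

text \<open>As \<open>s\<close> tends to \<open>- \<infinity>\<close>, \<open>w\<close> behaves like
  \<open>k * v\<close>, so \<open>w\<^sup>2 / 2\<close> and \<open>k\<^sup>2 * v\<^sup>2 / 2\<close>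
  cancel to leading order; the next order carries the factor \<open>exp (2 * s)\<close> and the
  coefficient \<open>Q 0 = - (k * b * (k + 2)) / real N\<close>. Monotonicity transports the sign to
  every \<open>s\<close>.\<close>

lemma energy_negative: "energy s < 0"
proof -
  define Q where "Q t = 2 * k * G t * rhs P t + 2 * t * (rhs P t)\<^sup>2 + k\<^sup>2 * (max 0 (G t) powr (p + 1) / (p + 1))" for t
  have Q: "energy s = exp (2 * k * s) * exp (2 * s) * Q (exp (2 * s))" for s
  proof -
    define t where "t = exp (2 * s)"
    define E where "E = exp (k * s)"
    have m: "max 0 (v s) = E * max 0 (G t)"
      by (simp add: v_def E_def t_def max_mult_distrib_left)
    have "E powr (p + 1) = exp ((k * p + k) * s)" by (simp add: E_def powr_def algebra_simps)
    also have "(k * p + k) * s = k * s + k * s + 2 * s" unfolding kp_eq by (simp add: algebra_simps)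
    finally have "E powr (p + 1) = E * E * t" by (simp only: E_def t_def exp_add)
    then have mp: "max 0 (v s) powr (p + 1) = E * E * t * max 0 (G t) powr (p + 1)"
      unfolding m by (simp add: powr_mult E_def)
    have "2 * k * s = k * s + k * s" by simp
    then have EE: "exp (2 * k * s) = E * E" by (simp only: E_def exp_add)
    show ?thesis
      unfolding energy_def mp EE Q_def unfolding w_def v_def E_def[symmetric] t_def[symmetric]
      by (simp add: field_simps power2_eq_square)
  qed
  have "continuous_on {0..} Q"
    unfolding Q_def using p_greater_1
    by (intro continuous_intros continuous_on_powr' continuous_rhs_P continuous_G) auto
  then have "(Q \<longlongrightarrow> Q 0) (at 0 within {0..})"
    unfolding continuous_on_def by simp
  then have "(Q \<longlongrightarrow> Q 0) (at_right 0)"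
    by (simp add: at_within_Ici_at_right)
  moreover have "Q 0 < 0"
  proof -
    have "Q 0 = - (k * b) - k * (k * (k - b) / real N) + k\<^sup>2 / (p + 1)"
    proof -
      define c where "c = k * (k - b) / real N"
      have c2: "k * (k - b) / (2 * real N) = c / 2" by (simp add: c_def)
      show ?thesis
        unfolding Q_def rhs_at_0 P_def G_0 c2 c_def[symmetric] by (simp add: algebra_simps)
    qed
    also have "p + 1 = real N / k" using k_positive kp_eq unfolding N_eq by (simp add: field_simps)
    also have "- (k * b) - k * (k * (k - b) / real N) + k\<^sup>2 / (real N / k) = - (k * b * (k + 2)) / real N"
    proof -
      have "- (k * b) - k * (k * (k - b) / real N) + k\<^sup>2 / (real N / k) =
          (- (k * b) * real N - k * (k * (k - b)) + k * k * k) / real N"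
        using k_positive N_ge_3 by (simp add: add_divide_distrib diff_divide_distrib power2_eq_square)
      also have "- (k * b) * real N - k * (k * (k - b)) + k * k * k = - (k * b * (k + 2))"
        unfolding N_eq by (simp add: algebra_simps)
      finally show ?thesis .
    qed
    also have "\<dots> < 0" using k_positive b_positive N_ge_3 by simp
    finally show ?thesis .
  qed
  ultimately have "\<forall>\<^sub>F t in at_right 0. Q t < 0" by (rule order_tendstoD)
  then obtain d where d: "d > 0" "\<And>t. 0 < t \<Longrightarrow> t < d \<Longrightarrow> Q t < 0"
    unfolding eventually_at_right_field by auto
  define a where "a = min s (ln (d / 2) / 2)"
  have "exp (2 * a) \<le> exp (ln (d / 2))" unfolding exp_le_cancel_iff by (simp add: a_def)
  then have "exp (2 * a) < d" using d(1) by simp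
  then have "Q (exp (2 * a)) < 0" using d(2) by simp
  then have "energy a < 0" unfolding Q by (simp add: mult_pos_neg)
  then show ?thesis using energy_decreasing[of a s] by (simp add: a_def)
qed

lemma v_nonzero: "v s \<noteq> 0"
  using energy_negative[of s] p_greater_1 unfolding energy_def by (auto simp: not_less)

lemma G_positive:
  assumes t: "t \<ge> 0"
  shows "G t > 0"
proof (rule ccontr)
  assume "\<not> G t > 0"
  moreover have "continuous_on {0..t} G" using continuous_G by (rule continuous_on_subset) auto
  ultimately obtain u where u: "0 \<le> u" "u \<le> t" "G u = 0"
    using IVT2'[of G t 0 0] G_0 t by auto
  then have "u > 0" using G_0 by (cases "u = 0") auto
  then have "v (ln u / 2) = 0" using u by (simp add: v_def)
  then show False using v_nonzero by blast
qed

end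

context emden_params begin

lemma profile_exists: obtains G where "emden_profile N k p b G"
proof -
  obtain G where G: "G 0 = 1" "\<And>t. t \<ge> 0 \<Longrightarrow>
    (G has_real_derivative - (b / 2) * ext_powr p (G t) + - (k * (k - b) / 2) * wavg (N - 1) (\<lambda>u. ext_powr p (G u)) t) (at t within {0..})"
    using volterra_solution_exists[OF ext_powr_lipschitz[OF p_greater_1], where a = "- (b / 2)"
        and c = "- (k * (k - b) / 2)" and j = "N - 1"] by blast
  have "emden_profile N k p b G"
    by unfold_locales (use G in \<open>auto simp: rhs_def\<close>)
  then show thesis by (rule that)
qed

end

context emden_profile begin

lemma P_eq_powr: "t \<ge> 0 \<Longrightarrow> P t = G t powr p"
  using G_positive[of t] by (simp add: P_def max_def)

text \<open>Bootstrap: positivity makes \<open>G powr p\<close> as smooth as \<open>G\<close>, the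
  average preserves the order, and the equation then gains one derivative.\<close>

lemma Ck_nonneg_G: "Ck_nonneg n G"
proof (induction n)
  case 0
  then show ?case by (simp add: continuous_G)
next
  case (Suc n)
  have "Ck_nonneg n (\<lambda>t. G t powr p)"
    by (rule Ck_nonneg_powr[OF G_positive Suc])
  then have P: "Ck_nonneg n P"
    by (rule Ck_nonneg_cong) (simp add: P_eq_powr)
  have "Ck_nonneg n (\<lambda>t. - (b / 2) * P t + - (k * (k - b) / 2) * wavg (N - 1) P t)"
    by (intro Ck_nonneg_add Ck_nonneg_mult Ck_nonneg_const Ck_nonneg_wavg P)
  then have "Ck_nonneg n (rhs P)" by (simp add: rhs_def[abs_def])
  then show ?case by (rule Ck_nonneg_SucI[rotated]) (rule G_deriv_P)
qed

lemma v_positive: "v s > 0"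
  by (simp add: v_def G_positive)

sublocale orbit: emden_orbit k p b v w
proof
  fix s
  show "(w has_real_derivative k\<^sup>2 * (v s - v s powr p) - b * p * v s powr (p - 1) * w s) (at s)"
    using w_deriv[of s] v_positive[of s] by (simp add: max_absorb2)
qed (use k_positive k_times_p b_positive v_positive v_deriv in auto)

text \<open>Negative energy together with \<open>w\<^sup>2 \<ge> 0\<close> confines \<open>v\<close>
  to the potential well, where \<open>v powr (p - 1) < (p + 1) / 2\<close>.\<close>

lemma v_bounded: "v s \<le> ((p + 1) / 2) powr (1 / (p - 1))"
proof -
  have p1: "p - 1 > 0" using p_greater_1 by simp
  have "k\<^sup>2 * (v s powr (p + 1) / (p + 1) - (v s)\<^sup>2 / 2) < 0"
  proof -
    have "max 0 (v s) = v s" using v_positive[of s] by simp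
    then have "(w s)\<^sup>2 / 2 + k\<^sup>2 * (v s powr (p + 1) / (p + 1) - (v s)\<^sup>2 / 2) < 0"
      using energy_negative[of s] unfolding energy_def by simp
    moreover have "(w s)\<^sup>2 / 2 \<ge> 0" by simp
    ultimately show ?thesis by linarith
  qed
  then have "v s powr (p + 1) / (p + 1) < (v s)\<^sup>2 / 2"
    using k_positive by (simp add: mult_less_0_iff)
  also have "v s powr (p + 1) = v s powr (p - 1) * (v s)\<^sup>2"
    using powr_add[of "v s" "p - 1" 2] v_positive[of s] by (simp add: powr_numeral add.commute)
  finally have "v s powr (p - 1) * (v s)\<^sup>2 < (p + 1) / 2 * (v s)\<^sup>2"
    using p_greater_1 by (simp add: field_simps)
  then have "v s powr (p - 1) < (p + 1) / 2"
    using v_positive[of s] by simp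
  then have "(v s powr (p - 1)) powr (1 / (p - 1)) \<le> ((p + 1) / 2) powr (1 / (p - 1))"
    using p1 by (intro powr_mono2) auto
  then show ?thesis using p1 v_positive[of s] by (simp add: powr_powr)
qed

section \<open>Behaviour of the orbit near the origin, and its decay rate\<close>

lemma eventually_pos_at_right_0:
  assumes "continuous_on {0..} Q" "Q 0 > 0"
  shows "\<forall>\<^sub>F t in at_right 0. (Q t :: real) > 0"
proof -
  have "(Q \<longlongrightarrow> Q 0) (at 0 within {0..})"
    using assms(1) unfolding continuous_on_def by simp
  then have "(Q \<longlongrightarrow> Q 0) (at_right 0)"
    by (simp add: at_within_Ici_at_right)
  then show ?thesis using assms(2) by (rule order_tendstoD)
qed

lemma v_powr_exp:
  shows "v s powr p = exp (k * s) * exp (2 * s) * P (exp (2 * s))"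
proof -
  have "exp (k * s) powr p = exp (k * p * s)" by (simp add: powr_def)
  also have "k * p * s = k * s + 2 * s" unfolding kp_eq by (simp add: algebra_simps)
  finally have "exp (k * s) powr p = exp (k * s) * exp (2 * s)" by (simp only: exp_add)
  then show ?thesis
    by (simp add: v_def powr_mult P_eq_powr)
qed

lemma eventually_at_right_0_exp:
  assumes "\<forall>\<^sub>F t::real in at_right 0. R t"
  shows "\<forall>\<^sub>F s in at_bot. R (exp (2 * s))"
  by (rule eventually_compose_filterlim[OF assms]) real_asymp

lemma v_tendsto_0: "(v \<longlongrightarrow> 0) at_bot"
proof -
  have "filterlim (\<lambda>s::real. exp (2 * s)) (at_right 0) at_bot" by real_asymp
  moreover have "(G \<longlongrightarrow> G 0) (at 0 within {0..})"
    using continuous_G unfolding continuous_on_def by simp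
  then have "(G \<longlongrightarrow> G 0) (at_right 0)"
    by (simp add: at_within_Ici_at_right)
  ultimately have "((\<lambda>s. G (exp (2 * s))) \<longlongrightarrow> G 0) at_bot"
    by (rule filterlim_compose[rotated])
  moreover have "((\<lambda>s. exp (k * s)) \<longlongrightarrow> 0) at_bot"
    using k_positive by real_asymp
  ultimately have "((\<lambda>s. exp (k * s) * G (exp (2 * s))) \<longlongrightarrow> 0 * G 0) at_bot"
    by (intro tendsto_mult)
  then show ?thesis by (simp add: v_def[abs_def])
qed

text \<open>After division by \<open>exp (k * s)\<close>, \<open>w\<close> tends to \<open>k\<close>
  and \<open>l * (v - v powr p)\<close> tends to \<open>l\<close> as \<open>s\<close> tends to
  \<open>- \<infinity>\<close>.\<close>

lemma start_below_barrier:
  assumes l: "l > k"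
  obtains a where "v a < 1" "w a > 0" "w a < l * (v a - v a powr p)"
proof -
  have "\<forall>\<^sub>F t in at_right 0. k * G t + 2 * t * rhs P t > 0"
    by (rule eventually_pos_at_right_0) (use k_positive in \<open>auto simp: G_0 intro!: continuous_intros continuous_G continuous_rhs_P\<close>)
  moreover have "\<forall>\<^sub>F t in at_right 0. l * (G t - t * P t) - (k * G t + 2 * t * rhs P t) > 0"
    by (rule eventually_pos_at_right_0) (use l in \<open>auto simp: G_0 intro!: continuous_intros continuous_G continuous_rhs_P continuous_P\<close>)
  ultimately have "\<forall>\<^sub>F t in at_right 0. k * G t + 2 * t * rhs P t > 0 \<and>
      l * (G t - t * P t) - (k * G t + 2 * t * rhs P t) > 0"
    by (rule eventually_conj)
  from eventually_at_right_0_exp[OF this] order_tendstoD(2)[OF v_tendsto_0 zero_less_one]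
  have "\<forall>\<^sub>F s in at_bot. v s < 1 \<and> w s > 0 \<and> w s < l * (v s - v s powr p)"
  proof eventually_elim
    case (elim s)
    have "l * (v s - v s powr p) - w s = exp (k * s) * (l * (G (exp (2 * s)) - exp (2 * s) * P (exp (2 * s)))
        - (k * G (exp (2 * s)) + 2 * exp (2 * s) * rhs P (exp (2 * s))))"
      unfolding v_powr_exp unfolding v_def w_def by (simp add: algebra_simps)
    also have "\<dots> > 0" using elim by simp
    finally show ?case using elim by (simp add: w_def)
  qed
  then show thesis using that eventually_happens' trivial_limit_at_bot_linorder by blast
qed

text \<open>For \<open>l = k\<close> the leading terms cancel and the sign comes from the next
  order: divided by \<open>exp (k * s) * exp (2 * s)\<close>, the barrier tends to
  \<open>(k - b) * (1 - k / real N)\<close>.\<close>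

lemma start_above_barrier:
  assumes bk: "b < k"
  obtains a where "v a < 1" "orbit.barrier k a > 0"
proof -
  have "rhs P 0 * 2 + k = (k - b) * (1 - k / real N)"
  proof -
    define c where "c = k * (k - b) / real N"
    have c2: "k * (k - b) / (2 * real N) = c / 2" by (simp add: c_def)
    have c3: "(k - b) * (1 - k / real N) = k - b - c" by (simp add: c_def algebra_simps)
    show ?thesis unfolding rhs_at_0 P_def G_0 c2 c3 by (simp add: algebra_simps)
  qed
  moreover have "\<dots> > 0"
    using bk k_positive by (auto intro!: mult_pos_pos simp: N_eq)
  ultimately have "\<forall>\<^sub>F t in at_right 0. 2 * rhs P t + k * P t > 0"
    by (intro eventually_pos_at_right_0) (auto simp: G_0 P_def intro!: continuous_intros continuous_rhs_P continuous_P[unfolded P_def[abs_def]])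
  from eventually_at_right_0_exp[OF this] order_tendstoD(2)[OF v_tendsto_0 zero_less_one]
  have "\<forall>\<^sub>F s in at_bot. v s < 1 \<and> orbit.barrier k s > 0"
  proof eventually_elim
    case (elim s)
    have "orbit.barrier k s = exp (k * s) * exp (2 * s) * (2 * rhs P (exp (2 * s)) + k * P (exp (2 * s)))"
      unfolding orbit.barrier_def v_powr_exp unfolding v_def w_def by (simp add: algebra_simps)
    also have "\<dots> > 0" using elim by simp
    finally show ?case using elim by simp
  qed
  then show thesis using that eventually_happens' trivial_limit_at_bot_linorder by blast
qed

lemma rate_from_below:
  assumes sum: "g1 + g2 = b * p" and prod: "g1 * g2 = k\<^sup>2 * (p - 1)" and g: "0 < g1" "g1 < g2" "g2 > 2"
  obtains A where "A > 0" "((\<lambda>s. (1 - v s) * exp (g1 * s)) \<longlongrightarrow> A) at_top"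
proof -
  \<comment> \<open>There is room for \<open>g\<close> because \<open>g2\<close> exceeds both
    \<open>g1\<close> and \<open>2\<close>; \<open>g > 2\<close> is what makes
    \<open>g * k / 2 > k\<close>.\<close>
  define g where "g = (max g1 2 + g2) / 2"
  have gg: "g1 < g" "g < g2" "g > 2" using g by (auto simp: g_def)
  have "g * k / 2 > k" using mult_strict_right_mono[OF gg(3) k_positive] by simp
  then obtain a where "v a < 1" "w a > 0" "w a < g * k / 2 * (v a - v a powr p)"
    by (rule start_below_barrier)
  then show thesis
    using orbit.converge_from_below[OF sum prod g(1) gg refl] that by blast
qed

text \<open>The condition \<open>g2 < 2\<close> yields both hypotheses of the overshoot argument:
  \<open>(2 - g1) * (2 - g2) = 2 * p * (k - b)\<close> gives \<open>b < k\<close>, and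
  \<open>g1 * g2 = 2 * k\<close> gives \<open>k < 2\<close>.\<close>

lemma rate_from_above:
  assumes sum: "g1 + g2 = b * p" and prod: "g1 * g2 = k\<^sup>2 * (p - 1)" and g: "0 < g1" "g1 < g2" "g2 < 2"
  obtains A where "A > 0" "((\<lambda>s. (v s - 1) * exp (g1 * s)) \<longlongrightarrow> A) at_top"
proof -
  have prod': "g1 * g2 = 2 * k" unfolding prod using k_times_p by (simp add: power2_eq_square)
  have "(2 - g1) * (2 - g2) > 0" using g by simp
  also have "(2 - g1) * (2 - g2) = 4 - 2 * (g1 + g2) + g1 * g2" by (simp add: algebra_simps)
  also have "\<dots> = 2 * (k * p - b * p)" unfolding sum prod' kp_eq by simp
  finally have bk: "b < k" using p_greater_1 by (simp flip: left_diff_distrib add: zero_less_mult_iff)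
  have "g1 * g2 < 2 * 2" using g by (intro mult_strict_mono) auto
  then have k2: "k < 2" unfolding prod' by simp
  obtain a where "v a < 1" "orbit.barrier k a > 0" by (rule start_above_barrier[OF bk])
  then show thesis
    using orbit.converge_from_above[OF sum prod g(1,2) bk k2 _ _ v_bounded] that by blast
qed

text \<open>For \<open>b = k\<close> the nonlocal term drops out and
  \<open>G' = - (k / 2) * G powr p\<close> separates: \<open>G powr (- (2 / k))\<close> has
  derivative \<open>1\<close>.\<close>

lemma explicit_profile:
  assumes bk: "b = k" and t: "t \<ge> 0"
  shows "G t = (1 + t) powr (- (k / 2))"
proof -
  have kk: "2 / k = p - 1" using k_times_p k_positive by (simp add: field_simps)
  have "((\<lambda>t. G t powr (- (2 / k)) - t) has_real_derivative 0) (at u within {0..})" if u: "u \<ge> 0" for u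
  proof -
    have *: "((\<lambda>y. y powr (- (2 / k))) has_real_derivative - (2 / k) * G u powr (- (2 / k) - 1)) (at (G u))"
      using G_positive[OF u] by (auto intro!: derivative_eq_intros)
    have r: "rhs P u = - (k / 2) * G u powr p"
    proof -
      have "rhs P u = - (b / 2) * P u - k * (k - b) / 2 * wavg (N - 1) P u" by (rule rhs_def)
      also have "\<dots> = - (k / 2) * G u powr p" by (simp add: bk P_eq_powr u)
      finally show ?thesis .
    qed
    from DERIV_chain2[OF * G_deriv_P[OF u]]
    have "((\<lambda>t. G t powr (- (2 / k))) has_real_derivative - (2 / k) * G u powr (- (2 / k) - 1) * rhs P u) (at u within {0..})" .
    also note r
    also have "- (2 / k) * G u powr (- (2 / k) - 1) * (- (k / 2) * G u powr p) = G u powr (- (2 / k) - 1 + p)"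
      using k_positive by (simp add: powr_add)
    also have "- (2 / k) - 1 + p = 0" by (simp add: kk)
    finally have "((\<lambda>t. G t powr - (2 / k)) has_real_derivative 1) (at u within {0..})"
      using G_positive[OF u] by simp
    from DERIV_diff[OF this DERIV_ident] show ?thesis by simp
  qed
  then obtain c where c: "\<And>u. u \<in> {0..} \<Longrightarrow> G u powr (- (2 / k)) - u = c"
    using has_field_derivative_zero_constant[of "{0..}" "\<lambda>t. G t powr (- (2 / k)) - t"] by auto
  have "G t powr (- (2 / k)) = 1 + t"
    using c[of 0] c[of t] t by (simp add: G_0)
  then have "(1 + t) powr (- (k / 2)) = (G t powr (- (2 / k))) powr (- (k / 2))" by simp
  also have "\<dots> = G t" using k_positive G_positive[OF t] by (simp add: powr_powr)
  finally show ?thesis ..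
qed

end

section \<open>Radial functions on Euclidean space\<close>

lemma partial_deriv_eq:
  "(u has_derivative D) (at x) \<Longrightarrow> partial_deriv i u x = D (axis i 1)"
  unfolding partial_deriv_def using frechet_derivative_at by metis

lemma radial_has_derivative:
  fixes y :: "real ^ 'n"
  assumes "(\<phi> has_real_derivative d) (at (y \<bullet> y) within {0..})"
  shows "((\<lambda>x. \<phi> (x \<bullet> x)) has_derivative (\<lambda>h. d * (2 * (y \<bullet> h)))) (at y)"
proof -
  have "(\<phi> has_derivative (*) d) (at (y \<bullet> y) within range (\<lambda>x::real ^ 'n. x \<bullet> x))"
    by (rule has_derivative_subset[OF assms[unfolded has_field_derivative_def]]) auto
  moreover have "((\<lambda>x. x \<bullet> x) has_derivative (\<lambda>h. 2 * (y \<bullet> h))) (at y)"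
    by (auto intro!: derivative_eq_intros simp: inner_commute)
  ultimately show ?thesis by (rule has_derivative_in_compose[rotated])
qed

lemma partial_deriv_radial:
  fixes y :: "real ^ 'n"
  assumes "(\<phi> has_real_derivative d) (at (y \<bullet> y) within {0..})"
  shows "partial_deriv i (\<lambda>x. \<phi> (x \<bullet> x)) y = 2 * y $ i * d"
  using partial_deriv_eq[OF radial_has_derivative[OF assms]] by (simp add: inner_axis)

text \<open>The first derivative is required only near \<open>y\<close>, which admits profiles built
  from \<open>sqrt (x \<bullet> x)\<close> at points away from the origin.\<close>

lemma laplacian_radial:
  fixes y :: "real ^ 'n"
  assumes U: "open U" "y \<in> U"
    and d1: "\<And>x. x \<in> U \<Longrightarrow> (\<phi> has_real_derivative \<phi>' (x \<bullet> x)) (at (x \<bullet> x) within {0..})"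
    and d2: "(\<phi>' has_real_derivative d) (at (y \<bullet> y) within {0..})"
  shows "laplacian (\<lambda>x. \<phi> (x \<bullet> x)) y = 2 * real CARD('n) * \<phi>' (y \<bullet> y) + 4 * (y \<bullet> y) * d"
proof -
  have "partial_deriv i (partial_deriv i (\<lambda>x. \<phi> (x \<bullet> x))) y = 2 * \<phi>' (y \<bullet> y) + 4 * (y $ i * y $ i) * d" for i
  proof -
    have "((\<lambda>x. x $ i) has_derivative (\<lambda>h. h $ i)) (at y)"
      by (rule bounded_linear_imp_has_derivative[OF bounded_linear_vec_nth])
    from has_derivative_mult[OF has_derivative_mult_right[OF this, of 2] radial_has_derivative[OF d2]]
    have "((\<lambda>x. 2 * x $ i * \<phi>' (x \<bullet> x)) has_derivative
        (\<lambda>h. 2 * y $ i * (d * (2 * (y \<bullet> h))) + 2 * h $ i * \<phi>' (y \<bullet> y))) (at y)" .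
    then have "(partial_deriv i (\<lambda>x. \<phi> (x \<bullet> x)) has_derivative
        (\<lambda>h. 2 * y $ i * (d * (2 * (y \<bullet> h))) + 2 * h $ i * \<phi>' (y \<bullet> y))) (at y)"
      by (rule has_derivative_transform_within_open[OF _ U]) (simp add: partial_deriv_radial[OF d1])
    from partial_deriv_eq[OF this] show ?thesis by (simp add: inner_axis)
  qed
  then have "laplacian (\<lambda>x. \<phi> (x \<bullet> x)) y = (\<Sum>i\<in>UNIV. 2 * \<phi>' (y \<bullet> y) + 4 * (y $ i * y $ i) * d)"
    by (simp add: laplacian_def)
  also have "\<dots> = 2 * real CARD('n) * \<phi>' (y \<bullet> y) + 4 * (\<Sum>i\<in>UNIV. y $ i * y $ i) * d"
    by (simp add: sum.distrib sum_distrib_left sum_distrib_right mult.assoc)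
  also have "(\<Sum>i\<in>UNIV. y $ i * y $ i) = y \<bullet> y" by (simp add: inner_vec_def)
  finally show ?thesis .
qed

lemma inner_gradient_radial:
  fixes y :: "real ^ 'n"
  assumes "(\<phi> has_real_derivative d) (at (y \<bullet> y) within {0..})"
  shows "y \<bullet> gradient (\<lambda>x. \<phi> (x \<bullet> x)) y = 2 * (y \<bullet> y) * d"
proof -
  have "gradient (\<lambda>x. \<phi> (x \<bullet> x)) y = (2 * d) *\<^sub>R y"
    by (simp add: gradient_def partial_deriv_radial[OF assms] vec_eq_iff)
  then show ?thesis by simp
qed

section \<open>Closure properties of the classes \<open>C_k\<close>\<close>

lemma C_k_SucD: "C_k (Suc k) u \<Longrightarrow> C_k k u"
proof (induction k arbitrary: u)
  case 0
  then show ?case by (auto intro: differentiable_imp_continuous_on)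
qed fastforce

lemma has_frechet_derivative_on:
  "u differentiable_on UNIV \<Longrightarrow> (u has_derivative frechet_derivative u (at x)) (at x)"
  by (simp add: differentiable_on_def frechet_derivative_works)

lemma C_k_const: "C_k k (\<lambda>_. c)"
proof (induction k arbitrary: c)
  case (Suc k)
  have "partial_deriv i (\<lambda>_::real^'a. c) = (\<lambda>_. 0)" for i
    by (rule ext) (simp add: partial_deriv_eq[OF has_derivative_const])
  then show ?case using Suc by simp
qed simp

lemma C_k_coord: "C_k k (\<lambda>x::real ^ 'n. x $ j)"
proof (cases k)
  case 0
  then show ?thesis by (simp add: continuous_on_component)
next
  case (Suc l)
  have d: "((\<lambda>x::real ^ 'n. x $ j) has_derivative (\<lambda>h. h $ j)) (at x)" for x
    by (rule bounded_linear_imp_has_derivative[OF bounded_linear_vec_nth])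
  have "partial_deriv i (\<lambda>x::real ^ 'n. x $ j) = (\<lambda>_. axis i 1 $ j)" for i
    by (rule ext) (rule partial_deriv_eq[OF d])
  then show ?thesis using Suc d by (auto simp: differentiable_on_def C_k_const intro: differentiableI)
qed

lemma C_k_add: "C_k k u \<Longrightarrow> C_k k v \<Longrightarrow> C_k k (\<lambda>x. u x + v x)"
proof (induction k arbitrary: u v)
  case 0
  then show ?case by (simp add: continuous_on_add)
next
  case (Suc k)
  then have d: "u differentiable_on UNIV" "v differentiable_on UNIV" by auto
  have "partial_deriv i (\<lambda>x. u x + v x) = (\<lambda>x. partial_deriv i u x + partial_deriv i v x)" for i
    by (rule ext)
       (use partial_deriv_eq[OF has_derivative_add[OF d[THEN has_frechet_derivative_on]]] in \<open>simp add: partial_deriv_def\<close>)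
  then show ?case using Suc d by simp
qed

lemma C_k_mult: "C_k k u \<Longrightarrow> C_k k v \<Longrightarrow> C_k k (\<lambda>x. u x * v x)"
proof (induction k arbitrary: u v)
  case 0
  then show ?case by (simp add: continuous_on_mult)
next
  case (Suc k)
  then have d: "u differentiable_on UNIV" "v differentiable_on UNIV" by auto
  have "partial_deriv i (\<lambda>x. u x * v x) = (\<lambda>x. u x * partial_deriv i v x + partial_deriv i u x * v x)" for i
    by (rule ext)
       (use partial_deriv_eq[OF has_derivative_mult[OF d[THEN has_frechet_derivative_on]]] in \<open>simp add: partial_deriv_def\<close>)
  moreover have "C_k k (\<lambda>x. u x * partial_deriv i v x + partial_deriv i u x * v x)" for i
    using Suc.prems by (auto intro!: C_k_add Suc.IH intro: C_k_SucD[OF Suc.prems(1)] C_k_SucD[OF Suc.prems(2)])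
  ultimately show ?case using d by simp
qed

lemma C_k_radial: "Ck_nonneg k \<phi> \<Longrightarrow> C_k k (\<lambda>x::real ^ 'n. \<phi> (x \<bullet> x))"
proof (induction k arbitrary: \<phi>)
  case 0
  then have "continuous_on {0..} \<phi>" by simp
  then have "continuous_on UNIV (\<lambda>x::real ^ 'n. \<phi> (x \<bullet> x))"
    by (rule continuous_on_compose2) (auto intro!: continuous_intros)
  then show ?case by simp
next
  case (Suc k)
  then obtain \<phi>' where d: "\<And>t. t \<ge> 0 \<Longrightarrow> (\<phi> has_real_derivative \<phi>' t) (at t within {0..})" "Ck_nonneg k \<phi>'"
    by auto
  have "partial_deriv i (\<lambda>x::real ^ 'n. \<phi> (x \<bullet> x)) = (\<lambda>x. 2 * x $ i * \<phi>' (x \<bullet> x))" for i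
    by (rule ext) (rule partial_deriv_radial[OF d(1)], simp)
  moreover have "C_k k (\<lambda>x::real ^ 'n. 2 * x $ i * \<phi>' (x \<bullet> x))" for i
    by (intro C_k_mult C_k_const C_k_coord Suc.IH d)
  moreover have "(\<lambda>x::real ^ 'n. \<phi> (x \<bullet> x)) differentiable_on UNIV"
    unfolding differentiable_on_def using radial_has_derivative[OF d(1)] by (auto intro: differentiableI)
  ultimately show ?case by simp
qed

lemma smooth_radial:
  assumes "\<And>k. Ck_nonneg k \<phi>"
  shows "smooth (\<lambda>x::real ^ 'n. \<phi> (x \<bullet> x))"
  unfolding smooth_def using C_k_radial[OF assms] by blast

text \<open>Restriction to a coordinate axis turns the partial derivatives of an arbitrary solution
  into ordinary ones, from which its radial profile is built.\<close>

lemma line_deriv: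
  fixes u :: "real ^ 'n \<Rightarrow> real"
  assumes "u differentiable_on UNIV"
  shows "((\<lambda>r. u (r *\<^sub>R axis i 1)) has_real_derivative partial_deriv i u (r *\<^sub>R axis i 1)) (at r)"
proof -
  have D: "(u has_derivative frechet_derivative u (at (r *\<^sub>R axis i 1))) (at (r *\<^sub>R axis i 1))"
    by (rule has_frechet_derivative_on[OF assms])
  have "((\<lambda>r. r *\<^sub>R (axis i 1 :: real ^ 'n)) has_derivative (\<lambda>h. h *\<^sub>R axis i 1)) (at r)"
    by (auto intro!: derivative_eq_intros)
  from has_derivative_compose[OF this D]
  have "((\<lambda>r. u (r *\<^sub>R axis i 1)) has_derivative (\<lambda>h. frechet_derivative u (at (r *\<^sub>R axis i 1)) (h *\<^sub>R axis i 1))) (at r)" .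
  moreover have "frechet_derivative u (at (r *\<^sub>R axis i 1)) (h *\<^sub>R axis i 1) = partial_deriv i u (r *\<^sub>R axis i 1) * h" for h
    unfolding partial_deriv_def using linear_scale[OF has_derivative_linear[OF D]] by simp
  ultimately show ?thesis by (simp add: has_field_derivative_def)
qed

text \<open>An instance of the formulas in \<open>x \<bullet> x\<close> with
  \<open>\<phi> t = \<gamma> (sqrt t)\<close>; the derivative of \<open>inverse (sqrt t)\<close>
  lowers the dimension factor by one.\<close>

lemma radial_second_order:
  fixes y :: "real ^ 'n"
  assumes d1: "\<And>r. r > 0 \<Longrightarrow> (\<gamma> has_real_derivative \<gamma>' r) (at r)"
    and d2: "(\<gamma>' has_real_derivative d) (at (norm y))" and y: "y \<noteq> 0"
  shows "laplacian (\<lambda>x. \<gamma> (norm x)) y = d + (real CARD('n) - 1) / norm y * \<gamma>' (norm y)"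
    and "y \<bullet> gradient (\<lambda>x. \<gamma> (norm x)) y = norm y * \<gamma>' (norm y)"
proof -
  define r where "r = norm y"
  have r: "r > 0" "y \<bullet> y = r\<^sup>2" "sqrt (r\<^sup>2) = r" using y by (auto simp: r_def dot_square_norm)
  define \<phi> where "\<phi> t = \<gamma> (sqrt t)" for t
  define \<phi>' where "\<phi>' t = \<gamma>' (sqrt t) * (inverse (sqrt t) / 2)" for t
  have eq: "(\<lambda>x::real ^ 'n. \<gamma> (norm x)) = (\<lambda>x. \<phi> (x \<bullet> x))"
    by (simp add: \<phi>_def norm_eq_sqrt_inner)
  have D1: "(\<phi> has_real_derivative \<phi>' t) (at t within {0..})" if "t > 0" for t
    unfolding \<phi>_def \<phi>'_def
    by (rule has_field_derivative_at_within[OF DERIV_chain2[OF d1 DERIV_real_sqrt]]) (use that in auto)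
  have "((\<lambda>t. \<gamma>' (sqrt t)) has_real_derivative d * (inverse (sqrt (r\<^sup>2)) / 2)) (at (r\<^sup>2))"
    by (rule DERIV_chain2[OF _ DERIV_real_sqrt]) (use d2 r in \<open>auto simp: r_def\<close>)
  moreover have "((\<lambda>t. inverse (sqrt t) / 2) has_real_derivative
      - (inverse (sqrt (r\<^sup>2)) * (inverse (sqrt (r\<^sup>2)) / 2) * inverse (sqrt (r\<^sup>2))) / 2) (at (r\<^sup>2))"
    by (intro DERIV_cdivide DERIV_inverse' DERIV_real_sqrt) (use r in auto)
  ultimately have "(\<phi>' has_real_derivative d * (inverse (sqrt (r\<^sup>2)) / 2) * (inverse (sqrt (r\<^sup>2)) / 2) +
      - (inverse (sqrt (r\<^sup>2)) * (inverse (sqrt (r\<^sup>2)) / 2) * inverse (sqrt (r\<^sup>2))) / 2 * \<gamma>' (sqrt (r\<^sup>2))) (at (r\<^sup>2))"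
    unfolding \<phi>'_def by (rule DERIV_mult)
  moreover have "d * (inverse r / 2) * (inverse r / 2) + - (inverse r * (inverse r / 2) * inverse r) / 2 * \<gamma>' r =
      d / (4 * r\<^sup>2) - \<gamma>' r / (4 * r ^ 3)"
    using r(1) by (simp add: divide_simps power2_eq_square power3_eq_cube)
  ultimately have D2: "(\<phi>' has_real_derivative d / (4 * r\<^sup>2) - \<gamma>' r / (4 * r ^ 3)) (at (y \<bullet> y) within {0..})"
    unfolding r(2,3) by (metis has_field_derivative_at_within)
  have "laplacian (\<lambda>x::real ^ 'n. \<phi> (x \<bullet> x)) y =
      2 * real CARD('n) * \<phi>' (y \<bullet> y) + 4 * (y \<bullet> y) * (d / (4 * r\<^sup>2) - \<gamma>' r / (4 * r ^ 3))"
    by (rule laplacian_radial[of "- {0}", OF _ _ D1 D2]) (use y in auto)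
  also have "\<dots> = d + (real CARD('n) - 1) / r * \<gamma>' r"
  proof -
    have "4 * r\<^sup>2 * (d / (4 * r\<^sup>2) - \<gamma>' r / (4 * r ^ 3)) = d - \<gamma>' r / r"
      using r(1) by (simp add: right_diff_distrib power2_eq_square power3_eq_cube)
    then show ?thesis
      unfolding r(2) \<phi>'_def r(3) using r(1) by (simp add: field_simps)
  qed
  finally show "laplacian (\<lambda>x. \<gamma> (norm x)) y = d + (real CARD('n) - 1) / norm y * \<gamma>' (norm y)"
    unfolding eq r_def .
  have "y \<bullet> gradient (\<lambda>x. \<phi> (x \<bullet> x)) y = 2 * (y \<bullet> y) * \<phi>' (y \<bullet> y)"
    by (rule inner_gradient_radial[OF D1]) (use y in simp)
  also have "\<dots> = r * \<gamma>' r"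
    unfolding r(2) \<phi>'_def r(3) using r(1) by (simp add: field_simps power2_eq_square)
  finally show "y \<bullet> gradient (\<lambda>x. \<gamma> (norm x)) y = norm y * \<gamma>' (norm y)"
    unfolding eq r_def .
qed

section \<open>Uniqueness of regular radial solutions\<close>

lemma abs_le_of_deriv_le:
  fixes F F' :: "real \<Rightarrow> real"
  assumes cont: "continuous_on {0..R} F" and F0: "F 0 = 0"
    and der: "\<And>r. 0 < r \<Longrightarrow> r < R \<Longrightarrow> (F has_real_derivative F' r) (at r)"
    and le: "\<And>r. 0 < r \<Longrightarrow> r < R \<Longrightarrow> \<bar>F' r\<bar> \<le> C * r ^ n"
    and r: "0 \<le> r" "r \<le> R"
  shows "\<bar>F r\<bar> \<le> C * r ^ Suc n / real (Suc n)"
proof -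
  have "C * r ^ Suc n / real (Suc n) - \<sigma> * F r \<ge> 0" if \<sigma>: "\<sigma> = 1 \<or> \<sigma> = - 1" for \<sigma>
  proof -
    have "C * 0 ^ Suc n / real (Suc n) - \<sigma> * F 0 \<le> C * r ^ Suc n / real (Suc n) - \<sigma> * F r"
    proof (rule DERIV_nonneg_imp_increasing_open[OF r(1)])
      fix u assume u: "0 < u" "u < r"
      then have "((\<lambda>r. C * r ^ Suc n / real (Suc n) - \<sigma> * F r) has_real_derivative C * u ^ n - \<sigma> * F' u) (at u)"
        using r by (auto intro!: derivative_eq_intros der simp del: power_Suc of_nat_Suc)
      moreover have "C * u ^ n - \<sigma> * F' u \<ge> 0" using le[of u] u r \<sigma> by auto
      ultimately show "\<exists>y. ((\<lambda>r. C * r ^ Suc n / real (Suc n) - \<sigma> * F r) has_real_derivative y) (at u) \<and> y \<ge> 0"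
        by blast
    next
      have "continuous_on {0..r} F" using cont by (rule continuous_on_subset) (use r in auto)
      then show "continuous_on {0..r} (\<lambda>r. C * r ^ Suc n / real (Suc n) - \<sigma> * F r)"
        by (intro continuous_intros) auto
    qed
    then show ?thesis using F0 by simp
  qed
  from this[of 1] this[of "- 1"] show ?thesis by auto
qed

lemma powr_lipschitz_bounded:
  fixes p :: real
  assumes p: "p > 1" and x: "0 < x" "x \<le> X" and y: "0 < y" "y \<le> X"
  shows "\<bar>x powr p - y powr p\<bar> \<le> p * X powr (p - 1) * \<bar>x - y\<bar>"
proof -
  have "norm (x powr p - y powr p) \<le> p * X powr (p - 1) * norm (x - y)"
  proof (rule field_differentiable_bound[of "{0<..X}"])
    fix z assume z: "z \<in> {0<..X}"
    show "((\<lambda>z. z powr p) has_real_derivative p * z powr (p - 1)) (at z within {0<..X})"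
      by (rule has_field_derivative_at_within) (use z in \<open>auto intro!: derivative_eq_intros\<close>)
    show "norm (p * z powr (p - 1)) \<le> p * X powr (p - 1)"
      using z p by (auto simp: abs_mult intro!: mult_left_mono powr_mono2)
  qed (use x y in auto)
  then show ?thesis by simp
qed

context emden_params begin

text \<open>The equation for \<open>f powr m\<close> along a ray, normalised by scaling. At the
  singular origin only continuity of \<open>h\<close> and of its derivative \<open>h1\<close> is
  recorded.\<close>

definition radial_solution :: "(real \<Rightarrow> real) \<Rightarrow> bool" where
  "radial_solution h \<longleftrightarrow> h 0 = 1 \<and> (\<forall>r\<ge>0. h r > 0) \<and> continuous_on {0..} h \<and>
    (\<exists>h1 h2. continuous_on {0..} h1 \<and>
      (\<forall>r>0. (h has_real_derivative h1 r) (at r) \<and> (h1 has_real_derivative h2 r) (at r) \<and>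
        h2 r + (real N - 1) / r * h1 r + b * r * (p * h r powr (p - 1) * h1 r)
          + ((k + 2) * b + k\<^sup>2) * h r powr p = 0))"

lemma radial_solutionI:
  assumes "h 0 = 1" "\<And>r. r \<ge> 0 \<Longrightarrow> h r > 0" "continuous_on {0..} h" "continuous_on {0..} h1"
    "\<And>r. r > 0 \<Longrightarrow> (h has_real_derivative h1 r) (at r)"
    "\<And>r. r > 0 \<Longrightarrow> (h1 has_real_derivative h2 r) (at r)"
    "\<And>r. r > 0 \<Longrightarrow> h2 r + (real N - 1) / r * h1 r + b * r * (p * h r powr (p - 1) * h1 r)
          + ((k + 2) * b + k\<^sup>2) * h r powr p = 0"
  shows "radial_solution h"
  unfolding radial_solution_def using assms by blast

text \<open>Multiplication by \<open>r ^ (N - 1)\<close> gives divergence form; the leftover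
  coefficient is \<open>b * real N - ((k + 2) * b + k\<^sup>2) = - (k * (k - b))\<close>.\<close>

lemma radial_solution_flux:
  assumes "radial_solution h"
  obtains h1 where "continuous_on {0..} h1" "\<And>r. r > 0 \<Longrightarrow> (h has_real_derivative h1 r) (at r)"
    "\<And>r. r > 0 \<Longrightarrow> ((\<lambda>r. r ^ (N - 1) * h1 r + b * r ^ N * h r powr p) has_real_derivative
      - (k * (k - b)) * r ^ (N - 1) * h r powr p) (at r)"
proof -
  obtain h1 h2 where h: "continuous_on {0..} h1" "\<And>r. r > 0 \<Longrightarrow> (h has_real_derivative h1 r) (at r)"
    "\<And>r. r > 0 \<Longrightarrow> (h1 has_real_derivative h2 r) (at r)"
    "\<And>r. r > 0 \<Longrightarrow> h2 r + (real N - 1) / r * h1 r + b * r * (p * h r powr (p - 1) * h1 r)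
          + ((k + 2) * b + k\<^sup>2) * h r powr p = 0" and pos: "\<And>r. r \<ge> 0 \<Longrightarrow> h r > 0"
    using assms unfolding radial_solution_def by auto
  \<comment> \<open>Writing \<open>N\<close> as a double successor avoids truncated subtraction in
    the exponents.\<close>
  obtain M where M: "N = Suc (Suc M)"
    using N_ge_3 by (metis One_nat_def Suc_1 add_2_eq_Suc le_Suc_ex numeral_3_eq_3 Suc_leD)
  have "((\<lambda>r. r ^ (N - 1) * h1 r + b * r ^ N * h r powr p) has_real_derivative
      - (k * (k - b)) * r ^ (N - 1) * h r powr p) (at r)" if r: "r > 0" for r
  proof -
    have pw: "((\<lambda>r. h r powr p) has_real_derivative p * h r powr (p - 1) * h1 r) (at r)"
      using DERIV_fun_powr[OF h(2)[OF r], of p] pos[of r] r by simp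
    have "((\<lambda>r. r ^ Suc M * h1 r + b * r ^ Suc (Suc M) * h r powr p) has_real_derivative
      real (Suc M) * r ^ M * h1 r + h2 r * r ^ Suc M
      + (b * (real (Suc (Suc M)) * r ^ Suc M) * h r powr p + p * h r powr (p - 1) * h1 r * (b * r ^ Suc (Suc M)))) (at r)"
      by (intro DERIV_add DERIV_mult h(3) r pw DERIV_cmult) (auto intro!: derivative_eq_intros simp del: power_Suc of_nat_Suc)
    also have "real (Suc M) * r ^ M * h1 r + h2 r * r ^ Suc M
      + (b * (real (Suc (Suc M)) * r ^ Suc M) * h r powr p + p * h r powr (p - 1) * h1 r * (b * r ^ Suc (Suc M))) =
      r ^ Suc M * ((h2 r + (real N - 1) / r * h1 r + b * r * (p * h r powr (p - 1) * h1 r)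
          + ((k + 2) * b + k\<^sup>2) * h r powr p) + (b * real N - ((k + 2) * b + k\<^sup>2)) * h r powr p)"
      using r unfolding M by (simp add: field_simps)
    also have "\<dots> = - (k * (k - b)) * r ^ Suc M * h r powr p"
      unfolding h(4)[OF r] unfolding N_eq by (simp add: algebra_simps power2_eq_square)
    finally show ?thesis by (simp only: M diff_Suc_1)
  qed
  then show thesis using that h by blast
qed

text \<open>An iterated Gronwall estimate. The difference \<open>Y\<close> of the fluxes vanishes at
  \<open>0\<close>, and its integration gains more powers of \<open>r\<close> than division by
  \<open>r ^ (N - 1)\<close> loses. Each pass multiplies the bound by \<open>K * r\<close> over the
  next integer, so the factorial forces the difference to vanish.\<close>

lemma radial_solution_unique:
  assumes h: "radial_solution h" and g: "radial_solution g" and R: "R \<ge> 0"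
  shows "h R = g R"
proof -
  obtain h1 where h1: "continuous_on {0..} h1" "\<And>r. r > 0 \<Longrightarrow> (h has_real_derivative h1 r) (at r)"
    "\<And>r. r > 0 \<Longrightarrow> ((\<lambda>r. r ^ (N - 1) * h1 r + b * r ^ N * h r powr p) has_real_derivative
      - (k * (k - b)) * r ^ (N - 1) * h r powr p) (at r)"
    by (rule radial_solution_flux[OF h]) blast
  obtain g1 where g1: "continuous_on {0..} g1" "\<And>r. r > 0 \<Longrightarrow> (g has_real_derivative g1 r) (at r)"
    "\<And>r. r > 0 \<Longrightarrow> ((\<lambda>r. r ^ (N - 1) * g1 r + b * r ^ N * g r powr p) has_real_derivative
      - (k * (k - b)) * r ^ (N - 1) * g r powr p) (at r)"
    by (rule radial_solution_flux[OF g]) blast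
  have hg: "h 0 = 1" "g 0 = 1" "\<And>r. r \<ge> 0 \<Longrightarrow> h r > 0" "\<And>r. r \<ge> 0 \<Longrightarrow> g r > 0"
    and ch: "continuous_on {0..} h" and cg: "continuous_on {0..} g"
    using h g by (auto simp: radial_solution_def)
  have restrict: "continuous_on {0..R} F" if "continuous_on {0..} F" for F :: "real \<Rightarrow> real"
    using that by (rule continuous_on_subset) auto
  obtain x1 where "\<forall>r\<in>{0..R}. h r \<le> h x1"
    using continuous_attains_sup[OF compact_Icc _ restrict[OF ch]] R by auto
  then obtain X1 where X1: "\<And>r. r \<in> {0..R} \<Longrightarrow> h r \<le> X1"
    by blast
  obtain x2 where "\<forall>r\<in>{0..R}. g r \<le> g x2"
    using continuous_attains_sup[OF compact_Icc _ restrict[OF cg]] R by auto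
  then obtain X2 where X2: "\<And>r. r \<in> {0..R} \<Longrightarrow> g r \<le> X2"
    by blast
  define X where "X = max X1 X2"
  define L where "L = p * X powr (p - 1)"
  have L0: "L \<ge> 0" using p_greater_1 by (simp add: L_def)
  have lip: "\<bar>h r powr p - g r powr p\<bar> \<le> L * \<bar>h r - g r\<bar>" if "r \<in> {0..R}" for r
    unfolding L_def by (rule powr_lipschitz_bounded[OF p_greater_1])
      (use that hg X1[OF that] X2[OF that] in \<open>auto simp: X_def\<close>)
  define c where "c = \<bar>k * (k - b)\<bar>"
  \<comment> \<open>\<open>c\<close> comes from integrating the flux equation, \<open>b\<close> from
    the term \<open>b * r ^ N * h r powr p\<close> inside the flux; the one spare factor
    \<open>r\<close> is bounded by \<open>R\<close>.\<close>
  define K where "K = (c + b) * L * R"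
  have c0: "c \<ge> 0" by (simp add: c_def)
  have K0: "K \<ge> 0" using c0 b_positive L0 R by (simp add: K_def)
  define A0 where "A0 = X1 + X2"
  define Y where "Y r = (r ^ (N - 1) * h1 r + b * r ^ N * h r powr p) - (r ^ (N - 1) * g1 r + b * r ^ N * g r powr p)" for r
  have cY: "continuous_on {0..R} Y"
    unfolding Y_def
    by (intro continuous_intros restrict[OF h1(1)] restrict[OF g1(1)] restrict[OF ch] restrict[OF cg])
       (use hg(3,4)[THEN less_imp_neq] in \<open>fastforce+\<close>)
  have Y0: "Y 0 = 0" using N_ge_3 by (simp add: Y_def power_0_left)
  have dY: "(Y has_real_derivative - (k * (k - b)) * r ^ (N - 1) * (h r powr p - g r powr p)) (at r)" if "r > 0" for r
    unfolding Y_def using DERIV_diff[OF h1(3)[OF that] g1(3)[OF that]] by (simp add: algebra_simps)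
  have main: "\<bar>h r - g r\<bar> \<le> A0 * K ^ n / fact n * r ^ n" if "r \<in> {0..R}" for r n
    using that
  proof (induction n arbitrary: r)
    case 0
    have "\<bar>h r - g r\<bar> \<le> h r + g r" using hg(3)[of r] hg(4)[of r] 0 by auto
    then show ?case using X1[OF 0] X2[OF 0] by (simp add: A0_def)
  next
    case (Suc n)
    define A where "A = A0 * K ^ n / fact n"
    have IH: "\<bar>h r - g r\<bar> \<le> A * r ^ n" if "r \<in> {0..R}" for r using Suc.IH[OF that] by (simp add: A_def)
    have dl: "\<bar>h r powr p - g r powr p\<bar> \<le> L * (A * r ^ n)" if "r \<in> {0..R}" for r
      using lip[OF that] mult_left_mono[OF IH[OF that] L0] by linarith
    have Yb: "\<bar>Y r\<bar> \<le> c * L * A * r ^ (N + n)" if r: "r \<in> {0..R}" for r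
    proof -
      have "\<bar>Y r\<bar> \<le> c * L * A * r ^ Suc (N - 1 + n) / real (Suc (N - 1 + n))"
      proof (rule abs_le_of_deriv_le[OF cY Y0 dY])
        fix u assume u: "0 < u" "u < R"
        have "\<bar>- (k * (k - b)) * u ^ (N - 1) * (h u powr p - g u powr p)\<bar> = c * u ^ (N - 1) * \<bar>h u powr p - g u powr p\<bar>"
          using u by (simp add: c_def abs_mult)
        also have "\<dots> \<le> c * u ^ (N - 1) * (L * (A * u ^ n))"
          using dl[of u] u c0 by (intro mult_left_mono) auto
        finally show "\<bar>- (k * (k - b)) * u ^ (N - 1) * (h u powr p - g u powr p)\<bar> \<le> c * L * A * u ^ (N - 1 + n)"
          by (simp add: power_add mult_ac)
      qed (use r in auto)
      moreover have "Suc (N - 1 + n) = N + n" using N_ge_3 by simp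
      moreover have nn: "0 \<le> c * L * A * r ^ (N + n)"
      proof -
        have "0 \<le> A * r ^ n" using IH[OF r] by linarith
        moreover have "0 \<le> c * L * r ^ N" using c0 L0 r by simp
        ultimately have "0 \<le> (c * L * r ^ N) * (A * r ^ n)" by (rule mult_nonneg_nonneg[rotated])
        then show ?thesis by (simp add: power_add mult_ac)
      qed
      moreover have "c * L * A * r ^ (N + n) / real (N + n) \<le> c * L * A * r ^ (N + n)"
        using divide_left_mono[of 1 "real (N + n)", OF _ nn] N_ge_3 by simp
      ultimately show ?thesis by (metis order_trans)
    qed
    have "\<bar>h r - g r\<bar> \<le> (K * A) * r ^ Suc n / real (Suc n)"
    proof (rule abs_le_of_deriv_le[where F = "\<lambda>r. h r - g r" and F' = "\<lambda>r. h1 r - g1 r" and R = R])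
      fix u assume u: "0 < u" "u < R"
      show "((\<lambda>r. h r - g r) has_real_derivative h1 u - g1 u) (at u)"
        by (rule DERIV_diff[OF h1(2)[OF u(1)] g1(2)[OF u(1)]])
      have uN: "u ^ N = u ^ (N - 1) * u" using N_ge_3 by (metis Suc_N power_Suc2)
      have "u ^ (N - 1) * (h1 u - g1 u) = Y u - b * u ^ N * (h u powr p - g u powr p)"
        by (simp add: Y_def algebra_simps)
      also have "\<bar>\<dots>\<bar> \<le> \<bar>Y u\<bar> + \<bar>b * u ^ N * (h u powr p - g u powr p)\<bar>" by (rule abs_triangle_ineq4)
      also have "\<dots> \<le> c * L * A * u ^ (N + n) + b * u ^ N * (L * (A * u ^ n))"
      proof (rule add_mono)
        show "\<bar>Y u\<bar> \<le> c * L * A * u ^ (N + n)" by (rule Yb) (use u in auto)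
        show "\<bar>b * u ^ N * (h u powr p - g u powr p)\<bar> \<le> b * u ^ N * (L * (A * u ^ n))"
          using dl[of u] u b_positive by (auto simp: abs_mult intro!: mult_left_mono)
      qed
      also have "\<dots> = u ^ (N - 1) * ((c + b) * L * u * (A * u ^ n))"
        unfolding power_add uN by (simp add: algebra_simps)
      finally have "u ^ (N - 1) * \<bar>h1 u - g1 u\<bar> \<le> u ^ (N - 1) * ((c + b) * L * u * (A * u ^ n))"
        using u by (simp add: abs_mult)
      then have "\<bar>h1 u - g1 u\<bar> \<le> (c + b) * L * u * (A * u ^ n)"
        using u by simp
      also have "\<dots> \<le> (c + b) * L * R * (A * u ^ n)"
      proof (rule mult_right_mono[OF mult_left_mono])
        show "0 \<le> A * u ^ n" using IH[of u] u by auto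
      qed (use u c0 b_positive L0 in auto)
      finally show "\<bar>h1 u - g1 u\<bar> \<le> K * A * u ^ n" by (simp add: K_def mult_ac)
    next
      show "continuous_on {0..R} (\<lambda>r. h r - g r)"
        by (intro continuous_intros restrict[OF ch] restrict[OF cg])
    qed (use hg Suc.prems in auto)
    then show ?case by (simp add: A_def field_simps)
  qed
  have "(\<lambda>n. A0 * (inverse (fact n) * (K * R) ^ n)) \<longlonglongrightarrow> A0 * 0"
    by (intro tendsto_mult tendsto_const summable_LIMSEQ_zero summable_exp)
  then have "(\<lambda>n. A0 * (inverse (fact n) * (K * R) ^ n)) \<longlonglongrightarrow> 0" by simp
  moreover have "\<bar>h R - g R\<bar> \<le> A0 * (inverse (fact n) * (K * R) ^ n)" for n
    using main[of R n] R by (simp add: power_mult_distrib field_simps)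
  ultimately have "\<bar>h R - g R\<bar> \<le> 0"
    by (intro LIMSEQ_le_const) auto
  then show ?thesis by simp
qed

end

context emden_profile begin

lemma radial_solution_profile: "radial_solution (\<lambda>r. G (r\<^sup>2))"
proof (rule radial_solutionI[where ?h1.0 = "\<lambda>r. 2 * r * rhs P (r\<^sup>2)"
      and ?h2.0 = "\<lambda>r. 2 * rhs P (r\<^sup>2) + 4 * r\<^sup>2 * G2 (r\<^sup>2)"])
  show "G (0\<^sup>2) = 1" by (simp add: G_0)
  show "G (r\<^sup>2) > 0" for r by (simp add: G_positive)
  show "continuous_on {0..} (\<lambda>r. G (r\<^sup>2))"
    by (rule continuous_on_compose2[OF continuous_G]) (auto intro!: continuous_intros)
  have "continuous_on {0..} (\<lambda>r. rhs P (r\<^sup>2))"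
    by (rule continuous_on_compose2[OF continuous_rhs_P]) (auto intro!: continuous_intros)
  then show "continuous_on {0..} (\<lambda>r. 2 * r * rhs P (r\<^sup>2))"
    by (intro continuous_intros)
  fix r :: real assume r: "r > 0"
  have sq: "((\<lambda>r. r\<^sup>2) has_real_derivative 2 * r) (at r)" by (auto intro!: derivative_eq_intros)
  have g: "(G has_real_derivative rhs P (r\<^sup>2)) (at (r\<^sup>2))"
    using G_deriv_P[of "r\<^sup>2"] r by (simp add: within_eq_at)
  have g2: "(rhs P has_real_derivative G2 (r\<^sup>2)) (at (r\<^sup>2))"
    using rhs_P_deriv[of "r\<^sup>2"] r by (simp add: within_eq_at)
  show "((\<lambda>r. G (r\<^sup>2)) has_real_derivative 2 * r * rhs P (r\<^sup>2)) (at r)"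
    using DERIV_chain2[OF g sq] by (simp add: mult_ac)
  show "((\<lambda>r. 2 * r * rhs P (r\<^sup>2)) has_real_derivative 2 * rhs P (r\<^sup>2) + 4 * r\<^sup>2 * G2 (r\<^sup>2)) (at r)"
    using DERIV_mult[OF DERIV_cmult_Id[of 2 r] DERIV_chain2[OF g2 sq]]
    by (simp add: algebra_simps power2_eq_square)
  define t where "t = r\<^sup>2"
  have "t \<ge> 0" by (simp add: t_def)
  then have P': "P' t = p * G t powr (p - 1) * rhs P t" and P: "P t = G t powr p"
    using G_positive[of t] by (auto simp: P'_def P_eq_powr max_def)
  have "2 * rhs P t + 4 * t * G2 t + (real N - 1) / r * (2 * r * rhs P t)
      + b * r * (p * G t powr (p - 1) * (2 * r * rhs P t)) + ((k + 2) * b + k\<^sup>2) * G t powr p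
    = 2 * (2 * t * G2 t + real N * rhs P t) + 2 * b * t * P' t + ((k + 2) * b + k\<^sup>2) * P t"
    using r unfolding P' P unfolding t_def by (simp add: field_simps power2_eq_square)
  also have "\<dots> = 0" unfolding G2_ode[OF \<open>t \<ge> 0\<close>] by (simp add: field_simps)
  finally show "2 * rhs P (r\<^sup>2) + 4 * r\<^sup>2 * G2 (r\<^sup>2) + (real N - 1) / r * (2 * r * rhs P (r\<^sup>2))
      + b * r * (p * G (r\<^sup>2) powr (p - 1) * (2 * r * rhs P (r\<^sup>2))) + ((k + 2) * b + k\<^sup>2) * G (r\<^sup>2) powr p = 0"
    unfolding t_def .
qed

end

section \<open>Self-similar solutions and their expansion at infinity\<close>

text \<open>The leading factor is positive away from \<open>0\<close>, so the remainder in (A) is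
  determined by \<open>u\<close> and its smallness becomes a limit.\<close>

lemma expansion_A_iff:
  fixes f u :: "real ^ 'n \<Rightarrow> real"
  assumes C: "C_star CARD('n) > 0"
    and f: "\<And>y. y \<noteq> 0 \<Longrightarrow> f y = (C_star CARD('n) / (norm y)\<^sup>2) powr (1 / n_exp CARD('n)) * (1 + u y)"
  shows "expansion_A B \<gamma> f \<longleftrightarrow> ((\<lambda>y. u y * norm y powr \<gamma>) \<longlongrightarrow> - B) at_infinity"
proof -
  define W :: "real ^ 'n \<Rightarrow> real" where "W y = (C_star CARD('n) / (norm y)\<^sup>2) powr (1 / n_exp CARD('n))" for y
  have ev0: "\<forall>\<^sub>F y::real ^ 'n in at_infinity. y \<noteq> 0"
    unfolding eventually_at_infinity by (rule exI[of _ 1]) auto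
  have W: "W y > 0" if "y \<noteq> 0" for y
    using C that by (simp add: W_def)
  have pw: "norm y powr - \<gamma> * norm y powr \<gamma> = 1" if "y \<noteq> 0" for y :: "real ^ 'n"
    using that by (simp flip: powr_add)
  show ?thesis
  proof
    assume "expansion_A B \<gamma> f"
    then obtain r where r: "r \<in> o[at_infinity](\<lambda>y. norm y powr - \<gamma>)"
      and ev: "\<forall>\<^sub>F y in at_infinity. f y = W y * (1 - B * norm y powr - \<gamma> + r y)"
      unfolding expansion_A_def W_def by blast
    have "((\<lambda>y. - B + r y / norm y powr - \<gamma>) \<longlongrightarrow> - B + 0) at_infinity"
      by (intro tendsto_add tendsto_const smalloD_tendsto[OF r])
    moreover have "\<forall>\<^sub>F y in at_infinity. - B + r y / norm y powr - \<gamma> = u y * norm y powr \<gamma>"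
      using ev ev0
    proof eventually_elim
      case (elim y)
      then have "W y * (1 + u y) = W y * (1 - B * norm y powr - \<gamma> + r y)"
        using f[of y] by (simp add: W_def)
      then have u: "u y = - B * norm y powr - \<gamma> + r y" using W[OF elim(2)] by simp
      have "u y * norm y powr \<gamma> = - B * (norm y powr - \<gamma> * norm y powr \<gamma>) + r y * norm y powr \<gamma>"
        unfolding u by (simp add: algebra_simps)
      then show ?case unfolding pw[OF elim(2)] by (simp add: powr_minus divide_inverse)
    qed
    ultimately show "((\<lambda>y. u y * norm y powr \<gamma>) \<longlongrightarrow> - B) at_infinity"
      by (auto elim: Lim_transform_eventually)
  next
    assume lim: "((\<lambda>y. u y * norm y powr \<gamma>) \<longlongrightarrow> - B) at_infinity"
    define r where "r y = u y + B * norm y powr - \<gamma>" for y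
    have "((\<lambda>y. u y * norm y powr \<gamma> + B) \<longlongrightarrow> - B + B) at_infinity"
      by (intro tendsto_add tendsto_const lim)
    moreover have "\<forall>\<^sub>F y in at_infinity. u y * norm y powr \<gamma> + B = r y / norm y powr - \<gamma>"
      using ev0
    proof eventually_elim
      case (elim y)
      have "r y / norm y powr - \<gamma> = u y * norm y powr \<gamma> + B * (norm y powr - \<gamma> * norm y powr \<gamma>)"
        by (simp add: r_def powr_minus divide_inverse algebra_simps)
      then show ?case unfolding pw[OF elim] by simp
    qed
    ultimately have "((\<lambda>y. r y / norm y powr - \<gamma>) \<longlongrightarrow> 0) at_infinity"
      by (auto elim: Lim_transform_eventually)
    then have "r \<in> o[at_infinity](\<lambda>y. norm y powr - \<gamma>)"
      by (rule smalloI_tendsto) (use ev0 in \<open>auto elim!: eventually_mono\<close>)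
    moreover have "\<forall>\<^sub>F y in at_infinity. f y = W y * (1 - B * norm y powr - \<gamma> + r y)"
      using ev0 by eventually_elim (simp add: f W_def r_def)
    ultimately show "expansion_A B \<gamma> f"
      unfolding expansion_A_def W_def by blast
  qed
qed

lemma C_star_closed_form:
  assumes "N \<ge> 3"
  shows "C_star N = (real N - 2)\<^sup>2 / (real N + 2)"
proof -
  have n: "n_exp N = 4 / (real N + 2)" by (simp add: n_exp_def m_exp_def field_simps)
  have e: "(1 - m_exp N) * real N - 2 = 2 * (real N - 2) / (real N + 2)"
    unfolding n_exp_def[symmetric] n by (simp add: field_simps)
  have "2 * (u / z) * (2 * u / z) / (4 / z) = u\<^sup>2 / z" if "z \<noteq> 0" for u z :: real
    using that by (simp add: power2_eq_square)
  from this[of "real N + 2" "real N - 2"] show ?thesis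
    unfolding C_star_def e unfolding n m_exp_def by simp
qed

text \<open>The phantom \<open>T\<close> fixes the index type, so that the dimension in the partial
  differential equation and \<open>N\<close> in the profile are tied together.\<close>

locale self_similar = emden_profile N k p b G for N k p b G +
  fixes \<beta> :: real and T :: "'n::finite itself"
  assumes N_card: "N = CARD('n)" and b_eq: "b = \<beta> * C_star N"
begin

lemma m_exp_eq: "m_exp N = 1 / p"
proof -
  have "m_exp N = k / (k + 2)" using k_positive by (simp add: m_exp_def N_eq field_simps)
  then show ?thesis unfolding kp_eq[symmetric] using k_positive by simp
qed

lemma inverse_n_exp: "1 / n_exp N = (k + 2) / 2"
  using k_positive by (simp add: n_exp_def m_exp_def N_eq field_simps)

lemma C_star_eq: "C_star N = 2 * k\<^sup>2 / (k + 2)"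
  unfolding C_star_closed_form[OF N_ge_3] N_eq using k_positive by (simp add: field_simps power2_eq_square)

lemma C_star_pos: "C_star N > 0"
  using k_positive by (simp add: C_star_eq)

text \<open>Identifies the zeroth-order coefficient of the normalised equation with that of (E),
  scaled by \<open>C_star N\<close>.\<close>

lemma alpha_C_star: "alpha N \<beta> * C_star N = (k + 2) * b + k\<^sup>2"
proof -
  have a: "alpha N \<beta> = (1 + 2 * \<beta>) * ((k + 2) / 2)"
    unfolding inverse_n_exp[symmetric] by (simp add: alpha_def)
  show ?thesis unfolding a b_eq C_star_eq using k_positive by (simp add: field_simps)
qed

definition \<omega> :: real where "\<omega> = C_star N powr (k / 2)"

lemma \<omega>_pos: "\<omega> > 0" using C_star_pos by (simp add: \<omega>_def)

text \<open>The value of \<open>f powr m\<close> at the origin for the solution of scale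
  \<open>\<mu>\<close>. The factor \<open>\<omega>\<close> makes its power \<open>p - 1\<close>
  equal to \<open>C_star N * \<mu>\<^sup>2\<close>, which turns \<open>\<beta>\<close> into
  \<open>b\<close>.\<close>

definition amp :: "real \<Rightarrow> real" where "amp \<mu> = \<omega> * \<mu> powr k"

lemma amp_pos: "\<mu> > 0 \<Longrightarrow> amp \<mu> > 0"
  using \<omega>_pos by (simp add: amp_def)

lemma amp_powr: "\<mu> > 0 \<Longrightarrow> amp \<mu> powr (p - 1) = C_star N * \<mu>\<^sup>2"
proof -
  assume \<mu>: "\<mu> > 0"
  have "amp \<mu> powr (p - 1) = C_star N powr (k * (p - 1) / 2) * \<mu> powr (k * (p - 1))"
    using \<mu> \<omega>_pos C_star_pos by (simp add: amp_def powr_mult \<omega>_def powr_powr)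
  then show ?thesis unfolding k_times_p using \<mu> C_star_pos by simp
qed

lemma powr_p_split: "x > 0 \<Longrightarrow> x powr p = x * x powr (p - 1)"
  using powr_add[of x 1 "p - 1"] by simp

lemma powr_p_m: "x > 0 \<Longrightarrow> (x powr p) powr m_exp N = x"
  using p_greater_1 by (simp add: m_exp_eq powr_powr)

definition sol :: "real \<Rightarrow> real ^ 'n \<Rightarrow> real" where
  "sol \<mu> y = (amp \<mu> * G (\<mu>\<^sup>2 * (y \<bullet> y))) powr p"

lemma sol_is_solution:
  assumes \<mu>: "\<mu> > 0"
  shows "radial_smooth_positive_solution \<beta> (sol \<mu>)"
proof -
  define \<psi> where "\<psi> t = amp \<mu> * G (\<mu>\<^sup>2 * t)" for t
  have \<psi>pos: "\<psi> t > 0" if "t \<ge> 0" for t using that amp_pos[OF \<mu>] G_positive by (simp add: \<psi>_def)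
  have sol: "sol \<mu> = (\<lambda>y. \<psi> (y \<bullet> y) powr p)" by (rule ext) (simp add: sol_def \<psi>_def)
  have Ck: "Ck_nonneg n \<psi>" for n
    unfolding \<psi>_def by (intro Ck_nonneg_mult Ck_nonneg_const Ck_nonneg_scale Ck_nonneg_G) simp
  have scale: "((\<lambda>t. F (\<mu>\<^sup>2 * t)) has_real_derivative F' (\<mu>\<^sup>2 * t) * \<mu>\<^sup>2) (at t within {0..})"
    if F: "\<And>t. t \<ge> 0 \<Longrightarrow> (F has_real_derivative F' t) (at t within {0..})" and t: "t \<ge> 0" for F F' t
  proof -
    have im: "(\<lambda>t. \<mu>\<^sup>2 * t) ` {0..} \<subseteq> {0..}" by auto
    have "(F has_real_derivative F' (\<mu>\<^sup>2 * t)) (at (\<mu>\<^sup>2 * t) within (\<lambda>t. \<mu>\<^sup>2 * t) ` {0..})"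
      by (rule has_field_derivative_subset[OF F im]) (use t in auto)
    from DERIV_image_chain[OF this, of "\<mu>\<^sup>2"] show ?thesis
      by (simp add: o_def)
  qed
  define \<psi>' where "\<psi>' t = amp \<mu> * (rhs P (\<mu>\<^sup>2 * t) * \<mu>\<^sup>2)" for t
  define \<psi>'' where "\<psi>'' t = amp \<mu> * (G2 (\<mu>\<^sup>2 * t) * \<mu>\<^sup>2 * \<mu>\<^sup>2)" for t
  have d1: "(\<psi> has_real_derivative \<psi>' t) (at t within {0..})" if "t \<ge> 0" for t
    unfolding \<psi>_def \<psi>'_def by (intro DERIV_cmult scale[OF G_deriv_P] that)
  have d2: "(\<psi>' has_real_derivative \<psi>'' t) (at t within {0..})" if "t \<ge> 0" for t
    unfolding \<psi>'_def \<psi>''_def by (intro DERIV_cmult DERIV_cmult_right scale[OF rhs_P_deriv] that)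
  have d3: "((\<lambda>t. \<psi> t powr p) has_real_derivative p * \<psi> t powr (p - 1) * \<psi>' t) (at t within {0..})"
    if t: "t \<ge> 0" for t
  proof -
    have "((\<lambda>y. y powr p) has_real_derivative p * \<psi> t powr (p - 1)) (at (\<psi> t))"
      using \<psi>pos[OF t] by (auto intro!: derivative_eq_intros)
    from DERIV_chain2[OF this d1[OF t]] show ?thesis .
  qed
  have "solves_E \<beta> (sol \<mu>)"
    unfolding solves_E_def
  proof
    fix y :: "real ^ 'n"
    define t where "t = y \<bullet> y"
    have t: "t \<ge> 0" by (simp add: t_def)
    define \<tau> where "\<tau> = \<mu>\<^sup>2 * t"
    have \<tau>: "\<tau> \<ge> 0" using t by (simp add: \<tau>_def)
    have fm: "(\<lambda>x. sol \<mu> x powr m_exp CARD('n)) = (\<lambda>x. \<psi> (x \<bullet> x))"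
      using powr_p_m[OF \<psi>pos] by (simp add: sol flip: N_card)
    have lap: "laplacian (\<lambda>x. sol \<mu> x powr m_exp CARD('n)) y = 2 * real N * \<psi>' t + 4 * t * \<psi>'' t"
      unfolding fm t_def N_card[THEN arg_cong[where f = real]]
      by (rule laplacian_radial[of UNIV]) (auto intro: d1 d2)
    have grad: "y \<bullet> gradient (sol \<mu>) y = 2 * t * (p * \<psi> t powr (p - 1) * \<psi>' t)"
      unfolding sol t_def by (rule inner_gradient_radial[OF d3]) simp
    have Gt: "G \<tau> > 0" by (rule G_positive[OF \<tau>])
    have pw1: "\<psi> t powr (p - 1) = C_star N * \<mu>\<^sup>2 * G \<tau> powr (p - 1)"
      using amp_pos[OF \<mu>] Gt by (simp add: \<psi>_def powr_mult amp_powr[OF \<mu>] flip: \<tau>_def)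
    have pw: "\<psi> t powr p = amp \<mu> * (C_star N * \<mu>\<^sup>2) * P \<tau>"
      using amp_pos[OF \<mu>] Gt by (simp add: \<psi>_def powr_mult P_eq_powr[OF \<tau>] powr_p_split[OF amp_pos[OF \<mu>]] amp_powr[OF \<mu>] flip: \<tau>_def)
    have P': "P' \<tau> = p * G \<tau> powr (p - 1) * rhs P \<tau>"
      using Gt by (simp add: P'_def max_absorb2)
    \<comment> \<open>Every term carries the factor \<open>amp \<mu> * \<mu>\<^sup>2\<close>; the
      remaining bracket vanishes by \<open>G2_ode\<close>.\<close>
    have "2 * real N * \<psi>' t + 4 * t * \<psi>'' t + \<beta> * (2 * t * (p * \<psi> t powr (p - 1) * \<psi>' t)) + alpha N \<beta> * \<psi> t powr p
      = amp \<mu> * \<mu>\<^sup>2 * (2 * (2 * \<tau> * G2 \<tau> + real N * rhs P \<tau>) + 2 * (\<beta> * C_star N) * \<tau> * P' \<tau> + (alpha N \<beta> * C_star N) * P \<tau>)"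
      unfolding pw1 pw P' unfolding \<psi>'_def \<psi>''_def \<tau>_def by (simp add: algebra_simps)
    also have "\<dots> = 0"
      unfolding G2_ode[OF \<tau>] alpha_C_star b_eq[symmetric] by (simp add: field_simps)
    finally show "laplacian (\<lambda>x. sol \<mu> x powr m_exp CARD('n)) y + \<beta> * (y \<bullet> gradient (sol \<mu>) y)
        + alpha CARD('n) \<beta> * sol \<mu> y = 0"
      unfolding lap grad by (simp add: sol t_def flip: N_card)
  qed
  moreover have "smooth (sol \<mu>)"
    unfolding sol by (rule smooth_radial) (intro Ck_nonneg_powr \<psi>pos Ck)
  moreover have "sol \<mu> y > 0" for y
  proof -
    have "\<psi> (y \<bullet> y) > 0" by (rule \<psi>pos) simp
    then show ?thesis by (simp add: sol)
  qed
  moreover have "radially_symmetric (sol \<mu>)"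
    unfolding radially_symmetric_def sol_def by (simp add: dot_square_norm)
  ultimately show ?thesis
    by (simp add: radial_smooth_positive_solution_def)
qed

text \<open>The value at the origin selects the scale. After rescaling, the radial profile of
  \<open>f powr m\<close> is a normalised radial solution, and uniqueness identifies it with
  \<open>G\<close>; so all solutions form one family in \<open>\<mu>\<close>.\<close>

lemma solution_is_sol:
  assumes f: "radial_smooth_positive_solution \<beta> (f :: real ^ 'n \<Rightarrow> real)"
  obtains \<mu> where "\<mu> > 0" "f = sol \<mu>"
proof -
  define e :: "real ^ 'n" where "e = axis undefined 1"
  have rad: "radially_symmetric f" and pos: "\<And>y. f y > 0" and E: "solves_E \<beta> f" and "C_k 2 f"
    using f by (auto simp: radial_smooth_positive_solution_def smooth_def)
  then have "C_k (Suc (Suc 0)) f" by (simp add: numeral_2_eq_2)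
  then have dif: "f differentiable_on UNIV" "partial_deriv undefined f differentiable_on UNIV" by auto
  define g where "g r = f (r *\<^sub>R e)" for r
  define g1 where "g1 r = partial_deriv undefined f (r *\<^sub>R e)" for r
  define g2 where "g2 r = partial_deriv undefined (partial_deriv undefined f) (r *\<^sub>R e)" for r
  have dg: "(g has_real_derivative g1 r) (at r)" and dg1: "(g1 has_real_derivative g2 r) (at r)" for r
    using line_deriv[OF dif(1)] line_deriv[OF dif(2)] by (simp_all add: g_def[abs_def] g1_def[abs_def] g2_def e_def)
  have gpos: "g r > 0" for r by (simp add: g_def pos)
  have fg: "f x = g (norm x)" for x
    unfolding g_def by (rule rad[unfolded radially_symmetric_def, rule_format]) (simp add: e_def)
  define m where "m = m_exp N"
  have mp: "m * p = 1" using p_greater_1 by (simp add: m_def m_exp_eq)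
  define \<gamma> where "\<gamma> r = g r powr m" for r
  define \<gamma>1 where "\<gamma>1 r = m * g r powr (m - 1) * g1 r" for r
  define \<gamma>2 where "\<gamma>2 r = m * ((m - 1) * g r powr (m - 1 - 1) * g1 r) * g1 r + g2 r * (m * g r powr (m - 1))" for r
  have d1: "(\<gamma> has_real_derivative \<gamma>1 r) (at r)" for r
    unfolding \<gamma>_def \<gamma>1_def using DERIV_fun_powr[OF dg gpos, of m r] by simp
  have "((\<lambda>r. g r powr (m - 1)) has_real_derivative (m - 1) * g r powr (m - 1 - 1) * g1 r) (at r)" for r
    using DERIV_fun_powr[OF dg gpos, of "m - 1" r] by simp
  then have d2: "(\<gamma>1 has_real_derivative \<gamma>2 r) (at r)" for r
    unfolding \<gamma>1_def \<gamma>2_def by (intro DERIV_mult DERIV_cmult dg1)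
  have \<gamma>pos: "\<gamma> r > 0" for r using gpos[of r] by (simp add: \<gamma>_def)
  have g\<gamma>: "g r = \<gamma> r powr p" for r using gpos[of r] mp by (simp add: \<gamma>_def powr_powr)
  have g1\<gamma>: "g1 r = p * \<gamma> r powr (p - 1) * \<gamma>1 r" for r
  proof -
    have "\<gamma> r powr (p - 1) * g r powr (m - 1) = g r powr (m * (p - 1) + (m - 1))"
      by (simp add: \<gamma>_def powr_powr powr_add)
    also have "m * (p - 1) + (m - 1) = 0" using mp by (simp add: algebra_simps)
    finally have "\<gamma> r powr (p - 1) * g r powr (m - 1) = 1" using gpos[of r] by simp
    then have "p * \<gamma> r powr (p - 1) * \<gamma>1 r = (m * p) * g1 r" by (simp add: \<gamma>1_def)
    then show ?thesis unfolding mp by simp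
  qed
  have ode: "\<gamma>2 r + (real N - 1) / r * \<gamma>1 r + \<beta> * (r * g1 r) + alpha N \<beta> * g r = 0" if r: "r > 0" for r
  proof -
    define y where "y = r *\<^sub>R e"
    have y: "norm y = r" "y \<noteq> 0" using r by (auto simp: y_def e_def)
    have f_eq: "f = (\<lambda>x. g (norm x))" and fm: "(\<lambda>x. f x powr m_exp CARD('n)) = (\<lambda>x. \<gamma> (norm x))"
      using fg by (auto simp: \<gamma>_def m_def simp flip: N_card)
    have "laplacian (\<lambda>x. f x powr m_exp CARD('n)) y = \<gamma>2 r + (real N - 1) / r * \<gamma>1 r"
      unfolding fm using radial_second_order(1)[OF d1 d2 y(2)] y(1) by (simp flip: N_card)
    moreover have "y \<bullet> gradient f y = r * g1 r"
      unfolding f_eq using radial_second_order(2)[OF dg dg1 y(2)] y(1) by simp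
    moreover have "f y = g r" by (simp add: fg y)
    ultimately show ?thesis
      using E[unfolded solves_E_def, THEN spec[of _ y]] by (simp flip: N_card)
  qed
  define c where "c = \<gamma> 0"
  have c: "c > 0" using \<gamma>pos by (simp add: c_def)
  \<comment> \<open>The positive scale for which \<open>amp \<mu> = c\<close>.\<close>
  define \<mu> where "\<mu> = (c / \<omega>) powr (1 / k)"
  have \<mu>: "\<mu> > 0" using c \<omega>_pos by (simp add: \<mu>_def)
  have amp: "amp \<mu> = c" using c \<omega>_pos k_positive by (simp add: amp_def \<mu>_def powr_powr)
  have cp: "c powr (p - 1) = C_star N * \<mu>\<^sup>2" using amp_powr[OF \<mu>] by (simp add: amp)
  define h where "h r = \<gamma> (r / \<mu>) / c" for r
  define h1 where "h1 r = \<gamma>1 (r / \<mu>) * (1 / \<mu>) / c" for r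
  define h2 where "h2 r = \<gamma>2 (r / \<mu>) * (1 / \<mu>) * (1 / \<mu>) / c" for r
  have dm: "((\<lambda>r. r / \<mu>) has_real_derivative 1 / \<mu>) (at r)" for r
    by (rule DERIV_cdivide[OF DERIV_ident])
  have dh: "(h has_real_derivative h1 r) (at r)" for r
    unfolding h_def h1_def by (intro DERIV_cdivide DERIV_chain2[OF d1 dm])
  have dh1: "(h1 has_real_derivative h2 r) (at r)" for r
    unfolding h1_def h2_def by (intro DERIV_cdivide DERIV_cmult_right DERIV_chain2[OF d2 dm])
  have "radial_solution h"
  proof (rule radial_solutionI)
    show "h 0 = 1" using c by (simp add: h_def c_def)
    show "h r > 0" for r using c \<gamma>pos by (simp add: h_def)
    show "continuous_on {0..} h" "continuous_on {0..} h1"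
      by (auto intro!: continuous_at_imp_continuous_on DERIV_isCont dh dh1)
    show "(h has_real_derivative h1 r) (at r)" "(h1 has_real_derivative h2 r) (at r)" for r
      by (rule dh, rule dh1)
    fix r :: real assume r: "r > 0"
    define \<rho> where "\<rho> = r / \<mu>"
    have \<rho>: "\<rho> > 0" "r = \<mu> * \<rho>" using r \<mu> by (auto simp: \<rho>_def)
    have \<gamma>h: "\<gamma> \<rho> = c * h r" using c by (simp add: h_def \<rho>_def)
    have hpos: "h r > 0" using c \<gamma>pos by (simp add: h_def)
    have pw1: "\<gamma> \<rho> powr (p - 1) = C_star N * \<mu>\<^sup>2 * h r powr (p - 1)"
      unfolding \<gamma>h using c hpos by (simp add: powr_mult cp)
    have pw: "\<gamma> \<rho> powr p = c * (C_star N * \<mu>\<^sup>2) * h r powr p"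
      unfolding \<gamma>h using c hpos by (simp add: powr_mult powr_p_split[OF c] cp)
    have "h2 r + (real N - 1) / r * h1 r + b * r * (p * h r powr (p - 1) * h1 r) + ((k + 2) * b + k\<^sup>2) * h r powr p
      = (\<gamma>2 \<rho> + (real N - 1) / \<rho> * \<gamma>1 \<rho> + \<beta> * (\<rho> * g1 \<rho>) + alpha N \<beta> * g \<rho>) / (c * \<mu>\<^sup>2)"
      unfolding g1\<gamma> g\<gamma> pw1 pw alpha_C_star[symmetric] unfolding b_eq
      unfolding h2_def h1_def \<rho>_def[symmetric] unfolding \<rho>(2)
      using c \<mu> \<rho>(1) by (simp add: field_simps power2_eq_square)
    also have "\<dots> = 0" using ode[OF \<rho>(1)] by simp
    finally show "h2 r + (real N - 1) / r * h1 r + b * r * (p * h r powr (p - 1) * h1 r) + ((k + 2) * b + k\<^sup>2) * h r powr p = 0" .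
  qed
  from radial_solution_unique[OF this radial_solution_profile]
  have hG: "h r = G (r\<^sup>2)" if "r \<ge> 0" for r using that by blast
  have "f y = sol \<mu> y" for y
  proof -
    have "h (\<mu> * norm y) = G ((\<mu> * norm y)\<^sup>2)" by (rule hG) (use \<mu> in simp)
    then have "\<gamma> (norm y) = c * G (\<mu>\<^sup>2 * (y \<bullet> y))"
      using c \<mu> by (simp add: h_def power_mult_distrib dot_square_norm field_simps)
    then show ?thesis by (simp add: fg g\<gamma> sol_def amp)
  qed
  then show thesis using that[OF \<mu>] by blast
qed

text \<open>The scale enters only as \<open>ln \<mu>\<close> added to \<open>ln (norm y)\<close>, a
  translation along the orbit; the explicit factor corresponds to the rest point
  \<open>v = 1\<close>.\<close>

lemma sol_eq_orbit:
  assumes \<mu>: "\<mu> > 0" and y: "y \<noteq> 0"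
  shows "sol \<mu> y = (C_star N / (norm y)\<^sup>2) powr (1 / n_exp N) * v (ln (\<mu> * norm y)) powr p"
proof -
  define r where "r = norm y"
  have r: "r > 0" using y by (simp add: r_def)
  define s where "s = ln (\<mu> * r)"
  have "exp (2 * s) = (exp s)\<^sup>2" by (simp add: exp_double)
  then have e2: "exp (2 * s) = \<mu>\<^sup>2 * (y \<bullet> y)"
    using \<mu> r by (simp add: s_def power_mult_distrib dot_square_norm r_def)
  have ek: "exp (k * s) = \<mu> powr k * r powr k"
    using \<mu> r by (simp add: s_def powr_def ln_mult exp_add distrib_left)
  have "amp \<mu> * G (\<mu>\<^sup>2 * (y \<bullet> y)) = \<omega> * r powr (- k) * v s"
    unfolding v_def ek e2 amp_def using r by (simp add: powr_minus field_simps)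
  then have "sol \<mu> y = (\<omega> * r powr (- k) * v s) powr p" by (simp add: sol_def)
  also have "\<dots> = C_star N powr (k * p / 2) * r powr (- (k * p)) * v s powr p"
    using r C_star_pos \<omega>_pos v_positive[of s] by (simp add: powr_mult \<omega>_def powr_powr)
  also have "C_star N powr (k * p / 2) * r powr (- (k * p)) = (C_star N / r\<^sup>2) powr (1 / n_exp N)"
  proof -
    have "(C_star N / r\<^sup>2) powr ((k + 2) / 2) = C_star N powr ((k + 2) / 2) / (r powr 2) powr ((k + 2) / 2)"
      using r C_star_pos by (simp add: powr_divide powr_numeral)
    also have "(r powr 2) powr ((k + 2) / 2) = r powr (k + 2)" by (simp only: powr_powr times_divide_eq_right nonzero_mult_div_cancel_left zero_neq_numeral not_False_eq_True)
    finally have *: "(C_star N / r\<^sup>2) powr ((k + 2) / 2) = C_star N powr ((k + 2) / 2) / r powr (k + 2)" .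
    show ?thesis
      unfolding kp_eq inverse_n_exp * by (simp only: powr_minus_divide times_divide_eq_right mult_1_right)
  qed
  finally show ?thesis by (simp add: r_def s_def)
qed

text \<open>Since \<open>v powr p - 1\<close> is asymptotic to \<open>p * (v - 1)\<close> and
  \<open>exp (\<gamma> * s) = (\<mu> * norm y) powr \<gamma>\<close>, the limit that has to equal
  \<open>- B\<close> is \<open>p * A * \<mu> powr - \<gamma>\<close>.\<close>

lemma expansion_A_sol_iff:
  assumes lim: "((\<lambda>s. (v s - 1) * exp (\<gamma> * s)) \<longlongrightarrow> A) at_top" and A: "A \<noteq> 0" and \<gamma>: "\<gamma> > 0" and \<mu>: "\<mu> > 0"
  shows "expansion_A B \<gamma> (sol \<mu>) \<longleftrightarrow> B = - (p * A) * \<mu> powr - \<gamma>"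
proof -
  have "((\<lambda>s. (v s - 1) * exp (\<gamma> * s) * exp (- \<gamma> * s)) \<longlongrightarrow> A * 0) at_top"
    by (intro tendsto_mult lim) (use \<gamma> in real_asymp)
  then have "((\<lambda>s. v s - 1) \<longlongrightarrow> 0) at_top" by (simp add: mult.assoc flip: exp_add)
  then have v1: "(v \<longlongrightarrow> 1) at_top" by (rule Lim_null[THEN iffD2])
  have ne: "\<forall>\<^sub>F s in at_top. v s \<noteq> 1"
    using tendsto_imp_eventually_ne[OF lim A] by eventually_elim auto
  have at1: "filterlim v (at 1) at_top" using v1 ne by (simp add: filterlim_at)
  have "((\<lambda>x. (x powr p - 1) / (x - 1)) \<longlongrightarrow> p) (at 1)"
    using p_greater_1 by real_asymp
  from tendsto_mult[OF filterlim_compose[OF this at1] lim]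
  have "((\<lambda>s. (v s powr p - 1) / (v s - 1) * ((v s - 1) * exp (\<gamma> * s))) \<longlongrightarrow> p * A) at_top" .
  moreover have "\<forall>\<^sub>F s in at_top. (v s powr p - 1) / (v s - 1) * ((v s - 1) * exp (\<gamma> * s)) = (v s powr p - 1) * exp (\<gamma> * s)"
    using ne by eventually_elim simp
  ultimately have lim2: "((\<lambda>s. (v s powr p - 1) * exp (\<gamma> * s)) \<longlongrightarrow> p * A) at_top"
    by (rule Lim_transform_eventually)
  have "filterlim (\<lambda>r. ln (\<mu> * r)) at_top at_top" using \<mu> by real_asymp
  then have "filterlim (\<lambda>y::real ^ 'n. ln (\<mu> * norm y)) at_top at_infinity"
    by (rule filterlim_compose[OF _ filterlim_norm_at_top])
  from tendsto_mult[OF filterlim_compose[OF lim2 this] tendsto_const[of "\<mu> powr - \<gamma>"]]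
  have "((\<lambda>y::real ^ 'n. (v (ln (\<mu> * norm y)) powr p - 1) * exp (\<gamma> * ln (\<mu> * norm y)) * \<mu> powr - \<gamma>)
      \<longlongrightarrow> p * A * \<mu> powr - \<gamma>) at_infinity" .
  moreover have "\<forall>\<^sub>F y::real ^ 'n in at_infinity. (v (ln (\<mu> * norm y)) powr p - 1) * exp (\<gamma> * ln (\<mu> * norm y)) * \<mu> powr - \<gamma>
      = (v (ln (\<mu> * norm y)) powr p - 1) * norm y powr \<gamma>"
  proof -
    have "\<forall>\<^sub>F y::real ^ 'n in at_infinity. y \<noteq> 0"
      unfolding eventually_at_infinity by (rule exI[of _ 1]) auto
    then show ?thesis
    proof eventually_elim
      case (elim y)
      have "exp (\<gamma> * ln (\<mu> * norm y)) = \<mu> powr \<gamma> * norm y powr \<gamma>"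
        using elim \<mu> by (simp add: powr_def ln_mult exp_add distrib_left)
      then show ?case using \<mu> by (simp add: powr_minus)
    qed
  qed
  ultimately have lim3: "((\<lambda>y::real ^ 'n. (v (ln (\<mu> * norm y)) powr p - 1) * norm y powr \<gamma>)
      \<longlongrightarrow> p * A * \<mu> powr - \<gamma>) at_infinity"
    by (rule Lim_transform_eventually)
  have "expansion_A B \<gamma> (sol \<mu>) \<longleftrightarrow>
      ((\<lambda>y::real ^ 'n. (v (ln (\<mu> * norm y)) powr p - 1) * norm y powr \<gamma>) \<longlongrightarrow> - B) at_infinity"
    by (rule expansion_A_iff) (use C_star_pos sol_eq_orbit[OF \<mu>] in \<open>simp_all flip: N_card\<close>)
  also have "\<dots> \<longleftrightarrow> - B = p * A * \<mu> powr - \<gamma>"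
  proof
    assume "((\<lambda>y::real ^ 'n. (v (ln (\<mu> * norm y)) powr p - 1) * norm y powr \<gamma>) \<longlongrightarrow> - B) at_infinity"
    then show "- B = p * A * \<mu> powr - \<gamma>"
      by (rule tendsto_unique[OF trivial_limit_at_infinity _ lim3])
  next
    assume B: "- B = p * A * \<mu> powr - \<gamma>"
    show "((\<lambda>y::real ^ 'n. (v (ln (\<mu> * norm y)) powr p - 1) * norm y powr \<gamma>) \<longlongrightarrow> - B) at_infinity"
      unfolding B by (rule lim3)
  qed
  also have "\<dots> \<longleftrightarrow> B = - (p * A) * \<mu> powr - \<gamma>" unfolding mult_minus_left by linarith
  finally show ?thesis .
qed

text \<open>The map from \<open>\<mu>\<close> to \<open>- (p * A) * \<mu> powr - \<gamma>\<close> is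
  a bijection of the positive numbers onto the half-line of sign opposite to \<open>A\<close>, which
  is where \<open>B\<close> lies.\<close>

lemma unique_solution_with_expansion:
  assumes lim: "((\<lambda>s. (v s - 1) * exp (\<gamma> * s)) \<longlongrightarrow> A) at_top" and AB: "A * B < 0" and \<gamma>: "\<gamma> > 0"
  shows "\<exists>!f :: real ^ 'n \<Rightarrow> real. radial_smooth_positive_solution \<beta> f \<and> expansion_A B \<gamma> f"
proof -
  have A: "A \<noteq> 0" and B: "B \<noteq> 0" using AB by auto
  note iff = expansion_A_sol_iff[OF lim A \<gamma>]
  define x where "x = - (p * A) / B"
  have "A / B < 0" using AB by (auto simp: mult_less_0_iff divide_less_0_iff)
  then have x: "x > 0" using p_greater_1 mult_pos_neg[of p "A / B"] by (simp add: x_def)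
  have pA: "p * A \<noteq> 0" using A p_greater_1 by simp
  have key: "B = - (p * A) * \<mu> powr - \<gamma> \<longleftrightarrow> \<mu> = x powr (1 / \<gamma>)" if \<mu>: "\<mu> > 0" for \<mu>
  proof -
    have "B = - (p * A) * \<mu> powr - \<gamma> \<longleftrightarrow> \<mu> powr \<gamma> = x"
      using \<mu> B by (auto simp: x_def powr_minus field_simps)
    also have "\<dots> \<longleftrightarrow> \<mu> = x powr (1 / \<gamma>)"
      using \<mu> \<gamma> x by (auto simp: powr_powr)
    finally show ?thesis .
  qed
  show ?thesis
  proof (rule ex1I[of _ "sol (x powr (1 / \<gamma>))"])
    have \<mu>: "x powr (1 / \<gamma>) > 0" using x by simp
    show "radial_smooth_positive_solution \<beta> (sol (x powr (1 / \<gamma>))) \<and> expansion_A B \<gamma> (sol (x powr (1 / \<gamma>)))"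
      using sol_is_solution[OF \<mu>] iff[OF \<mu>] key[OF \<mu>] by simp
  next
    fix f :: "real ^ 'n \<Rightarrow> real"
    assume f: "radial_smooth_positive_solution \<beta> f \<and> expansion_A B \<gamma> f"
    then obtain \<mu> where \<mu>: "\<mu> > 0" "f = sol \<mu>" using solution_is_sol by blast
    then show "f = sol (x powr (1 / \<gamma>))" using f iff[OF \<mu>(1)] key[OF \<mu>(1)] by simp
  qed
qed

lemma explicit_sol:
  assumes bk: "b = k" and \<mu>: "\<mu> > 0"
  shows "sol \<mu> y = (C_star N / ((1 / \<mu>)\<^sup>2 + (norm y)\<^sup>2)) powr (1 / n_exp N)"
proof -
  define X where "X = (1 / \<mu>)\<^sup>2 + (norm y)\<^sup>2"
  have X: "X > 0" unfolding X_def using \<mu> by (intro add_pos_nonneg) auto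
  have "1 + \<mu>\<^sup>2 * (y \<bullet> y) = \<mu>\<^sup>2 * X"
    using \<mu> by (simp add: X_def dot_square_norm field_simps)
  then have "G (\<mu>\<^sup>2 * (y \<bullet> y)) = (\<mu>\<^sup>2 * X) powr (- (k / 2))"
    using explicit_profile[OF bk, of "\<mu>\<^sup>2 * (y \<bullet> y)"] by simp
  also have "\<dots> = \<mu> powr (- k) * X powr (- (k / 2))"
  proof -
    have "\<mu>\<^sup>2 powr (- (k / 2)) = \<mu> powr (- k)"
      using powr_powr[of \<mu> 2 "- (k / 2)"] \<mu> by simp
    then show ?thesis using \<mu> X by (simp add: powr_mult)
  qed
  finally have "amp \<mu> * G (\<mu>\<^sup>2 * (y \<bullet> y)) = (C_star N / X) powr (k / 2)"
    using \<mu> X C_star_pos by (simp add: amp_def \<omega>_def powr_minus powr_divide field_simps)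
  then have "sol \<mu> y = (C_star N / X) powr (k * p / 2)"
    by (simp add: sol_def powr_powr)
  then show ?thesis unfolding kp_eq inverse_n_exp X_def .
qed

text \<open>Here \<open>v s = (1 + exp (- 2 * s)) powr (- (k / 2))\<close>, whose first-order
  expansion is \<open>1 - (k / 2) * exp (- 2 * s)\<close>.\<close>

lemma explicit_orbit_limit:
  assumes bk: "b = k"
  shows "((\<lambda>s. (v s - 1) * exp (2 * s)) \<longlongrightarrow> - (k / 2)) at_top"
proof -
  have "v s = exp (k * s) * (1 + exp (2 * s)) powr (- (k / 2))" for s
    by (simp add: v_def explicit_profile[OF bk])
  moreover have "((\<lambda>s. (exp (k * s) * (1 + exp (2 * s)) powr (- (k / 2)) - 1) * exp (2 * s)) \<longlongrightarrow> - (k / 2)) at_top"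
    using k_positive by real_asymp
  ultimately show ?thesis by simp
qed

end

section \<open>The exponents as roots of a quadratic, and the three ranges of
  \<open>\<beta>\<close>\<close>

lemma gamma_sum_prod:
  assumes N: "N \<ge> 3" and disc: "\<beta>\<^sup>2 * (real N - 2)\<^sup>2 > 4 * (real N - 2)" and \<beta>: "\<beta> > 0"
  shows "gamma1 N \<beta> + gamma2 N \<beta> = \<beta> * (real N - 2)" "gamma1 N \<beta> * gamma2 N \<beta> = real N - 2"
    "0 < gamma1 N \<beta>" "gamma1 N \<beta> < gamma2 N \<beta>"
proof -
  define D where "D = \<beta>\<^sup>2 * (real N - 2)\<^sup>2 - 4 * (real N - 2)"
  have D: "D > 0" using disc by (simp add: D_def)
  then have sD: "sqrt D > 0" "sqrt D * sqrt D = D" by auto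
  have g: "gamma1 N \<beta> = (\<beta> * (real N - 2) - sqrt D) / 2" "gamma2 N \<beta> = (\<beta> * (real N - 2) + sqrt D) / 2"
    by (simp_all add: gamma1_def gamma2_def D_def)
  show sum: "gamma1 N \<beta> + gamma2 N \<beta> = \<beta> * (real N - 2)" unfolding g by (simp add: field_simps)
  have "gamma1 N \<beta> * gamma2 N \<beta> = (\<beta>\<^sup>2 * (real N - 2)\<^sup>2 - sqrt D * sqrt D) / 4"
    unfolding g by (simp add: field_simps power2_eq_square)
  then show prod: "gamma1 N \<beta> * gamma2 N \<beta> = real N - 2" unfolding sD(2) by (simp add: D_def)
  show lt: "gamma1 N \<beta> < gamma2 N \<beta>" using sD unfolding g by simp
  have "gamma2 N \<beta> > 0" using sD(1) \<beta> N unfolding g by (intro divide_pos_pos add_nonneg_pos) auto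
  moreover have "gamma1 N \<beta> * gamma2 N \<beta> > 0" unfolding prod using N by simp
  ultimately show "0 < gamma1 N \<beta>" by (simp add: zero_less_mult_iff)
qed

lemma disc_pos_if_beta0:
  assumes N: "N \<ge> 3" and \<beta>: "\<beta> > beta0 N"
  shows "\<beta>\<^sup>2 * (real N - 2)\<^sup>2 > 4 * (real N - 2)" "\<beta>\<^sup>2 * (real N - 2) > 4"
proof -
  have x: "real N - 2 > 0" using N by simp
  have "(beta0 N)\<^sup>2 < \<beta>\<^sup>2"
    using \<beta> x by (intro power_strict_mono) (auto simp: beta0_def)
  then have "4 / (real N - 2) < \<beta>\<^sup>2" using x by (simp add: beta0_def power_divide)
  then show 4: "\<beta>\<^sup>2 * (real N - 2) > 4" using x by (simp add: divide_less_eq)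
  show "\<beta>\<^sup>2 * (real N - 2)\<^sup>2 > 4 * (real N - 2)"
    using mult_strict_right_mono[OF 4 x] by (simp add: power2_eq_square mult.assoc)
qed

text \<open>\<open>((real N + 2) / 2)\<^sup>2 - 4 * (real N - 2)\<close> is the square of
  \<open>(real N - 6) / 2\<close>, so \<open>\<beta>\<^sub>1\<close> is never smaller than
  \<open>\<beta>\<^sub>0\<close>.\<close>

lemma disc_pos_if_beta1:
  assumes N: "N \<ge> 3" and \<beta>: "\<beta> * (real N - 2) > (real N + 2) / 2"
  shows "\<beta>\<^sup>2 * (real N - 2)\<^sup>2 > 4 * (real N - 2)"
proof -
  have "((real N + 2) / 2)\<^sup>2 < (\<beta> * (real N - 2))\<^sup>2"
    using \<beta> by (intro power_strict_mono) auto
  moreover have "((real N + 2) / 2)\<^sup>2 - 4 * (real N - 2) = ((real N - 6) / 2)\<^sup>2"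
    by (simp add: power2_eq_square field_simps)
  moreover have "((real N - 6) / 2)\<^sup>2 \<ge> 0" by simp
  ultimately show ?thesis unfolding power_mult_distrib by linarith
qed

lemma beta1_eq: "N \<ge> 3 \<Longrightarrow> beta1 N = (real N + 2) / (2 * (real N - 2))"
  by (simp add: beta1_def m_exp_def)

theorem theorem1p1:
  fixes N :: nat and \<beta> :: real
  assumes N_def: "N = CARD('n::finite)"
    and N_ge: "N \<ge> 3"
    and beta_pos: "\<beta> > 0"
  shows
    "((N \<ge> 6 \<and> \<beta> > beta0 N \<or> 3 \<le> N \<and> N < 6 \<and> \<beta> > beta1 N) \<longrightarrow>
       (\<forall>B>0. \<exists>!f :: real ^ 'n \<Rightarrow> real.
          radial_smooth_positive_solution \<beta> f \<and> expansion_A B (gamma1 N \<beta>) f))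
     \<and>
     (3 \<le> N \<and> N < 6 \<and> beta0 N < \<beta> \<and> \<beta> < beta1 N \<longrightarrow>
       (\<forall>B<0. \<exists>!f :: real ^ 'n \<Rightarrow> real.
          radial_smooth_positive_solution \<beta> f \<and> expansion_A B (gamma1 N \<beta>) f))
     \<and>
     (3 \<le> N \<and> N < 6 \<and> \<beta> = beta1 N \<longrightarrow>
       gamma2 N \<beta> = 2 \<and>
       (\<forall>B>0.
          (\<exists>!f :: real ^ 'n \<Rightarrow> real.
             radial_smooth_positive_solution \<beta> f \<and> expansion_A B (gamma2 N \<beta>) f) \<and>
          (\<forall>f :: real ^ 'n \<Rightarrow> real.
             radial_smooth_positive_solution \<beta> f \<and> expansion_A B (gamma2 N \<beta>) f \<longrightarrow>
             (\<exists>l>0. \<forall>y. f y = (C_star N / (l\<^sup>2 + (norm y)\<^sup>2)) powr (1 / n_exp N)))))"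
proof -
  define k where "k = (real N - 2) / 2"
  define p where "p = 1 + 2 / k"
  define b where "b = \<beta> * C_star N"
  have x: "real N - 2 > 0" using N_ge by simp
  then have k: "k > 0" by (simp add: k_def)
  note Cs = C_star_closed_form[OF N_ge]
  have p: "p = (real N + 2) / (real N - 2)" using x by (simp add: p_def k_def field_simps)
  have bp: "b * p = \<beta> * (real N - 2)"
    unfolding b_def Cs p using x by (simp add: power2_eq_square)
  have kp: "k\<^sup>2 * (p - 1) = real N - 2"
    using k by (simp add: p_def power2_eq_square) (simp add: k_def)
  interpret emden_params N k p b
  proof
    show "b > 0" using beta_pos x by (simp add: b_def Cs)
    show "real N = 2 * k + 2" by (simp add: k_def field_simps)
    show "k * (p - 1) = 2" using k by (simp add: p_def)
  qed (rule N_ge)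
  obtain G where "emden_profile N k p b G" by (rule profile_exists)
  then interpret emden_profile N k p b G .
  interpret self_similar N k p b G \<beta> "TYPE('n)"
    by unfold_locales (simp_all add: N_def[symmetric] b_def)
  have b1: "\<beta> < beta1 N \<longleftrightarrow> \<beta> * (real N - 2) < (real N + 2) / 2"
    "\<beta> > beta1 N \<longleftrightarrow> \<beta> * (real N - 2) > (real N + 2) / 2"
    using x by (auto simp: beta1_eq[OF N_ge] field_simps)
  \<comment> \<open>The characteristic polynomial at \<open>2\<close>. It changes sign at
    \<open>\<beta> = beta1 N\<close>, which decides how the roots lie relative to
    \<open>2\<close>.\<close>
  have at_2: "(2 - gamma1 N \<beta>) * (2 - gamma2 N \<beta>) = real N + 2 - 2 * (\<beta> * (real N - 2))"
    if disc: "\<beta>\<^sup>2 * (real N - 2)\<^sup>2 > 4 * (real N - 2)"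
  proof -
    have "(2 - gamma1 N \<beta>) * (2 - gamma2 N \<beta>) = 4 - 2 * (gamma1 N \<beta> + gamma2 N \<beta>) + gamma1 N \<beta> * gamma2 N \<beta>"
      by (simp add: algebra_simps)
    then show ?thesis unfolding gamma_sum_prod[OF N_ge disc beta_pos] by simp
  qed
  have part1: "\<exists>!f :: real ^ 'n \<Rightarrow> real. radial_smooth_positive_solution \<beta> f \<and> expansion_A B (gamma1 N \<beta>) f"
    if B: "B > 0" and cases: "N \<ge> 6 \<and> \<beta> > beta0 N \<or> N < 6 \<and> \<beta> > beta1 N" for B
  proof -
    have disc: "\<beta>\<^sup>2 * (real N - 2)\<^sup>2 > 4 * (real N - 2)"
      using cases disc_pos_if_beta0[OF N_ge] disc_pos_if_beta1[OF N_ge] b1 by blast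
    note g = gamma_sum_prod[OF N_ge disc beta_pos]
    \<comment> \<open>In dimension at least 6 the product \<open>real N - 2 \<ge> 4\<close> of the
      roots puts the larger one above \<open>2\<close>; in lower dimension
      \<open>\<beta> > beta1 N\<close> puts \<open>2\<close> between the roots.\<close>
    have g2: "gamma2 N \<beta> > 2"
    proof (cases "N \<ge> 6")
      case True
      then have "real N - 2 \<ge> 4" by simp
      then have "4 < gamma2 N \<beta> * gamma2 N \<beta>"
        using g(2) mult_strict_right_mono[OF g(4), of "gamma2 N \<beta>"] g(3,4) by linarith
      then have "2\<^sup>2 < (gamma2 N \<beta>)\<^sup>2" by (simp add: power2_eq_square)
      then show ?thesis using g(3,4) by (intro power_less_imp_less_base[of 2 2 "gamma2 N \<beta>"]) auto
    next
      case False
      then have "(2 - gamma1 N \<beta>) * (2 - gamma2 N \<beta>) < 0"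
        using at_2[OF disc] cases b1 by auto
      then show ?thesis using g(4) by (auto simp: mult_less_0_iff)
    qed
    obtain A where A: "A > 0" "((\<lambda>s. (1 - v s) * exp (gamma1 N \<beta> * s)) \<longlongrightarrow> A) at_top"
      using rate_from_below[OF _ _ g(3,4) g2] g(1,2) bp kp by metis
    have "((\<lambda>s. (v s - 1) * exp (gamma1 N \<beta> * s)) \<longlongrightarrow> - A) at_top"
      using tendsto_minus[OF A(2)] by (simp add: algebra_simps)
    then show ?thesis
      by (rule unique_solution_with_expansion) (use A B g(3) in auto)
  qed
  have part2: "\<exists>!f :: real ^ 'n \<Rightarrow> real. radial_smooth_positive_solution \<beta> f \<and> expansion_A B (gamma1 N \<beta>) f"
    if B: "B < 0" and N6: "N < 6" and \<beta>: "beta0 N < \<beta>" "\<beta> < beta1 N" for B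
  proof -
    have disc: "\<beta>\<^sup>2 * (real N - 2)\<^sup>2 > 4 * (real N - 2)"
      using disc_pos_if_beta0[OF N_ge] \<beta> by blast
    note g = gamma_sum_prod[OF N_ge disc beta_pos]
    have pos: "(2 - gamma1 N \<beta>) * (2 - gamma2 N \<beta>) > 0"
      using at_2[OF disc] \<beta> b1 by auto
    \<comment> \<open>Both roots lie on the same side of \<open>2\<close>; their product
      \<open>real N - 2 < 4\<close> excludes the upper side.\<close>
    have "gamma2 N \<beta> < 2"
    proof (rule ccontr)
      assume "\<not> gamma2 N \<beta> < 2"
      with pos have "gamma1 N \<beta> > 2" "gamma2 N \<beta> > 2" by (auto simp: zero_less_mult_iff)
      then have "gamma1 N \<beta> * gamma2 N \<beta> > 2 * 2" by (intro mult_strict_mono) auto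
      then show False using g(2) N6 by simp
    qed
    then obtain A where A: "A > 0" "((\<lambda>s. (v s - 1) * exp (gamma1 N \<beta> * s)) \<longlongrightarrow> A) at_top"
      using rate_from_above[OF _ _ g(3,4)] g(1,2) bp kp by metis
    show ?thesis
      by (rule unique_solution_with_expansion[OF A(2)]) (use A B g(3) in \<open>auto simp: mult_pos_neg\<close>)
  qed
  have part3: "gamma2 N \<beta> = 2 \<and>
       (\<forall>B>0.
          (\<exists>!f :: real ^ 'n \<Rightarrow> real.
             radial_smooth_positive_solution \<beta> f \<and> expansion_A B (gamma2 N \<beta>) f) \<and>
          (\<forall>f :: real ^ 'n \<Rightarrow> real.
             radial_smooth_positive_solution \<beta> f \<and> expansion_A B (gamma2 N \<beta>) f \<longrightarrow>
             (\<exists>l>0. \<forall>y. f y = (C_star N / (l\<^sup>2 + (norm y)\<^sup>2)) powr (1 / n_exp N))))"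
    if N6: "N < 6" and \<beta>: "\<beta> = beta1 N"
  proof -
    have "u / (2 * z) * z = u / 2" if "z \<noteq> 0" for u z :: real
      using that by simp
    from this[of "real N - 2" "real N + 2"]
    have \<beta>N: "\<beta> * (real N - 2) = (real N + 2) / 2"
      unfolding \<beta> beta1_eq[OF N_ge] using x by auto
    \<comment> \<open>At \<open>beta1 N\<close> the discriminant is a perfect square, and
      \<open>N < 6\<close> fixes the sign of its root, so that \<open>2\<close> is the larger
      exponent.\<close>
    have D: "\<beta>\<^sup>2 * (real N - 2)\<^sup>2 - 4 * (real N - 2) = ((6 - real N) / 2)\<^sup>2"
      unfolding power_mult_distrib[symmetric] \<beta>N by (simp add: power2_eq_square field_simps)
    have g2: "gamma2 N \<beta> = 2"
      unfolding gamma2_def \<beta>N D real_sqrt_abs using N6 by (simp add: field_simps)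
    have "k + 2 = (real N + 2) / 2" by (simp add: k_def field_simps)
    then have "b * p = k * p" using bp \<beta>N kp_eq by linarith
    then have bk: "b = k" using p_greater_1 by simp
    show ?thesis
      unfolding g2
    proof (intro conjI allI impI refl)
      fix B :: real assume B: "B > 0"
      show "\<exists>!f :: real ^ 'n \<Rightarrow> real. radial_smooth_positive_solution \<beta> f \<and> expansion_A B 2 f"
        by (rule unique_solution_with_expansion[OF explicit_orbit_limit[OF bk]]) (use B k in auto)
    next
      fix B :: real and f :: "real ^ 'n \<Rightarrow> real"
      assume "radial_smooth_positive_solution \<beta> f \<and> expansion_A B 2 f"
      then obtain \<mu> where \<mu>: "\<mu> > 0" "f = sol \<mu>" using solution_is_sol by blast
      show "\<exists>l>0. \<forall>y. f y = (C_star N / (l\<^sup>2 + (norm y)\<^sup>2)) powr (1 / n_exp N)"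
        using explicit_sol[OF bk \<mu>(1)] \<mu> by (intro exI[of _ "1 / \<mu>"]) auto
    qed
  qed
  show ?thesis
  proof (rule conjI[OF _ conjI])
    show "(N \<ge> 6 \<and> \<beta> > beta0 N \<or> 3 \<le> N \<and> N < 6 \<and> \<beta> > beta1 N) \<longrightarrow>
       (\<forall>B>0. \<exists>!f :: real ^ 'n \<Rightarrow> real.
          radial_smooth_positive_solution \<beta> f \<and> expansion_A B (gamma1 N \<beta>) f)"
      by (intro impI allI part1) auto
  qed ((intro impI allI part2; simp)[1], rule impI, rule part3, simp_all)
qed

end
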